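(* The algebra $A_{ph}^{\mathbb{Z}^+}$ is chiral with respect to isometric isomorphisms; that is, there is no isometric algebra isomorphism from $A_{ph}^{\mathbb{Z}^+}$ onto its adjoint algebra $(A_{ph}^{\mathbb{Z}^+})^\ast=\{X^\ast : X\in A_{ph}^{\mathbb{Z}^+}\}$.
   Context: On $L^2(\mathbb{R})$ define the unitary operators $(M_\lambda f)(x)=e^{i\lambda x}f(x)$, $(D_\mu f)(x)=f(x-\mu)$, $(V_tf)(x)=e^{t/2}f(e^tx)$ for $\lambda,\mu,t\in\mathbb{R}$. Let $\mathbb{Z}^+=\{0,1,2,\dots\}$. The algebra $A_{ph}^{\mathbb{Z}^+}$ is the operator-norm closed (non-selfadjoint) subalgebra of $B(L^2(\mathbb{R}))$ generated by $\{M_\lambda, D_\mu, V_t : \lambda,\mu\in[0,\infty),\ t\in\mathbb{Z}^+\}$. An isometric algebra isomorphism is a bijective (complex linear) algebra homomorphism that is isometric for the operator norms. *)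

theory Defs
  imports "HOL-Analysis.Analysis"
begin

section \<open>The Hilbert space of square-integrable functions on the real line\<close>

definition sq_integrable :: "(real \<Rightarrow> complex) \<Rightarrow> bool" where
  "sq_integrable f \<longleftrightarrow>
     f \<in> borel_measurable lborel \<and> integrable lborel (\<lambda>x. (cmod (f x))\<^sup>2)"

lemma sq_integrable_measurable:
  "sq_integrable f \<Longrightarrow> f \<in> borel_measurable lborel"
  by (simp add: sq_integrable_def)

lemma sq_integrable_zero: "sq_integrable (\<lambda>x. 0)"
  by (simp add: sq_integrable_def)

lemma sq_integrable_add:
  assumes f: "sq_integrable f" and g: "sq_integrable g"
  shows "sq_integrable (\<lambda>x. f x + g x)"
proof -
  note [measurable] = sq_integrable_measurable[OF f] sq_integrable_measurable[OF g]
  have int: "integrable lborel (\<lambda>x. 2 * (cmod (f x))\<^sup>2 + 2 * (cmod (g x))\<^sup>2)"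
    using f g by (auto simp: sq_integrable_def)
  have bound: "(cmod (f x + g x))\<^sup>2 \<le> 2 * (cmod (f x))\<^sup>2 + 2 * (cmod (g x))\<^sup>2" for x
  proof -
    have "(cmod (f x + g x))\<^sup>2 \<le> (cmod (f x) + cmod (g x))\<^sup>2"
      by (intro power_mono norm_triangle_ineq) auto
    also have "\<dots> \<le> 2 * (cmod (f x))\<^sup>2 + 2 * (cmod (g x))\<^sup>2"
      using sum_squares_bound[of "cmod (f x)" "cmod (g x)"] unfolding power2_sum by linarith
    finally show ?thesis .
  qed
  have "integrable lborel (\<lambda>x. (cmod (f x + g x))\<^sup>2)"
    by (rule Bochner_Integration.integrable_bound[OF int]) (use bound in auto)
  then show ?thesis
    by (simp add: sq_integrable_def)
qed

lemma sq_integrable_mult_left: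
  assumes f: "sq_integrable f"
  shows "sq_integrable (\<lambda>x. c * f x)"
  using f by (auto simp: sq_integrable_def norm_mult power_mult_distrib)

lemma sq_integrable_scaleR: "sq_integrable f \<Longrightarrow> sq_integrable (\<lambda>x. r *\<^sub>R f x)"
  by (simp add: scaleR_conv_of_real sq_integrable_mult_left)

lemma sq_integrable_uminus: "sq_integrable f \<Longrightarrow> sq_integrable (\<lambda>x. - f x)"
  using sq_integrable_mult_left[of f "-1"] by simp

lemma sq_integrable_diff:
  "sq_integrable f \<Longrightarrow> sq_integrable g \<Longrightarrow> sq_integrable (\<lambda>x. f x - g x)"
  using sq_integrable_add[OF _ sq_integrable_uminus, of f g] by simp

lemma integrable_mult_cnj:
  assumes f: "sq_integrable f" and g: "sq_integrable g"
  shows "integrable lborel (\<lambda>x. f x * cnj (g x))"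
proof -
  note [measurable] = sq_integrable_measurable[OF f] sq_integrable_measurable[OF g]
  have [measurable]: "cnj \<in> borel_measurable borel"
    by (intro borel_measurable_continuous_onI continuous_intros)
  have int: "integrable lborel (\<lambda>x. (cmod (f x))\<^sup>2 + (cmod (g x))\<^sup>2)"
    using f g by (auto simp: sq_integrable_def)
  have bound: "cmod (f x * cnj (g x)) \<le> (cmod (f x))\<^sup>2 + (cmod (g x))\<^sup>2" for x
    using sum_squares_bound[of "cmod (f x)" "cmod (g x)"]
      mult_nonneg_nonneg[OF norm_ge_zero norm_ge_zero, of "f x" "g x"]
    unfolding norm_mult complex_mod_cnj by linarith
  show ?thesis
    by (rule Bochner_Integration.integrable_bound[OF int _ AE_I2]) (measurable, use bound in auto)
qed

definition L2_rel :: "(real \<Rightarrow> complex) \<Rightarrow> (real \<Rightarrow> complex) \<Rightarrow> bool" where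
  "L2_rel f g \<longleftrightarrow> sq_integrable f \<and> sq_integrable g \<and> (AE x in lborel. f x = g x)"

quotient_type L2 = "real \<Rightarrow> complex" / partial: L2_rel
proof (rule part_equivpI)
  show "\<exists>f. L2_rel f f"
    using sq_integrable_zero by (auto simp: L2_rel_def)
  show "symp L2_rel"
    by (auto simp: symp_def L2_rel_def)
  show "transp L2_rel"
    by (auto simp: transp_def L2_rel_def)
qed

instantiation L2 :: real_vector
begin

lift_definition zero_L2 :: L2 is "\<lambda>x. 0"
  by (simp add: L2_rel_def sq_integrable_zero)

lift_definition plus_L2 :: "L2 \<Rightarrow> L2 \<Rightarrow> L2" is "\<lambda>f g x. f x + g x"
  by (auto simp: L2_rel_def sq_integrable_add)

lift_definition uminus_L2 :: "L2 \<Rightarrow> L2" is "\<lambda>f x. - f x"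
  by (auto simp: L2_rel_def sq_integrable_uminus)

lift_definition minus_L2 :: "L2 \<Rightarrow> L2 \<Rightarrow> L2" is "\<lambda>f g x. f x - g x"
  by (auto simp: L2_rel_def sq_integrable_diff)

lift_definition scaleR_L2 :: "real \<Rightarrow> L2 \<Rightarrow> L2" is "\<lambda>r f x. r *\<^sub>R f x"
  by (auto simp: L2_rel_def sq_integrable_scaleR)

instance
proof
  fix f g h :: L2 and r s :: real
  show "f + g + h = f + (g + h)"
    by transfer (simp add: L2_rel_def sq_integrable_add add.assoc)
  show "f + g = g + f"
    by transfer (simp add: L2_rel_def sq_integrable_add add.commute)
  show "0 + f = f"
    by transfer (simp add: L2_rel_def)
  show "- f + f = 0"
    by transfer (simp add: L2_rel_def sq_integrable_zero)
  show "f - g = f + - g"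
    by transfer (simp add: L2_rel_def sq_integrable_diff)
  show "r *\<^sub>R (f + g) = r *\<^sub>R f + r *\<^sub>R g"
    by transfer (simp add: L2_rel_def sq_integrable_add sq_integrable_scaleR scaleR_add_right)
  show "(r + s) *\<^sub>R f = r *\<^sub>R f + s *\<^sub>R f"
    by transfer (simp add: L2_rel_def sq_integrable_add sq_integrable_scaleR scaleR_add_left)
  show "r *\<^sub>R s *\<^sub>R f = (r * s) *\<^sub>R f"
    by transfer (simp add: L2_rel_def sq_integrable_scaleR)
  show "1 *\<^sub>R f = f"
    by transfer (simp add: L2_rel_def)
qed

end

lift_definition scaleC_L2 :: "complex \<Rightarrow> L2 \<Rightarrow> L2" is "\<lambda>c f x. c * f x"
  by (auto simp: L2_rel_def sq_integrable_mult_left)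

lift_definition cinner_L2 :: "L2 \<Rightarrow> L2 \<Rightarrow> complex" is
  "\<lambda>f g. LINT x|lborel. f x * cnj (g x)"
proof -
  fix f f' g g' assume "L2_rel f f'" "L2_rel g g'"
  then have rel: "sq_integrable f" "sq_integrable f'" "sq_integrable g" "sq_integrable g'"
    "AE x in lborel. f x = f' x" "AE x in lborel. g x = g' x"
    by (auto simp: L2_rel_def)
  have "AE x in lborel. f x * cnj (g x) = f' x * cnj (g' x)"
    using rel(5,6) by eventually_elim simp
  then show "(LINT x|lborel. f x * cnj (g x)) = (LINT x|lborel. f' x * cnj (g' x))"
    by (intro integral_cong_AE borel_measurable_integrable integrable_mult_cnj rel)
qed

instantiation L2 :: real_inner
begin

definition inner_L2 :: "L2 \<Rightarrow> L2 \<Rightarrow> real" where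
  "inner_L2 f g = Re (cinner_L2 f g)"

definition norm_L2 :: "L2 \<Rightarrow> real" where
  "norm_L2 f = sqrt (inner f f)"

definition sgn_L2 :: "L2 \<Rightarrow> L2" where
  "sgn_L2 f = f /\<^sub>R norm f"

definition dist_L2 :: "L2 \<Rightarrow> L2 \<Rightarrow> real" where
  "dist_L2 f g = norm (f - g)"

definition uniformity_L2 :: "(L2 \<times> L2) filter" where
  "uniformity_L2 = (INF e\<in>{0 <..}. principal {(x, y). dist x y < e})"

definition open_L2 :: "L2 set \<Rightarrow> bool" where
  "open_L2 U \<longleftrightarrow> (\<forall>x\<in>U. eventually (\<lambda>(x', y). x' = x \<longrightarrow> y \<in> U) uniformity)"

instance
proof
  fix x y z :: L2 and r :: real
  show "inner x y = inner y x"
    unfolding inner_L2_def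
  proof transfer
    fix f g assume "L2_rel f f" "L2_rel g g"
    have "(LINT t|lborel. g t * cnj (f t)) = (LINT t|lborel. cnj (f t * cnj (g t)))"
      by (simp add: mult.commute)
    also have "\<dots> = cnj (LINT t|lborel. f t * cnj (g t))"
      by (rule Bochner_Integration.integral_cnj)
    finally show "Re (LINT t|lborel. f t * cnj (g t)) = Re (LINT t|lborel. g t * cnj (f t))"
      by simp
  qed
  show "inner (x + y) z = inner x z + inner y z"
    unfolding inner_L2_def
    by transfer (simp add: L2_rel_def distrib_right integrable_mult_cnj)
  show "inner (r *\<^sub>R x) y = r * inner x y"
    unfolding inner_L2_def by transfer simp
  show "0 \<le> inner x x"
    unfolding inner_L2_def
    by transfer (simp add: complex_norm_square[symmetric] del: of_real_power)
  show "inner x x = 0 \<longleftrightarrow> x = 0"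
    unfolding inner_L2_def
  proof transfer
    fix f assume "L2_rel f f"
    then have f: "sq_integrable f" by (simp add: L2_rel_def)
    have "(Re (LINT t|lborel. f t * cnj (f t)) = 0) = ((LINT t|lborel. (cmod (f t))\<^sup>2) = 0)"
      by (simp add: complex_norm_square[symmetric] del: of_real_power)
    also have "\<dots> = (AE t in lborel. (cmod (f t))\<^sup>2 = 0)"
      using f by (intro integral_nonneg_eq_0_iff_AE) (auto simp: sq_integrable_def)
    finally show "(Re (LINT t|lborel. f t * cnj (f t)) = 0) = L2_rel f (\<lambda>t. 0)"
      using f by (simp add: L2_rel_def sq_integrable_zero)
  qed
qed (simp_all add: norm_L2_def sgn_L2_def dist_L2_def uniformity_L2_def open_L2_def)

end

lemma norm_scaleC_L2: "norm (scaleC_L2 c f) = cmod c * norm f"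
proof -
  have "cinner_L2 (scaleC_L2 c f) (scaleC_L2 c f) = of_real ((cmod c)\<^sup>2) * cinner_L2 f f"
  proof transfer
    fix c :: complex and f :: "real \<Rightarrow> complex"
    have "c * f x * cnj (c * f x) = of_real ((cmod c)\<^sup>2) * (f x * cnj (f x))" for x
      by (simp only: complex_norm_square complex_cnj_mult mult_ac)
    then show "(LINT x|lborel. c * f x * cnj (c * f x)) =
        of_real ((cmod c)\<^sup>2) * (LINT x|lborel. f x * cnj (f x))"
      by (simp only: Bochner_Integration.integral_mult_right_zero)
  qed
  then show ?thesis
    by (simp add: norm_L2_def inner_L2_def real_sqrt_mult)
qed

lemma scaleC_L2_add: "scaleC_L2 c (f + g) = scaleC_L2 c f + scaleC_L2 c g"
  by transfer (auto simp: L2_rel_def distrib_left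
      intro!: sq_integrable_add sq_integrable_mult_left)

lemma scaleC_L2_scaleR: "scaleC_L2 c (r *\<^sub>R f) = r *\<^sub>R scaleC_L2 c f"
  by transfer (auto simp: L2_rel_def scaleR_conv_of_real mult.left_commute
      intro!: sq_integrable_mult_left)

lemma bounded_linear_scaleC_L2: "bounded_linear (scaleC_L2 c)"
  by (rule bounded_linear_intro[of _ "cmod c"])
    (simp_all add: scaleC_L2_add scaleC_L2_scaleR norm_scaleC_L2)


section \<open>Bounded operators and closed operator algebras\<close>

text \<open>
  The type \<^typ>\<open>L2 \<Rightarrow>\<^sub>L L2\<close> consists of the bounded real-linear maps; its norm is the
  operator norm, its multiplication \<^const>\<open>blinfun_compose\<close>.
  The complex-linear ones among them form the algebra of all bounded operators on the Hilbert space.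
\<close>

definition bounded_ops :: "(L2 \<Rightarrow>\<^sub>L L2) set" where
  "bounded_ops = {X. \<forall>c f. blinfun_apply X (scaleC_L2 c f) = scaleC_L2 c (blinfun_apply X f)}"

definition scaleC_op :: "complex \<Rightarrow> (L2 \<Rightarrow>\<^sub>L L2) \<Rightarrow> (L2 \<Rightarrow>\<^sub>L L2)" where
  "scaleC_op c X = Blinfun (\<lambda>f. scaleC_L2 c (blinfun_apply X f))"

lemma scaleC_op_apply: "blinfun_apply (scaleC_op c X) f = scaleC_L2 c (blinfun_apply X f)"
  unfolding scaleC_op_def
  by (subst bounded_linear_Blinfun_apply)
    (auto intro: bounded_linear_compose[OF bounded_linear_scaleC_L2] blinfun.bounded_linear_right)

definition op_algebra :: "(L2 \<Rightarrow>\<^sub>L L2) set \<Rightarrow> bool" where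
  "op_algebra A \<longleftrightarrow> A \<subseteq> bounded_ops \<and> 0 \<in> A \<and>
     (\<forall>X\<in>A. \<forall>Y\<in>A. X + Y \<in> A) \<and> (\<forall>c. \<forall>X\<in>A. scaleC_op c X \<in> A) \<and>
     (\<forall>X\<in>A. \<forall>Y\<in>A. X o\<^sub>L Y \<in> A)"

definition closed_op_algebra :: "(L2 \<Rightarrow>\<^sub>L L2) set \<Rightarrow> bool" where
  "closed_op_algebra A \<longleftrightarrow> op_algebra A \<and> closed A"

lemma scaleC_L2_mult: "scaleC_L2 c (scaleC_L2 d f) = scaleC_L2 d (scaleC_L2 c f)"
  by transfer (auto simp: L2_rel_def mult.left_commute intro!: sq_integrable_mult_left)

text \<open>
  This guarantees that \<^term>\<open>closed_op_algebra hull S\<close> is the smallest closed algebra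
  containing \<^term>\<open>S\<close> whenever \<^term>\<open>S\<close> is a set of bounded operators.
\<close>

lemma closed_op_algebra_bounded_ops: "closed_op_algebra bounded_ops"
proof -
  interpret scale: bounded_linear "scaleC_L2 c" for c
    by (rule bounded_linear_scaleC_L2)
  have "bounded_ops = (\<Inter>c. \<Inter>f. {X. blinfun_apply X (scaleC_L2 c f) = scaleC_L2 c (blinfun_apply X f)})"
    by (auto simp: bounded_ops_def)
  also have "closed \<dots>"
    by (intro closed_INT ballI closed_Collect_eq continuous_intros
        bounded_linear.continuous_on[OF bounded_linear_scaleC_L2])
  finally show ?thesis
    unfolding closed_op_algebra_def op_algebra_def
    by (auto simp: bounded_ops_def blinfun.add_left scaleC_op_apply scale.zero scaleC_L2_add
        intro: scaleC_L2_mult)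
qed

text \<open>
  Adjoints are taken with respect to the complex inner product; by the Riesz representation
  theorem every complex-linear bounded operator has exactly one adjoint, so
  the adjoint algebra of a set of such operators consists of the adjoints of all its elements.
\<close>

definition is_adjoint :: "(L2 \<Rightarrow>\<^sub>L L2) \<Rightarrow> (L2 \<Rightarrow>\<^sub>L L2) \<Rightarrow> bool" where
  "is_adjoint X Y \<longleftrightarrow> (\<forall>f g. cinner_L2 (blinfun_apply X f) g = cinner_L2 f (blinfun_apply Y g))"

definition adjoint_algebra :: "(L2 \<Rightarrow>\<^sub>L L2) set \<Rightarrow> (L2 \<Rightarrow>\<^sub>L L2) set" where
  "adjoint_algebra A = {Y. \<exists>X\<in>A. is_adjoint X Y}"

definition isometric_algebra_iso ::
  "((L2 \<Rightarrow>\<^sub>L L2) \<Rightarrow> (L2 \<Rightarrow>\<^sub>L L2)) \<Rightarrow> (L2 \<Rightarrow>\<^sub>L L2) set \<Rightarrow> (L2 \<Rightarrow>\<^sub>L L2) set \<Rightarrow> bool" where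
  "isometric_algebra_iso \<Phi> A B \<longleftrightarrow> bij_betw \<Phi> A B \<and>
     (\<forall>X\<in>A. \<forall>Y\<in>A. \<Phi> (X + Y) = \<Phi> X + \<Phi> Y) \<and>
     (\<forall>c. \<forall>X\<in>A. \<Phi> (scaleC_op c X) = scaleC_op c (\<Phi> X)) \<and>
     (\<forall>X\<in>A. \<forall>Y\<in>A. \<Phi> (X o\<^sub>L Y) = \<Phi> X o\<^sub>L \<Phi> Y) \<and>
     (\<forall>X\<in>A. norm (\<Phi> X) = norm X)"

definition chiral :: "(L2 \<Rightarrow>\<^sub>L L2) set \<Rightarrow> bool" where
  "chiral A \<longleftrightarrow> \<not> (\<exists>\<Phi>. isometric_algebra_iso \<Phi> A (adjoint_algebra A))"


section \<open>Multiplication, translation and dilation operators\<close>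

lemma sq_integrable_cis_mult:
  assumes f: "sq_integrable f"
  shows "sq_integrable (\<lambda>x. cis (l * x) * f x)"
proof -
  note [measurable] = sq_integrable_measurable[OF f]
  have [measurable]: "cis \<in> borel_measurable borel"
    by (intro borel_measurable_continuous_onI continuous_intros)
  have "(\<lambda>x. cis (l * x) * f x) \<in> borel_measurable lborel"
    by measurable
  with f show ?thesis
    by (simp add: sq_integrable_def norm_mult)
qed

lemma sq_integrable_affine:
  assumes f: "sq_integrable f" and c: "c \<noteq> 0"
  shows "sq_integrable (\<lambda>x. f (t + c * x))"
proof -
  note [measurable] = sq_integrable_measurable[OF f]
  have "integrable lborel (\<lambda>x. (cmod (f (t + c * x)))\<^sup>2)"
    using f lborel_integrable_real_affine[of "\<lambda>x. (cmod (f x))\<^sup>2" c t] c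
    by (simp add: sq_integrable_def)
  then show ?thesis
    by (simp add: sq_integrable_def)
qed

lemma sq_integrable_translate: "sq_integrable f \<Longrightarrow> sq_integrable (\<lambda>x. f (x - m))"
  using sq_integrable_affine[of f 1 "- m"] by simp

lemma sq_integrable_dilate:
  "sq_integrable f \<Longrightarrow> sq_integrable (\<lambda>x. complex_of_real (exp (t / 2)) * f (exp t * x))"
  using sq_integrable_affine[of f "exp t" 0] by (auto intro!: sq_integrable_mult_left)

lemma L2_rel_affine:
  assumes "L2_rel f g" and c: "c \<noteq> 0"
  shows "AE x in lborel. f (t + c * x) = g (t + c * x)"
proof -
  have rel: "sq_integrable f" "sq_integrable g" "AE x in lborel. f x = g x"
    using assms by (auto simp: L2_rel_def)
  note [measurable] = sq_integrable_measurable[OF rel(1)] sq_integrable_measurable[OF rel(2)]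
  show ?thesis
    by (rule AE_borel_affine[OF c _ rel(3)]) measurable
qed

lift_definition mult_L2 :: "real \<Rightarrow> L2 \<Rightarrow> L2" is
  "\<lambda>l f x. cis (l * x) * f x"
  unfolding L2_rel_def by (auto intro: sq_integrable_cis_mult)

lift_definition translate_L2 :: "real \<Rightarrow> L2 \<Rightarrow> L2" is "\<lambda>m f x. f (x - m)"
  subgoal for m f g
    using L2_rel_affine[of f g 1 "- m"] by (simp add: L2_rel_def sq_integrable_translate)
  done

lift_definition dilate_L2 :: "real \<Rightarrow> L2 \<Rightarrow> L2" is
  "\<lambda>t f x. complex_of_real (exp (t / 2)) * f (exp t * x)"
  subgoal for t f g
    using L2_rel_affine[of f g "exp t" 0] by (simp add: L2_rel_def sq_integrable_dilate)
  done

lemma norm_L2_eqI: "cinner_L2 f f = cinner_L2 g g \<Longrightarrow> norm f = norm g"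
  by (simp add: norm_L2_def inner_L2_def)

lemma norm_mult_L2: "norm (mult_L2 l f) = norm f"
proof (rule norm_L2_eqI, transfer)
  fix l :: real and f :: "real \<Rightarrow> complex"
  have "cis (l * x) * f x * cnj (cis (l * x) * f x) = f x * cnj (f x)" for x
    by (simp only: complex_norm_square[symmetric] norm_mult norm_cis mult_1)
  then show "(LINT x|lborel. cis (l * x) * f x * cnj (cis (l * x) * f x)) =
      (LINT x|lborel. f x * cnj (f x))"
    by (simp only:)
qed

lemma norm_translate_L2: "norm (translate_L2 m f) = norm f"
proof (rule norm_L2_eqI, transfer)
  fix m :: real and f :: "real \<Rightarrow> complex"
  show "(LINT x|lborel. f (x - m) * cnj (f (x - m))) = (LINT x|lborel. f x * cnj (f x))"
    using lborel_integral_real_affine[of 1 "\<lambda>x. f x * cnj (f x)" "- m"] by simp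
qed

lemma norm_dilate_L2: "norm (dilate_L2 t f) = norm f"
proof (rule norm_L2_eqI, transfer)
  fix t :: real and f :: "real \<Rightarrow> complex"
  have *: "complex_of_real (exp (t / 2)) * a * cnj (complex_of_real (exp (t / 2)) * b)
      = exp t *\<^sub>R (a * cnj b)" for a b
  proof -
    have "exp (t / 2) * exp (t / 2) = exp t"
      by (simp flip: exp_add)
    then have "complex_of_real (exp (t / 2)) * complex_of_real (exp (t / 2)) = complex_of_real (exp t)"
      by (metis of_real_mult)
    then show ?thesis
      by (simp add: scaleR_conv_of_real mult_ac)
  qed
  show "(LINT x|lborel. complex_of_real (exp (t / 2)) * f (exp t * x) *
      cnj (complex_of_real (exp (t / 2)) * f (exp t * x))) = (LINT x|lborel. f x * cnj (f x))"
    unfolding * using lborel_integral_real_affine[of "exp t" "\<lambda>x. f x * cnj (f x)" 0] by simp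
qed

lemma bounded_linear_mult_L2: "bounded_linear (mult_L2 l)"
proof (rule bounded_linear_intro[of _ 1])
  fix r and f g :: L2
  show "mult_L2 l (f + g) = mult_L2 l f + mult_L2 l g"
    by transfer (auto simp: L2_rel_def distrib_left
        intro!: sq_integrable_add sq_integrable_cis_mult)
  show "mult_L2 l (r *\<^sub>R f) = r *\<^sub>R mult_L2 l f"
    by transfer (auto simp: L2_rel_def scaleR_conv_of_real mult.left_commute
        intro!: sq_integrable_mult_left sq_integrable_cis_mult)
  show "norm (mult_L2 l f) \<le> norm f * 1"
    by (simp add: norm_mult_L2)
qed

lemma bounded_linear_translate_L2: "bounded_linear (translate_L2 m)"
proof (rule bounded_linear_intro[of _ 1])
  fix r and f g :: L2
  show "translate_L2 m (f + g) = translate_L2 m f + translate_L2 m g"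
    by transfer (auto simp: L2_rel_def distrib_left
        intro!: sq_integrable_add sq_integrable_translate)
  show "translate_L2 m (r *\<^sub>R f) = r *\<^sub>R translate_L2 m f"
    by transfer (auto simp: L2_rel_def scaleR_conv_of_real mult.left_commute
        intro!: sq_integrable_mult_left sq_integrable_translate)
  show "norm (translate_L2 m f) \<le> norm f * 1"
    by (simp add: norm_translate_L2)
qed

lemma bounded_linear_dilate_L2: "bounded_linear (dilate_L2 t)"
proof (rule bounded_linear_intro[of _ 1])
  fix r and f g :: L2
  show "dilate_L2 t (f + g) = dilate_L2 t f + dilate_L2 t g"
    by transfer (auto simp: L2_rel_def distrib_left
        intro!: sq_integrable_add sq_integrable_dilate)
  show "dilate_L2 t (r *\<^sub>R f) = r *\<^sub>R dilate_L2 t f"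
    by transfer (auto simp: L2_rel_def scaleR_conv_of_real mult.left_commute
        intro!: sq_integrable_mult_left sq_integrable_dilate)
  show "norm (dilate_L2 t f) \<le> norm f * 1"
    by (simp add: norm_dilate_L2)
qed

definition M_op :: "real \<Rightarrow> (L2 \<Rightarrow>\<^sub>L L2)" where
  "M_op l = Blinfun (mult_L2 l)"

definition D_op :: "real \<Rightarrow> (L2 \<Rightarrow>\<^sub>L L2)" where
  "D_op m = Blinfun (translate_L2 m)"

definition V_op :: "real \<Rightarrow> (L2 \<Rightarrow>\<^sub>L L2)" where
  "V_op t = Blinfun (dilate_L2 t)"

definition A_ph_gens :: "(L2 \<Rightarrow>\<^sub>L L2) set" where
  "A_ph_gens = M_op ` {0..} \<union> D_op ` {0..} \<union> range (\<lambda>n :: nat. V_op (real n))"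

lemma A_ph_gens_bounded_ops: "A_ph_gens \<subseteq> bounded_ops"
proof -
  have "mult_L2 l (scaleC_L2 c f) = scaleC_L2 c (mult_L2 l f)" for l c f
    by transfer (auto simp: L2_rel_def mult.left_commute
        intro!: sq_integrable_mult_left sq_integrable_cis_mult)
  moreover have "translate_L2 m (scaleC_L2 c f) = scaleC_L2 c (translate_L2 m f)" for m c f
    by transfer (auto simp: L2_rel_def intro!: sq_integrable_mult_left sq_integrable_translate)
  moreover have "dilate_L2 t (scaleC_L2 c f) = scaleC_L2 c (dilate_L2 t f)" for t c f
    by transfer (auto simp: L2_rel_def mult.left_commute
        intro!: sq_integrable_mult_left sq_integrable_dilate)
  ultimately show ?thesis
    by (auto simp: A_ph_gens_def bounded_ops_def M_op_def D_op_def V_op_def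
        bounded_linear_Blinfun_apply[OF bounded_linear_mult_L2]
        bounded_linear_Blinfun_apply[OF bounded_linear_translate_L2]
        bounded_linear_Blinfun_apply[OF bounded_linear_dilate_L2])
qed

definition A_ph :: "(L2 \<Rightarrow>\<^sub>L L2) set" where
  "A_ph = closed_op_algebra hull A_ph_gens"

lemma closed_op_algebra_A_ph: "closed_op_algebra A_ph"
proof -
  let ?T = "{A. closed_op_algebra A \<and> A_ph_gens \<subseteq> A}"
  have "bounded_ops \<in> ?T"
    using closed_op_algebra_bounded_ops A_ph_gens_bounded_ops by simp
  then have "op_algebra (\<Inter>?T)"
    unfolding op_algebra_def
    by (intro conjI) (simp_all add: Inter_lower closed_op_algebra_def op_algebra_def)
  moreover have "closed (\<Inter>?T)"
    by (intro closed_Inter) (auto simp: closed_op_algebra_def)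
  ultimately show ?thesis
    by (simp add: A_ph_def hull_def closed_op_algebra_def)
qed

end

theory Submission
  imports Defs "HOL-Complex_Analysis.Complex_Analysis"
begin

text \<open>
  Suppose that \<open>\<Phi>\<close> were an isometric isomorphism of the algebra \<open>A\<close> onto its adjoint algebra.
  Following \<open>\<Phi>\<close> by the adjoint gives an isometric, conjugate-linear anti-automorphism \<open>\<Psi>\<close> with values in
  \<open>A\<close> and with the generators in its range. The relations between the generators are
  \<open>V M\<^sub>\<lambda> = M\<^bsub>e\<lambda>\<^esub> V\<close>, \<open>V D\<^sub>\<mu> = D\<^bsub>\<mu>/e\<^esub> V\<close> and \<open>M\<^sub>\<lambda> D\<^sub>\<mu> = e\<^bsup>i\<lambda>\<mu>\<^esup> D\<^sub>\<mu> M\<^sub>\<lambda>\<close>.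
  Reversing the order of products exchanges the roles of \<open>M\<close> and \<open>D\<close> in the first two relations, so
  \<open>\<Psi>\<close> ought to send \<open>M\<^sub>\<lambda>\<close> to a multiple of some \<open>D\<^sub>b\<close> and \<open>D\<^sub>\<mu>\<close> to a multiple of some \<open>M\<^sub>a\<close>,
  with \<open>a, b > 0\<close>. The third relation then requires \<open>e\<^bsup>-iab\<^esup> = e\<^bsup>i\<lambda>\<mu>\<^esup>\<close>, where \<open>ab\<close> is proportional to
  \<open>\<lambda>\<mu>\<close>, and this fails for a suitable choice of \<open>\<lambda>\<close> and \<open>\<mu>\<close>.

  The work is to show that \<open>\<Psi>\<close> has this form to a sufficient extent. For \<open>z\<close> in the upper half-plane,
  \<open>M\<^sub>a \<mapsto> e\<^bsup>iaz\<^esup>\<close> with \<open>D\<^sub>b\<close> (\<open>b > 0\<close>) and \<open>V\<close> sent to zero is a contractive character of \<open>A\<close>, and keeping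
  the terms of first order in \<open>V\<close> as well yields a representation by triangular matrices of size two
  (\<open>symb_0_compose\<close>, \<open>symb_1_compose\<close>); there is a second such family with \<open>M\<close> and \<open>D\<close> exchanged.
  These functions of \<open>z\<close> are holomorphic. Evaluated on the images under \<open>\<Psi>\<close> of the generators, the
  characters satisfy the relations as identities between scalars. The phase \<open>e\<^bsup>i\<lambda>\<mu>\<^esup>\<close> makes one of the two
  one-parameter families vanish; the triangular representation has to remain noncommutative, which forces
  the diagonal part of \<open>\<Psi> V\<close> to vanish and its first-order part not to (\<open>symb_0_W\<close>, \<open>symb_1_W_nonzero\<close>).
  What remains of the relations with \<open>V\<close> are scaling laws (\<open>symb_T_scaling\<close>).

  The scaling law of one family is incompatible with almost periodicity (\<open>symb_T_same_vanishes\<close>).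
  That of the other family says that a logarithm of its character is, at the points \<open>i\<close> and \<open>ei\<close>, in
  the equality case of the Schwarz--Pick lemma, so that the character is exactly \<open>C e\<^bsup>ikz\<^esup>\<close> with
  \<open>k > 0\<close> and \<open>|C| = 1\<close> (\<open>symb_T_other_exponential\<close>). The image is thus a contraction with a Fourier
  coefficient of modulus one. On a sequence of chirps, for which all distinct monomials become
  orthogonal, Bessel's inequality leaves no room for other terms (\<open>coef_modulus_one\<close>), and the
  phases can be compared there (\<open>no_anti_automorphism\<close>).
\<close>

section \<open>Inner products and generators\<close>

lemma cinner_add_left: "cinner_L2 (f + g) h = cinner_L2 f h + cinner_L2 g h"
  by transfer (simp add: L2_rel_def distrib_right integrable_mult_cnj)

lemma cinner_scaleC_left: "cinner_L2 (scaleC_L2 c f) h = c * cinner_L2 f h"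
  by transfer (simp add: mult.assoc)

lemma cinner_commute: "cinner_L2 g f = cnj (cinner_L2 f g)"
proof transfer
  fix f g :: "real \<Rightarrow> complex"
  have "(LINT t|lborel. g t * cnj (f t)) = (LINT t|lborel. cnj (f t * cnj (g t)))"
    by (simp add: mult.commute)
  also have "\<dots> = cnj (LINT t|lborel. f t * cnj (g t))"
    by (rule Bochner_Integration.integral_cnj)
  finally show "(LINT t|lborel. g t * cnj (f t)) = cnj (LINT t|lborel. f t * cnj (g t))" .
qed

lemma cinner_add_right: "cinner_L2 h (f + g) = cinner_L2 h f + cinner_L2 h g"
  using cinner_add_left[of f g h] by (metis cinner_commute complex_cnj_add)

lemma cinner_scaleC_right: "cinner_L2 h (scaleC_L2 c f) = cnj c * cinner_L2 h f"
  using cinner_scaleC_left[of c f h] by (metis cinner_commute complex_cnj_mult)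

lemma scaleC_minus_one: "scaleC_L2 (- 1) f = - f"
  by transfer (simp add: L2_rel_def sq_integrable_uminus)

lemma scaleC_one: "scaleC_L2 1 f = f"
  by transfer (simp add: L2_rel_def)

lemma scaleC_scaleC: "scaleC_L2 c (scaleC_L2 d f) = scaleC_L2 (c * d) f"
  by transfer (simp add: L2_rel_def sq_integrable_mult_left mult.assoc)

lemma scaleC_add_left: "scaleC_L2 (c + d) f = scaleC_L2 c f + scaleC_L2 d f"
  by transfer (simp add: L2_rel_def sq_integrable_mult_left sq_integrable_add distrib_right)

lemma cinner_diff_left: "cinner_L2 (f - g) h = cinner_L2 f h - cinner_L2 g h"
  using cinner_add_left[of f "scaleC_L2 (- 1) g" h]
  by (simp add: cinner_scaleC_left) (simp add: scaleC_minus_one)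

lemma cinner_self: "cinner_L2 f f = of_real ((norm f)\<^sup>2)"
proof -
  have "cnj (cinner_L2 f f) = cinner_L2 f f"
    by (metis cinner_commute)
  then have "cinner_L2 f f = of_real (Re (cinner_L2 f f))"
    by (metis Reals_cnj_iff of_real_Re)
  moreover have "Re (cinner_L2 f f) = (norm f)\<^sup>2"
    by (metis inner_L2_def power2_norm_eq_inner)
  ultimately show ?thesis by simp
qed

text \<open>Rotating \<open>f\<close> so that the complex inner product becomes real reduces the complex
  Cauchy--Schwarz inequality to the real one.\<close>

lemma cinner_Cauchy_Schwarz: "cmod (cinner_L2 f g) \<le> norm f * norm g"
proof (cases "cinner_L2 f g = 0")
  case False
  define u where "u = cnj (sgn (cinner_L2 f g))"
  have u: "cmod u = 1"
    using False by (simp add: u_def norm_sgn)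
  have "u * cinner_L2 f g = of_real (cmod (cinner_L2 f g))"
  proof -
    have "u * cinner_L2 f g = cinner_L2 f g * cnj (cinner_L2 f g) / of_real (cmod (cinner_L2 f g))"
      by (simp add: u_def sgn_div_norm scaleR_conv_of_real divide_inverse mult_ac)
    also have "\<dots> = of_real ((cmod (cinner_L2 f g))\<^sup>2 / cmod (cinner_L2 f g))"
      by (simp only: complex_norm_square[symmetric] of_real_divide)
    finally show ?thesis by (simp add: power2_eq_square)
  qed
  then have "cmod (cinner_L2 f g) = inner (scaleC_L2 u f) g"
    by (simp add: inner_L2_def cinner_scaleC_left)
  also have "\<dots> \<le> norm (scaleC_L2 u f) * norm g"
    by (rule norm_cauchy_schwarz)
  finally show ?thesis by (simp add: norm_scaleC_L2 u)
qed simp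

lemma M_op_apply: "blinfun_apply (M_op l) = mult_L2 l"
  and D_op_apply: "blinfun_apply (D_op m) = translate_L2 m"
  and V_op_apply: "blinfun_apply (V_op t) = dilate_L2 t"
  by (simp_all add: M_op_def D_op_def V_op_def bounded_linear_Blinfun_apply
      bounded_linear_mult_L2 bounded_linear_translate_L2 bounded_linear_dilate_L2)

lemma M_op_add: "M_op a o\<^sub>L M_op b = M_op (a + b)"
proof (rule blinfun_eqI)
  have "mult_L2 a (mult_L2 b f) = mult_L2 (a + b) f" for f
  proof transfer
    fix a b :: real and f assume f: "L2_rel f f"
    have "(\<lambda>x. cis (a * x) * (cis (b * x) * f x)) = (\<lambda>x. cis ((a + b) * x) * f x)"
      by (rule ext) (simp add: cis_mult distrib_right flip: mult.assoc)
    then show "L2_rel (\<lambda>x. cis (a * x) * (cis (b * x) * f x)) (\<lambda>x. cis ((a + b) * x) * f x)"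
      using f sq_integrable_cis_mult[of f "a + b"] by (simp add: L2_rel_def)
  qed
  then show "blinfun_apply (M_op a o\<^sub>L M_op b) f = blinfun_apply (M_op (a + b)) f" for f
    by (simp add: M_op_apply)
qed

lemma D_op_add: "D_op a o\<^sub>L D_op b = D_op (a + b)"
proof (rule blinfun_eqI)
  have "translate_L2 a (translate_L2 b f) = translate_L2 (a + b) f" for f
    by transfer (simp add: L2_rel_def sq_integrable_translate diff_diff_eq)
  then show "blinfun_apply (D_op a o\<^sub>L D_op b) f = blinfun_apply (D_op (a + b)) f" for f
    by (simp add: D_op_apply)
qed

lemma V_op_add: "V_op s o\<^sub>L V_op t = V_op (s + t)"
proof (rule blinfun_eqI)
  have "dilate_L2 s (dilate_L2 t f) = dilate_L2 (s + t) f" for f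
  proof transfer
    fix s t :: real and f assume f: "L2_rel f f"
    have "(\<lambda>x. complex_of_real (exp (s / 2)) * (complex_of_real (exp (t / 2)) * f (exp t * (exp s * x))))
      = (\<lambda>x. complex_of_real (exp ((s + t) / 2)) * f (exp (s + t) * x))"
      by (rule ext) (simp only: exp_add add_divide_distrib mult_ac of_real_mult)
    then show "L2_rel (\<lambda>x. complex_of_real (exp (s / 2)) * (complex_of_real (exp (t / 2)) * f (exp t * (exp s * x))))
      (\<lambda>x. complex_of_real (exp ((s + t) / 2)) * f (exp (s + t) * x))"
      using f sq_integrable_dilate[of f "s + t"] by (simp add: L2_rel_def)
  qed
  then show "blinfun_apply (V_op s o\<^sub>L V_op t) f = blinfun_apply (V_op (s + t)) f" for f
    by (simp add: V_op_apply)
qed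

lemma V_M_op: "V_op t o\<^sub>L M_op a = M_op (exp t * a) o\<^sub>L V_op t"
proof (rule blinfun_eqI)
  have "dilate_L2 t (mult_L2 a f) = mult_L2 (exp t * a) (dilate_L2 t f)" for f
  proof transfer
    fix t a :: real and f assume f: "L2_rel f f"
    have "(\<lambda>x. complex_of_real (exp (t / 2)) * (cis (a * (exp t * x)) * f (exp t * x)))
      = (\<lambda>x. cis (exp t * a * x) * (complex_of_real (exp (t / 2)) * f (exp t * x)))"
      by (rule ext) (simp add: mult_ac)
    then show "L2_rel (\<lambda>x. complex_of_real (exp (t / 2)) * (cis (a * (exp t * x)) * f (exp t * x)))
      (\<lambda>x. cis (exp t * a * x) * (complex_of_real (exp (t / 2)) * f (exp t * x)))"
      using f sq_integrable_cis_mult[OF sq_integrable_dilate[of f t], of "exp t * a"]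
      by (simp add: L2_rel_def)
  qed
  then show "blinfun_apply (V_op t o\<^sub>L M_op a) f = blinfun_apply (M_op (exp t * a) o\<^sub>L V_op t) f" for f
    by (simp add: M_op_apply V_op_apply)
qed

lemma V_D_op: "V_op t o\<^sub>L D_op b = D_op (exp (- t) * b) o\<^sub>L V_op t"
proof (rule blinfun_eqI)
  have "dilate_L2 t (translate_L2 b f) = translate_L2 (exp (- t) * b) (dilate_L2 t f)" for f
  proof transfer
    fix t b :: real and f assume f: "L2_rel f f"
    have "(\<lambda>x. complex_of_real (exp (t / 2)) * f (exp t * x - b))
      = (\<lambda>x. complex_of_real (exp (t / 2)) * f (exp t * (x - exp (- t) * b)))"
      by (rule ext) (simp add: right_diff_distrib flip: mult.assoc exp_add)
    then show "L2_rel (\<lambda>x. complex_of_real (exp (t / 2)) * f (exp t * x - b))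
      (\<lambda>x. complex_of_real (exp (t / 2)) * f (exp t * (x - exp (- t) * b)))"
      using f sq_integrable_dilate[OF sq_integrable_translate[of f b], of t] by (simp add: L2_rel_def)
  qed
  then show "blinfun_apply (V_op t o\<^sub>L D_op b) f = blinfun_apply (D_op (exp (- t) * b) o\<^sub>L V_op t) f" for f
    by (simp add: D_op_apply V_op_apply)
qed

lemma D_M_op: "D_op b o\<^sub>L M_op a = scaleC_op (cis (- (b * a))) (M_op a o\<^sub>L D_op b)"
proof (rule blinfun_eqI)
  have "translate_L2 b (mult_L2 a f) = scaleC_L2 (cis (- (b * a))) (mult_L2 a (translate_L2 b f))" for f
  proof transfer
    fix a b :: real and f assume f: "L2_rel f f"
    have "cis (a * (x - b)) = cis (- (b * a)) * cis (a * x)" for x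
      by (simp add: cis_mult algebra_simps)
    then have "(\<lambda>x. cis (a * (x - b)) * f (x - b)) = (\<lambda>x. cis (- (b * a)) * (cis (a * x) * f (x - b)))"
      by (simp only: mult.assoc)
    then show "L2_rel (\<lambda>x. cis (a * (x - b)) * f (x - b)) (\<lambda>x. cis (- (b * a)) * (cis (a * x) * f (x - b)))"
      using f sq_integrable_translate[OF sq_integrable_cis_mult[of f a], of b] by (simp add: L2_rel_def)
  qed
  then show "blinfun_apply (D_op b o\<^sub>L M_op a) f
      = blinfun_apply (scaleC_op (cis (- (b * a))) (M_op a o\<^sub>L D_op b)) f" for f
    by (simp add: D_op_apply M_op_apply scaleC_op_apply)
qed

lemma M_op_0: "M_op 0 = id_blinfun"
  by (rule blinfun_eqI, simp add: M_op_apply, transfer) (simp add: L2_rel_def)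

lemma D_op_0: "D_op 0 = id_blinfun"
  by (rule blinfun_eqI, simp add: D_op_apply, transfer) (simp add: L2_rel_def)

lemma V_op_0: "V_op 0 = id_blinfun"
  by (rule blinfun_eqI, simp add: V_op_apply, transfer) (simp add: L2_rel_def)

lemma norm_op_le_1: "(\<And>f. norm (blinfun_apply X f) \<le> norm f) \<Longrightarrow> norm X \<le> 1"
  for X :: "L2 \<Rightarrow>\<^sub>L L2"
  by (rule norm_blinfun_bound) simp_all

lemma norm_M_op: "norm (M_op a) \<le> 1"
  and norm_D_op: "norm (D_op b) \<le> 1"
  by (auto intro!: norm_op_le_1 simp: M_op_apply D_op_apply norm_mult_L2 norm_translate_L2)

lemma norm_scaleC_op: "norm (scaleC_op c X) = cmod c * norm X"
proof -
  have le: "norm (scaleC_op c X) \<le> cmod c * norm X" for c X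
    by (rule norm_blinfun_bound)
      (simp_all add: scaleC_op_apply norm_scaleC_L2 norm_blinfun mult_left_mono mult.assoc)
  show ?thesis
  proof (cases "c = 0")
    case True
    then show ?thesis using le[of c X] by simp
  next
    case False
    have "scaleC_op (1 / c) (scaleC_op c X) = X"
      by (rule blinfun_eqI) (simp add: scaleC_op_apply scaleC_scaleC False scaleC_one)
    then have "norm X \<le> cmod (1 / c) * norm (scaleC_op c X)"
      using le[of "1 / c" "scaleC_op c X"] by simp
    then have "cmod c * norm X \<le> norm (scaleC_op c X)"
      using False by (simp add: norm_divide field_simps)
    then show ?thesis using le[of c X] by simp
  qed
qed

lemma scaleC_op_compose_left: "scaleC_op c X o\<^sub>L Y = scaleC_op c (X o\<^sub>L Y)"
  by (rule blinfun_eqI) (simp add: scaleC_op_apply)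

lemma scaleC_op_compose_right:
  "X \<in> bounded_ops \<Longrightarrow> X o\<^sub>L scaleC_op c Y = scaleC_op c (X o\<^sub>L Y)"
  by (rule blinfun_eqI) (simp add: scaleC_op_apply bounded_ops_def)

lemma scaleC_op_add_right: "scaleC_op c (X + Y) = scaleC_op c X + scaleC_op c Y"
  by (rule blinfun_eqI) (simp add: scaleC_op_apply blinfun.add_left scaleC_L2_add)

lemma scaleC_op_scaleC_op: "scaleC_op c (scaleC_op d X) = scaleC_op (c * d) X"
  by (rule blinfun_eqI) (simp add: scaleC_op_apply scaleC_scaleC)

lemma scaleC_op_one: "scaleC_op 1 X = X"
  by (rule blinfun_eqI) (simp add: scaleC_op_apply scaleC_one)

lemma scaleC_op_minus_one: "scaleC_op (- 1) X = - X"
  by (rule blinfun_eqI) (simp add: scaleC_op_apply scaleC_minus_one blinfun.minus_left)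

lemma scaleC_op_zero_right: "scaleC_op c 0 = 0"
  using norm_scaleC_op[of c 0] by simp

section \<open>Bounded holomorphic functions on the upper half-plane\<close>

abbreviation uhp :: "complex set" where "uhp \<equiv> {z. 0 < Im z}"

lemma connected_uhp: "connected uhp"
  by (intro convex_connected convex_halfspace_Im_gt)

text \<open>The ring of holomorphic functions on a connected open set is an integral domain; this is what allows
  cancelling in the relations below.\<close>

lemma holomorphic_mult_eq_0:
  assumes "open S" "connected S" "f holomorphic_on S" "g holomorphic_on S"
    and prod: "\<And>z. z \<in> S \<Longrightarrow> f z * g z = 0"
  shows "(\<forall>z\<in>S. f z = 0) \<or> (\<forall>z\<in>S. g z = 0)"
proof (rule disjCI)
  assume "\<not> (\<forall>z\<in>S. g z = 0)"
  then obtain z0 where z0: "z0 \<in> S" "g z0 \<noteq> 0" by auto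
  define U where "U = S \<inter> g -` (- {0})"
  have "open U"
    unfolding U_def using assms
    by (intro continuous_open_preimage holomorphic_on_imp_continuous_on) auto
  show "\<forall>z\<in>S. f z = 0"
  proof
    fix z assume "z \<in> S"
    then show "f z = 0"
      using \<open>open U\<close> assms z0 prod
      by (intro analytic_continuation_open[of U S f "\<lambda>_. 0" z]) (auto simp: U_def)
  qed
qed

text \<open>Dividing by \<open>1 - i\<epsilon>z\<close>, which has modulus at least one on the closed half-plane and is large
  far out, reduces this to the maximum principle on half-discs.\<close>

lemma Phragmen_Lindelof_uhp:
  assumes hol: "f holomorphic_on uhp" and cont: "continuous_on {z. 0 \<le> Im z} f"
    and bound: "\<And>z. 0 \<le> Im z \<Longrightarrow> cmod (f z) \<le> B"
    and real: "\<And>x. cmod (f (complex_of_real x)) \<le> K"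
    and z: "0 < Im z"
  shows "cmod (f z) \<le> K"
proof -
  have K: "0 \<le> K" by (rule order_trans[OF norm_ge_zero real[of 0]])
  have B: "0 \<le> B" using order_trans[OF norm_ge_zero bound[of 0]] by simp
  define h where "h \<epsilon> w = f w / (1 - \<i> * of_real \<epsilon> * w)" for \<epsilon> w
  have den: "1 \<le> cmod (1 - \<i> * of_real \<epsilon> * w)" if "0 < \<epsilon>" "0 \<le> Im w" for \<epsilon> w
  proof -
    have "0 \<le> \<epsilon> * Im w" using that by simp
    then show ?thesis
      using complex_Re_le_cmod[of "1 - \<i> * of_real \<epsilon> * w"] by simp
  qed
  have den': "\<epsilon> * cmod w - 1 \<le> cmod (1 - \<i> * of_real \<epsilon> * w)" if "0 < \<epsilon>" for \<epsilon> w
    using norm_triangle_ineq2[of "\<i> * of_real \<epsilon> * w" 1] that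
    by (simp add: norm_mult norm_minus_commute)
  have key: "cmod (h \<epsilon> z) \<le> K + \<epsilon>" if e: "0 < \<epsilon>" for \<epsilon>
  proof -
    \<comment> \<open>beyond this radius the denominator exceeds \<open>B / \<epsilon>\<close>\<close>
    define R where "R = max (cmod z + 1) ((B / \<epsilon> + 1) / \<epsilon>)"
    define S where "S = uhp \<inter> ball 0 R"
    have S: "open S" unfolding S_def by (intro open_Int open_halfspace_Im_gt open_ball)
    have clS: "closure S \<subseteq> {w. 0 \<le> Im w} \<inter> cball 0 R"
      by (rule closure_minimal) (auto simp: S_def closed_halfspace_Im_ge intro!: closed_Int)
    have nz: "1 - \<i> * of_real \<epsilon> * w \<noteq> 0" if "0 \<le> Im w" for w
      using den[OF e that] by auto
    have "cmod (h \<epsilon> z) \<le> K + \<epsilon>"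
    proof (rule maximum_modulus_frontier[where S = S and f = "h \<epsilon>"])
      show "h \<epsilon> holomorphic_on interior S"
        unfolding h_def interior_open[OF S] using nz
        by (intro holomorphic_intros holomorphic_on_subset[OF hol]) (auto simp: S_def)
      show "continuous_on (closure S) (h \<epsilon>)"
        unfolding h_def using clS nz
        by (intro continuous_intros continuous_on_subset[OF cont]) auto
      show "bounded S" unfolding S_def by (intro bounded_Int) auto
      show "z \<in> S" using z by (auto simp: S_def R_def)
      fix w assume w: "w \<in> frontier S"
      then have "w \<in> closure S" "w \<notin> S"
        using S by (auto simp: frontier_def interior_open)
      with clS have w: "0 \<le> Im w" "cmod w \<le> R" "Im w = 0 \<or> cmod w = R"
        by (auto simp: S_def)
      show "cmod (h \<epsilon> w) \<le> K + \<epsilon>"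
      proof (cases "Im w = 0")
        case True
        then have "w = of_real (Re w)" by (simp add: complex_eq_iff)
        then have "cmod (f w) \<le> K" using real by metis
        have "cmod (h \<epsilon> w) \<le> cmod (f w) / 1"
          unfolding h_def norm_divide using den[OF e w(1)] by (intro divide_left_mono) auto
        then show ?thesis using \<open>cmod (f w) \<le> K\<close> e by linarith
      next
        case False
        then have "cmod w = R" using w by simp
        then have "B / \<epsilon> \<le> \<epsilon> * cmod w - 1"
          using e by (simp add: R_def max_def field_simps split: if_splits)
        then have "B / \<epsilon> \<le> cmod (1 - \<i> * of_real \<epsilon> * w)"
          using den'[OF e, of w] by linarith
        then have "B \<le> \<epsilon> * cmod (1 - \<i> * of_real \<epsilon> * w)"
          using e by (simp add: field_simps)
        then have "cmod (h \<epsilon> w) \<le> \<epsilon>"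
          unfolding h_def norm_divide using bound[OF w(1)] den[OF e w(1)] e
          by (simp add: divide_le_eq)
        then show ?thesis using K by linarith
      qed
    qed
    then show ?thesis .
  qed
  have "((\<lambda>\<epsilon>. cmod (h \<epsilon> z)) \<longlongrightarrow> cmod (f z / (1 - \<i> * of_real 0 * z))) (at_right 0)"
    unfolding h_def by (intro tendsto_intros) auto
  moreover have "((\<lambda>\<epsilon>. K + \<epsilon>) \<longlongrightarrow> K + 0) (at_right (0::real))"
    by (intro tendsto_intros)
  moreover have "\<forall>\<^sub>F \<epsilon> in at_right 0. cmod (h \<epsilon> z) \<le> K + \<epsilon>"
    using key by (auto simp: eventually_at_filter)
  ultimately have "cmod (f z / (1 - \<i> * of_real 0 * z)) \<le> K + 0"
    by (intro tendsto_le[of "at_right (0::real)"]) auto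
  then show ?thesis by simp
qed

lemma pseudo_hyperbolic_less_1:
  assumes "0 < Im u" "0 < Im w"
  shows "cmod (u - w) < cmod (u - cnj w)"
proof -
  have "0 < Im u * Im w" using assms by simp
  then have "(cmod (u - w))\<^sup>2 < (cmod (u - cnj w))\<^sup>2"
    unfolding cmod_power2 by (simp add: power2_eq_square algebra_simps)
  then show ?thesis by (rule power2_less_imp_less) simp
qed

lemma not_eq_cnj_of_uhp: "0 < Im u \<Longrightarrow> 0 < Im w \<Longrightarrow> u - cnj w \<noteq> 0"
  by (auto simp: complex_eq_iff)

lemma Cayley_in_uhp:
  assumes "cmod \<zeta> < 1"
  shows "0 < Im (\<i> * (1 + \<zeta>) / (1 - \<zeta>))"
proof -
  have "\<zeta> \<noteq> 1" using assms by auto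
  have "Re (cnj \<zeta> - \<zeta>) = 0" by simp
  have "\<i> * (1 + \<zeta>) / (1 - \<zeta>) = \<i> * ((1 + \<zeta>) * cnj (1 - \<zeta>)) / of_real ((cmod (1 - \<zeta>))\<^sup>2)"
    by (subst complex_div_cnj) (simp add: mult.assoc)
  then have "Im (\<i> * (1 + \<zeta>) / (1 - \<zeta>)) = Re ((1 + \<zeta>) * cnj (1 - \<zeta>)) / (cmod (1 - \<zeta>))\<^sup>2"
    by (simp only: Im_divide_of_real) simp
  also have "Re ((1 + \<zeta>) * cnj (1 - \<zeta>)) = 1 - (cmod \<zeta>)\<^sup>2"
    unfolding cmod_power2 by (simp add: algebra_simps power2_eq_square)
  finally show ?thesis
    using assms \<open>\<zeta> \<noteq> 1\<close> by (simp add: abs_square_less_1)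
qed

text \<open>Schwarz--Pick at the base point \<open>i\<close>: the difference quotients below are the pseudo-hyperbolic
  distances, and a holomorphic self-map of the half-plane contracts them.  Equality at a single
  point other than \<open>i\<close> forces the map to be an automorphism.\<close>

lemma Schwarz_Pick_uhp:
  assumes hol: "\<Phi> holomorphic_on uhp" and im: "\<And>z. 0 < Im z \<Longrightarrow> 0 < Im (\<Phi> z)"
  shows "0 < Im z \<Longrightarrow> cmod ((\<Phi> z - \<Phi> \<i>) / (\<Phi> z - cnj (\<Phi> \<i>))) \<le> cmod ((z - \<i>) / (z + \<i>))"
    and "0 < Im z0 \<Longrightarrow> z0 \<noteq> \<i> \<Longrightarrow>
      cmod ((\<Phi> z0 - \<Phi> \<i>) / (\<Phi> z0 - cnj (\<Phi> \<i>))) = cmod ((z0 - \<i>) / (z0 + \<i>)) \<Longrightarrow>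
      \<exists>\<alpha>. cmod \<alpha> = 1 \<and> (\<forall>z. 0 < Im z \<longrightarrow>
        (\<Phi> z - \<Phi> \<i>) / (\<Phi> z - cnj (\<Phi> \<i>)) = \<alpha> * ((z - \<i>) / (z + \<i>)))"
proof -
  define w where "w = \<Phi> \<i>"
  have w: "0 < Im w" using im by (simp add: w_def)
  define \<kappa> where "\<kappa> \<zeta> = \<i> * (1 + \<zeta>) / (1 - \<zeta>)" for \<zeta> :: complex
  define \<psi> where "\<psi> \<zeta> = (\<Phi> (\<kappa> \<zeta>) - w) / (\<Phi> (\<kappa> \<zeta>) - cnj w)" for \<zeta>
  have \<kappa>: "0 < Im (\<kappa> \<zeta>)" if "cmod \<zeta> < 1" for \<zeta>
    using Cayley_in_uhp[OF that] by (simp add: \<kappa>_def)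
  have hol\<psi>: "\<psi> holomorphic_on ball 0 1"
  proof -
    have "\<kappa> holomorphic_on ball 0 1"
      unfolding \<kappa>_def by (intro holomorphic_intros) auto
    then have "(\<Phi> \<circ> \<kappa>) holomorphic_on ball 0 1"
      by (rule holomorphic_on_compose_gen[OF _ hol]) (use \<kappa> in auto)
    then show ?thesis
      unfolding \<psi>_def using not_eq_cnj_of_uhp[OF im w] \<kappa>
      by (intro holomorphic_intros) (auto simp: o_def)
  qed
  have \<psi>0: "\<psi> 0 = 0" by (simp add: \<psi>_def \<kappa>_def w_def)
  have \<psi>1: "cmod (\<psi> \<zeta>) < 1" if "cmod \<zeta> < 1" for \<zeta>
    unfolding \<psi>_def norm_divide
    using pseudo_hyperbolic_less_1[OF im w, of "\<kappa> \<zeta>"] not_eq_cnj_of_uhp[OF im w, of "\<kappa> \<zeta>"] \<kappa>[OF that]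
    by simp
  have disc: "cmod ((z - \<i>) / (z + \<i>)) < 1" if "0 < Im z" for z
    using pseudo_hyperbolic_less_1[of z \<i>] not_eq_cnj_of_uhp[of z \<i>] that by (simp add: norm_divide)
  have inv: "\<kappa> ((z - \<i>) / (z + \<i>)) = z" if "0 < Im z" for z
  proof -
    have "z + \<i> \<noteq> 0" using not_eq_cnj_of_uhp[of z \<i>] that by simp
    then have "1 + (z - \<i>) / (z + \<i>) = 2 * z / (z + \<i>)" "1 - (z - \<i>) / (z + \<i>) = 2 * \<i> / (z + \<i>)"
      by (simp_all add: field_simps)
    then show ?thesis using \<open>z + \<i> \<noteq> 0\<close> by (simp add: \<kappa>_def)
  qed
  show "cmod ((\<Phi> z - \<Phi> \<i>) / (\<Phi> z - cnj (\<Phi> \<i>))) \<le> cmod ((z - \<i>) / (z + \<i>))" if "0 < Im z"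
    using Schwarz_Lemma(1)[OF hol\<psi> \<psi>0 \<psi>1 disc[OF that]] inv[OF that] by (simp add: \<psi>_def w_def)
  assume z0: "0 < Im z0" "z0 \<noteq> \<i>"
    and eq: "cmod ((\<Phi> z0 - \<Phi> \<i>) / (\<Phi> z0 - cnj (\<Phi> \<i>))) = cmod ((z0 - \<i>) / (z0 + \<i>))"
  have "\<exists>\<zeta>. cmod \<zeta> < 1 \<and> \<zeta> \<noteq> 0 \<and> cmod (\<psi> \<zeta>) = cmod \<zeta>"
    using z0 eq disc[OF z0(1)] inv[OF z0(1)] not_eq_cnj_of_uhp[of z0 \<i>]
    by (intro exI[of _ "(z0 - \<i>) / (z0 + \<i>)"]) (simp add: \<psi>_def w_def)
  then obtain \<alpha> where \<alpha>: "\<forall>\<zeta>. cmod \<zeta> < 1 \<longrightarrow> \<psi> \<zeta> = \<alpha> * \<zeta>" "cmod \<alpha> = 1"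
    using Schwarz_Lemma(3)[OF hol\<psi> \<psi>0 \<psi>1 disc[OF z0(1)]] by blast
  have "(\<Phi> z - \<Phi> \<i>) / (\<Phi> z - cnj (\<Phi> \<i>)) = \<alpha> * ((z - \<i>) / (z + \<i>))" if "0 < Im z" for z
    using \<alpha>(1)[rule_format, OF disc[OF that]] inv[OF that] by (simp add: \<psi>_def w_def)
  then show "\<exists>\<alpha>. cmod \<alpha> = 1 \<and> (\<forall>z. 0 < Im z \<longrightarrow>
        (\<Phi> z - \<Phi> \<i>) / (\<Phi> z - cnj (\<Phi> \<i>)) = \<alpha> * ((z - \<i>) / (z + \<i>)))"
    using \<alpha>(2) by blast
qed

text \<open>The points \<open>i\<close> and \<open>iR\<close> have the least hyperbolic distance among all pairs of points whose
  imaginary parts have ratio \<open>R\<close>.  Hence a holomorphic self-map that preserves this ratio at these two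
  points attains equality in the Schwarz--Pick lemma, and it has to be affine.\<close>

lemma self_map_uhp_affine:
  assumes hol: "\<Phi> holomorphic_on uhp" and im: "\<And>z. 0 < Im z \<Longrightarrow> 0 < Im (\<Phi> z)"
    and R: "1 < R" and scale: "Im (\<Phi> (\<i> * of_real R)) = R * Im (\<Phi> \<i>)" and z: "0 < Im z"
  shows "\<Phi> z = of_real (Im (\<Phi> \<i>)) * z + of_real (Re (\<Phi> \<i>))"
proof -
  define w where "w = \<Phi> \<i>"
  define v where "v = Im w"
  define u where "u = \<Phi> (\<i> * of_real R)"
  define d where "d = Re u - Re w"
  have v: "0 < v" using im by (simp add: v_def w_def)
  define \<rho> where "\<rho> = (R - 1) / (R + 1)"
  have \<rho>: "0 < \<rho>" "\<rho> < 1" using R by (auto simp: \<rho>_def)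
  have num: "u - w = Complex d ((R - 1) * v)" and den: "u - cnj w = Complex d ((R + 1) * v)"
    using scale by (simp_all add: u_def w_def v_def d_def complex_eq_iff algebra_simps)
  have den0: "u - cnj w \<noteq> 0" using den R v by (simp add: complex_eq_iff)
  have refpt: "(\<i> * of_real R - \<i>) / (\<i> * of_real R + \<i>) = of_real \<rho>"
  proof -
    have "\<i> * of_real R - \<i> = \<i> * of_real (R - 1)" "\<i> * of_real R + \<i> = \<i> * of_real (R + 1)"
      by (simp_all add: algebra_simps)
    then show ?thesis by (simp add: \<rho>_def)
  qed
  have le: "cmod ((u - w) / (u - cnj w)) \<le> \<rho>"
    using Schwarz_Pick_uhp(1)[OF hol im, of "\<i> * of_real R"] R \<rho>
    unfolding refpt u_def[symmetric] w_def[symmetric] by simp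
  then have "cmod (u - w) \<le> \<rho> * cmod (u - cnj w)"
    using den0 by (simp add: norm_divide divide_le_eq)
  then have "(cmod (u - w))\<^sup>2 \<le> \<rho>\<^sup>2 * (cmod (u - cnj w))\<^sup>2"
    by (metis norm_ge_zero power_mono power_mult_distrib)
  then have "d\<^sup>2 + ((R - 1) * v)\<^sup>2 \<le> \<rho>\<^sup>2 * d\<^sup>2 + (\<rho> * (R + 1) * v)\<^sup>2"
    unfolding num den cmod_power2 by (simp add: power_mult_distrib mult.assoc distrib_left[of "\<rho>\<^sup>2"])
  moreover have "\<rho> * (R + 1) = R - 1" using R by (simp add: \<rho>_def)
  ultimately have "d\<^sup>2 * (1 - \<rho>\<^sup>2) \<le> 0" by (simp add: right_diff_distrib mult.commute)
  moreover have "0 < 1 - \<rho>\<^sup>2" using \<rho> by (simp add: abs_square_less_1)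
  ultimately have "d = 0"
    using mult_pos_pos[of "d\<^sup>2" "1 - \<rho>\<^sup>2"] zero_less_power2[of d] by linarith
  then have ratio: "(u - w) / (u - cnj w) = of_real \<rho>"
  proof -
    have "u - w = \<i> * of_real ((R - 1) * v)" "u - cnj w = \<i> * of_real ((R + 1) * v)"
      using num den \<open>d = 0\<close> by (simp_all add: complex_eq_iff)
    then show ?thesis using v R by (simp add: \<rho>_def)
  qed
  have "cmod ((\<Phi> (\<i> * of_real R) - \<Phi> \<i>) / (\<Phi> (\<i> * of_real R) - cnj (\<Phi> \<i>)))
      = cmod ((\<i> * of_real R - \<i>) / (\<i> * of_real R + \<i>))"
    using ratio unfolding refpt u_def w_def by simp
  moreover have "\<i> * of_real R \<noteq> \<i>" using R by (simp add: complex_eq_iff)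
  ultimately obtain \<alpha> where \<alpha>: "\<And>z. 0 < Im z \<Longrightarrow> (\<Phi> z - w) / (\<Phi> z - cnj w) = \<alpha> * ((z - \<i>) / (z + \<i>))"
    using Schwarz_Pick_uhp(2)[OF hol im, of "\<i> * of_real R"] R unfolding w_def by auto
  have "of_real \<rho> = \<alpha> * of_real \<rho>"
    using \<alpha>[of "\<i> * of_real R"] R ratio refpt by (simp add: u_def)
  then have "\<alpha> = 1" using \<rho> by simp
  have nz: "\<Phi> z - cnj w \<noteq> 0" "z + \<i> \<noteq> 0"
    using not_eq_cnj_of_uhp[OF im[OF z] im[of \<i>]] not_eq_cnj_of_uhp[OF z, of \<i>] by (auto simp: w_def)
  have "(\<Phi> z - w) * (z + \<i>) = (z - \<i>) * (\<Phi> z - cnj w)"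
    using \<alpha>[OF z] nz unfolding \<open>\<alpha> = 1\<close> by (simp add: frac_eq_eq)
  then have "2 * \<i> * \<Phi> z = z * (w - cnj w) + \<i> * (w + cnj w)"
    by (simp add: algebra_simps)
  moreover have "w - cnj w = 2 * \<i> * of_real v" "w + cnj w = 2 * of_real (Re w)"
    by (simp_all add: v_def complex_eq_iff)
  ultimately have "2 * \<i> * \<Phi> z = 2 * \<i> * (of_real v * z + of_real (Re w))"
    by (simp add: algebra_simps)
  then show ?thesis by (simp add: v_def w_def)
qed

text \<open>A logarithm of \<open>g\<close>, divided by \<open>i\<close>, is a self-map of the half-plane because \<open>0 < |g| < 1\<close>; its imaginary
  part is \<open>- ln |g|\<close>, so the hypothesis on \<open>|g|\<close> is the one that makes the self-map affine.\<close>

lemma scaling_modulus_imp_exponential: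
  assumes hol: "g holomorphic_on uhp" and g: "\<And>z. 0 < Im z \<Longrightarrow> g z \<noteq> 0 \<and> cmod (g z) < 1"
    and R: "1 < R" and scale: "cmod (g (\<i> * of_real R)) = cmod (g \<i>) powr R"
  obtains C where "cmod C = 1"
    "\<And>z. 0 < Im z \<Longrightarrow> g z = C * exp (\<i> * of_real (- ln (cmod (g \<i>))) * z)"
proof -
  obtain q where q: "q holomorphic_on uhp" "\<And>z. 0 < Im z \<Longrightarrow> exp (q z) = g z"
    using holomorphic_logarithm_exists[OF convex_halfspace_Im_gt open_halfspace_Im_gt hol, where ?z0.0 = \<i>] g
    by auto
  define \<Phi> where "\<Phi> z = - \<i> * q z" for z
  have mod: "cmod (g z) = exp (- Im (\<Phi> z))" if "0 < Im z" for z
    by (simp add: \<Phi>_def norm_exp_eq_Re flip: q(2)[OF that])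
  have im: "0 < Im (\<Phi> z)" if "0 < Im z" for z
    using mod[OF that] g[OF that] by simp
  have "\<Phi> holomorphic_on uhp" unfolding \<Phi>_def by (intro holomorphic_intros q(1))
  moreover have "Im (\<Phi> (\<i> * of_real R)) = R * Im (\<Phi> \<i>)"
  proof -
    have "exp (- Im (\<Phi> (\<i> * of_real R))) = exp (R * (- Im (\<Phi> \<i>)))"
      using scale mod[of "\<i> * of_real R"] mod[of \<i>] R by (simp add: powr_def)
    then show ?thesis by (simp only: exp_inj_iff)
  qed
  ultimately have aff: "\<Phi> z = of_real (Im (\<Phi> \<i>)) * z + of_real (Re (\<Phi> \<i>))" if "0 < Im z" for z
    using self_map_uhp_affine[of \<Phi> R z, OF _ im R _ that] by simp
  have Im\<Phi>: "Im (\<Phi> \<i>) = - ln (cmod (g \<i>))" using mod[of \<i>] by simp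
  have "g z = exp (\<i> * of_real (Re (\<Phi> \<i>))) * exp (\<i> * of_real (- ln (cmod (g \<i>))) * z)"
    if "0 < Im z" for z
  proof -
    have "g z = exp (\<i> * \<Phi> z)" using q(2)[OF that] by (simp add: \<Phi>_def)
    then show ?thesis
      unfolding aff[OF that] Im\<Phi> exp_add[symmetric] by (simp add: algebra_simps)
  qed
  moreover have "cmod (exp (\<i> * of_real (Re (\<Phi> \<i>)))) = 1" by simp
  ultimately show ?thesis using that by blast
qed

text \<open>The negative logarithm of \<open>h\<close> is additive and nonnegative, hence monotone, hence linear. Only moduli
  are regular in this way: the phase of a bounded one-parameter semigroup may be a discontinuous
  character of the reals.\<close>

lemma bounded_semigroup_powr:
  fixes h :: "real \<Rightarrow> real"
  assumes h: "\<And>t. 0 < t \<Longrightarrow> 0 < h t \<and> h t \<le> 1"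
    and add: "\<And>s t. 0 < s \<Longrightarrow> 0 < t \<Longrightarrow> h (s + t) = h s * h t"
    and r: "0 < r" and s: "0 < s"
  shows "h (r * s) = h s powr r"
proof -
  define p where "p t = - ln (h t)" for t
  have p0: "0 \<le> p t" if "0 < t" for t
    using h[OF that] by (simp add: p_def)
  have padd: "p (s + t) = p s + p t" if "0 < s" "0 < t" for s t
    using add[OF that] h[OF that(1)] h[OF that(2)] by (simp add: p_def ln_mult)
  have pnat: "p (real (Suc n) * t) = real (Suc n) * p t" if "0 < t" for n t
  proof (induction n)
    case (Suc n)
    have "p (real (Suc (Suc n)) * t) = p (real (Suc n) * t + t)" by (simp add: algebra_simps)
    also have "\<dots> = p (real (Suc n) * t) + p t" by (rule padd) (use that in auto)
    finally show ?case using Suc by (simp add: algebra_simps)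
  qed simp
  have ge: "r * p s \<le> p (r * s)" if r: "0 < r" and s: "0 < s" for r s
  proof -
    have "real n * (r * p s - p (r * s)) \<le> p s" for n
    proof (cases "n = 0")
      case True then show ?thesis using p0[OF s] by simp
    next
      case False
      define m where "m = nat \<lfloor>real n * r\<rfloor>"
      have rn: "0 < real n * r" using False r by simp
      have m: "real m \<le> real n * r" "real n * r < real m + 1"
        using rn by (auto simp: m_def)
      have "real m * p s \<le> p (real n * r * s)"
      proof (cases "real m = real n * r \<or> m = 0")
        case True
        then show ?thesis
        proof (cases "m = 0")
          case True then show ?thesis using p0[of "real n * r * s"] rn s by simp
        next
          case False
          then obtain k where "m = Suc k" by (cases m) auto
          then show ?thesis using True False pnat[OF s, of k] by simp
        qed
      next
        case False
        then obtain k where k: "m = Suc k" by (cases m) auto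
        have "p (real n * r * s) = p (real m * s + (real n * r - real m) * s)"
          by (simp add: algebra_simps)
        also have "\<dots> = p (real m * s) + p ((real n * r - real m) * s)"
          by (rule padd) (use False m s k in auto)
        finally show ?thesis using p0[of "(real n * r - real m) * s"] False m s pnat[OF s, of k] k by simp
      qed
      moreover have "p (real n * r * s) = real n * p (r * s)"
        using pnat[of "r * s" "n - 1"] False r s by (simp add: mult.assoc)
      moreover have "real n * r * p s \<le> (real m + 1) * p s"
        using m(2) p0[OF s] by (intro mult_right_mono) auto
      ultimately show ?thesis by (simp add: algebra_simps)
    qed
    then have "r * p s - p (r * s) \<le> 0"
      using reals_Archimedean3[of "r * p s - p (r * s)"] by (metis linorder_not_le)
    then show ?thesis by simp
  qed
  have "(1 / r) * p (r * s) \<le> p s"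
    using ge[of "1 / r" "r * s"] r s by simp
  then have "p (r * s) = r * p s"
    using ge[OF r s] r by (simp add: field_simps)
  then have "ln (h (r * s)) = r * ln (h s)" by (simp add: p_def)
  then show ?thesis
    using h[OF s] h[of "r * s"] exp_ln[of "h (r * s)"] r s by (simp add: powr_def)
qed

text \<open>Every member of the semigroup has roots of all orders that are again bounded by one. A zero of \<open>f t0\<close>
  is a zero of each root, near which the Schwarz lemma bounds all of the roots by \<open>1/2\<close>; so their
  powers tend to zero there.\<close>

lemma semigroup_vanishing:
  fixes f :: "real \<Rightarrow> complex \<Rightarrow> complex"
  assumes hol: "\<And>t. 0 < t \<Longrightarrow> f t holomorphic_on uhp"
    and bound: "\<And>t z. 0 < t \<Longrightarrow> 0 < Im z \<Longrightarrow> cmod (f t z) \<le> 1"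
    and add: "\<And>s t z. 0 < s \<Longrightarrow> 0 < t \<Longrightarrow> 0 < Im z \<Longrightarrow> f (s + t) z = f s z * f t z"
    and zero: "0 < t0" "0 < Im z0" "f t0 z0 = 0"
    and tz: "0 < t" "0 < Im z"
  shows "f t z = 0"
proof -
  have pow: "f (real (Suc n) * s) z = f s z ^ Suc n" if "0 < s" "0 < Im z" for n s z
  proof (induction n)
    case (Suc n)
    have "f (real (Suc (Suc n)) * s) z = f (real (Suc n) * s + s) z" by (simp add: algebra_simps)
    also have "\<dots> = f (real (Suc n) * s) z * f s z" by (rule add) (use that in auto)
    finally show ?case using Suc by simp
  qed simp
  define r where "r = Im z0"
  have near: "f t0 w = 0" if w: "w \<in> ball z0 (r / 4)" for w
  proof -
    define \<zeta> where "\<zeta> = (w - z0) / of_real r"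
    have r: "0 < r" using zero by (simp add: r_def)
    have \<zeta>: "cmod \<zeta> < 1 / 4" "w = z0 + of_real r * \<zeta>"
      using w r by (simp_all add: \<zeta>_def norm_divide dist_norm norm_minus_commute field_simps)
    have in_uhp: "0 < Im (z0 + of_real r * x)" if "cmod x < 1" for x
    proof -
      have "- 1 < Im x" using abs_Im_le_cmod[of x] that by linarith
      then have "r * (- 1) < r * Im x" using r by (rule mult_strict_left_mono)
      then show ?thesis by (simp add: r_def)
    qed
    have half: "cmod (f t0 w) \<le> (1 / 2) ^ Suc n" for n
    proof -
      define s where "s = t0 / real (Suc n)"
      have s: "0 < s" "real (Suc n) * s = t0" using zero by (simp_all add: s_def)
      have "f s z0 ^ Suc n = 0" using pow[OF s(1) zero(2), of n] s(2) zero(3) by metis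
      then have s0: "f s z0 = 0" by (metis power_not_zero)
      \<comment> \<open>halving turns the bound by one into the strict bound of the Schwarz lemma\<close>
      define \<psi> where "\<psi> x = f s (z0 + of_real r * x) / 2" for x
      have "\<psi> holomorphic_on ball 0 1"
      proof -
        have "(f s \<circ> (\<lambda>x. z0 + of_real r * x)) holomorphic_on ball 0 1"
          by (rule holomorphic_on_compose_gen[OF _ hol[OF s(1)]])
            (auto intro!: holomorphic_intros simp: in_uhp[simplified])
        then show ?thesis unfolding \<psi>_def by (intro holomorphic_intros) (simp_all add: o_def)
      qed
      moreover have "\<psi> 0 = 0" by (simp add: \<psi>_def s0)
      moreover have "cmod (\<psi> x) < 1" if "cmod x < 1" for x
        using bound[OF s(1) in_uhp[OF that]] by (simp add: \<psi>_def)
      ultimately have "cmod (\<psi> \<zeta>) \<le> cmod \<zeta>"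
        using \<zeta>(1) by (intro Schwarz_Lemma(1)) auto
      then have "cmod (f s w) \<le> 1 / 2" using \<zeta> by (simp add: \<psi>_def)
      then have "cmod (f s w) ^ Suc n \<le> (1 / 2) ^ Suc n" by (intro power_mono) auto
      moreover have "0 < Im w" using in_uhp[of \<zeta>] \<zeta> by simp
      ultimately show ?thesis using pow[OF s(1), of w n] s(2) by (metis norm_power)
    qed
    have "(\<lambda>n. (1 / 2 :: real) ^ Suc n) \<longlonglongrightarrow> 0"
      by (rule LIMSEQ_Suc[OF LIMSEQ_power_zero]) simp
    then have "cmod (f t0 w) \<le> 0"
      by (rule LIMSEQ_le_const) (use half in auto)
    then show ?thesis by simp
  qed
  have "f t0 w = 0" if "0 < Im w" for w
  proof (rule analytic_continuation_open[of "ball z0 (r / 4) \<inter> uhp" uhp "f t0" "\<lambda>_. 0" w])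
    have "z0 \<in> ball z0 (r / 4) \<inter> uhp" using zero(2) by (simp add: r_def)
    then show "ball z0 (r / 4) \<inter> uhp \<noteq> {}" by blast
  qed (use that near hol[OF zero(1)] in \<open>auto intro!: open_Int open_halfspace_Im_gt connected_uhp\<close>)
  then have t0: "f t0 z = 0" using tz by simp
  obtain n where "t0 < real n * t"
    using reals_Archimedean3[OF tz(1)] by blast
  then have n: "t0 < real (Suc n) * t" using tz(1) by (simp add: algebra_simps)
  define s where "s = t0 / real (Suc n)"
  have s: "0 < s" "s < t" "real (Suc n) * s = t0" using zero n by (simp_all add: s_def field_simps)
  have "f s z ^ Suc n = 0" using pow[OF s(1) tz(2), of n] s(3) t0 by metis
  then have "f s z = 0" by (metis power_not_zero)
  then show ?thesis using add[of s "t - s" z] s tz by simp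
qed

section \<open>Exponential polynomials\<close>

text \<open>Linear combinations are lists of coefficients and indices, so that indices may repeat and sums are
  concatenations; \<open>E\<close> gives the value of the combination on each basis element.\<close>

definition val :: "('i \<Rightarrow> complex) \<Rightarrow> (complex \<times> 'i) list \<Rightarrow> complex" where
  "val E p = (\<Sum>(c, i)\<leftarrow>p. c * E i)"

lemma val_Nil [simp]: "val E [] = 0"
  and val_Cons [simp]: "val E (x # p) = fst x * E (snd x) + val E p"
  and val_append: "val E (p @ q) = val E p + val E q"
  by (simp_all add: val_def split_beta)

lemma val_map_mult: "val E (map (apfst ((*) c)) p) = c * val E p"
  by (induction p) (simp_all add: algebra_simps)

lemma tendsto_val:
  "(\<And>i. i \<in> snd ` set p \<Longrightarrow> ((\<lambda>n. E n i) \<longlongrightarrow> E' i) F) \<Longrightarrow> ((\<lambda>n. val (E n) p) \<longlongrightarrow> val E' p) F"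
  by (induction p) (auto intro!: tendsto_intros)

definition expo :: "('i \<Rightarrow> bool) \<Rightarrow> ('i \<Rightarrow> real) \<Rightarrow> complex \<Rightarrow> 'i \<Rightarrow> complex" where
  "expo P a z i = (if P i then exp (\<i> * of_real (a i) * z) else 0)"

lemma holomorphic_val_expo: "(\<lambda>z. val (expo P a z) p) holomorphic_on S"
proof (induction p)
  case (Cons x p)
  have "(\<lambda>z. expo P a z (snd x)) holomorphic_on S"
    unfolding expo_def by (cases "P (snd x)") (auto intro!: holomorphic_intros)
  then show ?case using Cons by (auto intro!: holomorphic_intros)
qed simp

lemma val_expo_bounded:
  "(\<And>i. i \<in> snd ` set p \<Longrightarrow> 0 \<le> a i) \<Longrightarrow> 0 \<le> Im z \<Longrightarrow>
    cmod (val (expo P a z) p) \<le> (\<Sum>(c, i)\<leftarrow>p. cmod c)"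
proof (induction p)
  case (Cons x p)
  have "cmod (fst x * expo P a z (snd x)) \<le> cmod (fst x) * 1"
    unfolding norm_mult using Cons.prems(2) Cons.prems(1)[of "snd x"]
    by (intro mult_left_mono) (auto simp: expo_def)
  moreover have "cmod (val (expo P a z) p) \<le> (\<Sum>(c, i)\<leftarrow>p. cmod c)"
    using Cons by auto
  ultimately show ?case
    by (simp add: case_prod_unfold norm_triangle_mono)
qed simp

lemma val_expo_Phragmen_Lindelof:
  assumes "\<And>i. i \<in> snd ` set p \<Longrightarrow> 0 \<le> a i"
    and "\<And>x. cmod (val (expo P a (of_real x)) p) \<le> K" and "0 < Im z"
  shows "cmod (val (expo P a z) p) \<le> K"
  by (rule Phragmen_Lindelof_uhp[OF holomorphic_val_expo
        holomorphic_on_imp_continuous_on[OF holomorphic_val_expo] val_expo_bounded])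
    (use assms in auto)

text \<open>A Fourier coefficient is the limit of averages over the progressions \<open>iy + nt\<close>, where \<open>t\<close> is small
  enough for distinct frequencies to be told apart; letting \<open>y\<close> tend to zero removes the
  weight \<open>e\<^sup>\<alpha>\<^sup>y\<close>.\<close>

lemma val_expo_coefficient_bound:
  assumes K: "\<And>z. 0 < Im z \<Longrightarrow> cmod (val (expo P a z) p) \<le> K"
  shows "cmod (val (\<lambda>i. if P i \<and> a i = \<alpha> then 1 else 0) p) \<le> K"
proof -
  let ?\<delta> = "\<lambda>i. if P i \<and> a i = \<alpha> then 1 else (0::complex)"
  have K0: "0 \<le> K" using order_trans[OF norm_ge_zero K[of \<i>]] by simp
  obtain B where B: "\<And>i. i \<in> snd ` set p \<Longrightarrow> \<bar>a i - \<alpha>\<bar> \<le> B" "0 \<le> B"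
    by (rule that[of "Max (insert 0 ((\<lambda>i. \<bar>a i - \<alpha>\<bar>) ` snd ` set p))"]) (auto intro!: Max_ge)
  \<comment> \<open>all frequency differences times \<open>t\<close> are below one, hence below \<open>2\<pi>\<close>\<close>
  define t where "t = 1 / (B + 1)"
  have t: "0 < t" using B(2) by (simp add: t_def)
  have "cmod (val ?\<delta> p) \<le> K * exp (\<alpha> * y)" if y: "0 < y" for y
  proof -
    define z where "z n = \<i> * of_real y + of_real (real n * t)" for n
    define avg where "avg N i = (\<Sum>n<N. exp (- \<i> * of_real \<alpha> * z n) * expo P a (z n) i) / of_nat N"
      for N i
    have lim: "(\<lambda>N. avg N i) \<longlonglongrightarrow> ?\<delta> i" if i: "i \<in> snd ` set p" for i
    proof (cases "P i")
      case False
      then show ?thesis by (simp add: avg_def expo_def)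
    next
      case True
      define w where "w = exp (\<i> * of_real ((a i - \<alpha>) * t))"
      define C where "C = exp (complex_of_real (- (a i - \<alpha>) * y))"
      have "exp (- \<i> * of_real \<alpha> * z n) * expo P a (z n) i = C * w ^ n" for n
      proof -
        have "- \<i> * of_real \<alpha> * z n + \<i> * of_real (a i) * z n
          = complex_of_real (- (a i - \<alpha>) * y) + of_nat n * (\<i> * of_real ((a i - \<alpha>) * t))"
          by (simp add: z_def algebra_simps complex_eq_iff)
        then show ?thesis
          using True unfolding expo_def C_def w_def exp_of_nat_mult[symmetric]
          by (simp only: exp_add[symmetric] if_True)
      qed
      then have avg: "avg N i = C * ((\<Sum>n<N. w ^ n) / of_nat N)" for N
        by (simp add: avg_def sum_distrib_left)
      show ?thesis
      proof (cases "a i = \<alpha>")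
        case eq: True
        then have "C = 1" "w = 1" by (simp_all add: C_def w_def)
        then have "\<forall>\<^sub>F N in sequentially. avg N i = 1"
          unfolding avg by (auto simp: eventually_sequentially intro!: exI[of _ 1])
        then show ?thesis using True eq by (simp add: tendsto_eventually)
      next
        case False
        have "\<bar>a i - \<alpha>\<bar> * t < 1"
          using B(1)[OF i] B(2) by (simp add: t_def field_simps)
        then have small: "\<bar>(a i - \<alpha>) * t\<bar> < 1" "(a i - \<alpha>) * t \<noteq> 0"
          using t False by (auto simp: abs_mult)
        have "w \<noteq> 1"
        proof
          assume "w = 1"
          then obtain n :: int where n: "(a i - \<alpha>) * t = of_int (2 * n) * pi"
            by (auto simp: w_def exp_eq_1)
          then have "n \<noteq> 0" using small(2) by auto
          then have "1 \<le> \<bar>real_of_int n\<bar>" by linarith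
          then have "1 * pi \<le> \<bar>real_of_int n\<bar> * pi" by (intro mult_right_mono) auto
          moreover have "\<bar>(a i - \<alpha>) * t\<bar> = 2 * (\<bar>real_of_int n\<bar> * pi)"
            by (simp add: n abs_mult)
          ultimately show False using small(1) pi_gt3 by linarith
        qed
        have bnd: "cmod (avg N i) \<le> cmod C * (2 / cmod (w - 1)) * inverse (real N)" for N
        proof -
          have "cmod w = 1" by (simp add: w_def)
          then have "cmod (w ^ N - 1) \<le> 2"
            using norm_triangle_ineq4[of "w ^ N" 1] by (simp add: norm_power)
          then have "cmod (\<Sum>n<N. w ^ n) \<le> 2 / cmod (w - 1)"
            using \<open>w \<noteq> 1\<close> by (simp add: geometric_sum norm_divide divide_right_mono)
          then have "cmod C * (cmod (\<Sum>n<N. w ^ n) * inverse (real N))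
              \<le> cmod C * (2 / cmod (w - 1) * inverse (real N))"
            by (intro mult_left_mono mult_right_mono) auto
          then show ?thesis
            unfolding avg norm_mult norm_divide norm_of_nat by (simp add: divide_inverse mult.assoc)
        qed
        have "(\<lambda>N. cmod C * (2 / cmod (w - 1)) * inverse (real N)) \<longlonglongrightarrow> 0"
          by (intro tendsto_mult_right_zero lim_inverse_n)
        then have "(\<lambda>N. avg N i) \<longlonglongrightarrow> 0"
          by (rule Lim_null_comparison[OF always_eventually[OF allI[OF bnd]]])
        then show ?thesis using False by simp
      qed
    qed
    have "(\<lambda>N. val (avg N) p) \<longlonglongrightarrow> val ?\<delta> p"
      by (rule tendsto_val[OF lim])
    moreover have "cmod (val (avg N) p) \<le> K * exp (\<alpha> * y)" for N
    proof (cases "N = 0")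
      case True
      then have "val (avg N) p = 0" by (induction p) (auto simp: avg_def)
      then show ?thesis using K0 by simp
    next
      case False
      have "val (avg N) p = (\<Sum>n<N. exp (- \<i> * of_real \<alpha> * z n) * val (expo P a (z n)) p) / of_nat N"
        by (induction p) (simp_all add: avg_def sum_distrib_left distrib_left sum.distrib
            add_divide_distrib mult_ac)
      also have "cmod \<dots> \<le> (\<Sum>n<N. exp (\<alpha> * y) * K) / real N"
        unfolding norm_divide norm_of_nat
      proof (intro divide_right_mono sum_norm_le)
        fix n
        show "cmod (exp (- \<i> * of_real \<alpha> * z n) * val (expo P a (z n)) p) \<le> exp (\<alpha> * y) * K"
          unfolding norm_mult using K[of "z n"] y by (intro mult_mono) (auto simp: z_def)
      qed simp
      finally show ?thesis using False by (simp add: mult.commute)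
    qed
    ultimately show ?thesis
      by (intro LIMSEQ_le_const2[OF tendsto_norm]) auto
  qed
  then have "\<forall>\<^sub>F y in at_right 0. cmod (val ?\<delta> p) \<le> K * exp (\<alpha> * y)"
    by (auto simp: eventually_at_filter)
  moreover have "((\<lambda>y. K * exp (\<alpha> * y)) \<longlongrightarrow> K * exp (\<alpha> * 0)) (at_right 0)"
    by (intro tendsto_intros)
  ultimately have "cmod (val ?\<delta> p) \<le> K * exp (\<alpha> * 0)"
    by (intro tendsto_lowerbound) auto
  then show ?thesis by simp
qed

lemmas blinfun_compose_add_left = bounded_bilinear.add_left[OF bounded_bilinear_blinfun_compose]
lemmas blinfun_compose_add_right = bounded_bilinear.add_right[OF bounded_bilinear_blinfun_compose]

lemma blinfun_compose_assoc: "X o\<^sub>L Y o\<^sub>L Z = X o\<^sub>L (Y o\<^sub>L Z)"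
  by (rule blinfun_eqI) simp

lemma blinfun_compose_id [simp]: "X o\<^sub>L id_blinfun = X" "id_blinfun o\<^sub>L X = X"
  by (rule blinfun_eqI, simp)+

lemma bounded_linear_scaleC_op: "bounded_linear (scaleC_op c)"
proof (rule bounded_linear_intro)
  show "scaleC_op c (r *\<^sub>R X) = r *\<^sub>R scaleC_op c X" for r X
    by (rule blinfun_eqI) (simp add: scaleC_op_apply blinfun.scaleR_left scaleC_L2_scaleR)
  show "norm (scaleC_op c X) \<le> norm X * cmod c" for X
    by (simp add: norm_scaleC_op)
qed (rule scaleC_op_add_right)

section \<open>The algebra as the closed span of ordered monomials\<close>

fun Mon :: "real \<times> real \<times> nat \<Rightarrow> L2 \<Rightarrow>\<^sub>L L2" where
  "Mon (a, b, n) = M_op a o\<^sub>L D_op b o\<^sub>L V_op (real n)"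

definition indices :: "(real \<times> real \<times> nat) set" where
  "indices = {0..} \<times> {0..} \<times> UNIV"

definition op_of :: "(complex \<times> real \<times> real \<times> nat) list \<Rightarrow> L2 \<Rightarrow>\<^sub>L L2" where
  "op_of p = (\<Sum>(c, i)\<leftarrow>p. scaleC_op c (Mon i))"

lemma op_of_Nil [simp]: "op_of [] = 0"
  and op_of_Cons [simp]: "op_of (x # p) = scaleC_op (fst x) (Mon (snd x)) + op_of p"
  and op_of_append: "op_of (p @ q) = op_of p + op_of q"
  by (simp_all add: op_of_def split_beta)

lemma op_of_map_mult: "op_of (map (apfst ((*) c)) p) = scaleC_op c (op_of p)"
  by (induction p) (simp_all add: scaleC_op_add_right scaleC_op_scaleC_op scaleC_op_zero_right)

abbreviation polys :: "(complex \<times> real \<times> real \<times> nat) list set" where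
  "polys \<equiv> lists (UNIV \<times> indices)"

lemma map_mult_polys: "p \<in> polys \<Longrightarrow> map (apfst ((*) c)) p \<in> polys"
  by (auto simp: in_lists_conv_set)

lemma compose_bounded_ops: "X \<in> bounded_ops \<Longrightarrow> Y \<in> bounded_ops \<Longrightarrow> X o\<^sub>L Y \<in> bounded_ops"
  by (simp add: bounded_ops_def)

lemma M_op_bounded_ops: "M_op a \<in> bounded_ops"
proof -
  have "mult_L2 l (scaleC_L2 c f) = scaleC_L2 c (mult_L2 l f)" for l c f
    by transfer (auto simp: L2_rel_def mult.left_commute
        intro!: sq_integrable_mult_left sq_integrable_cis_mult)
  then show ?thesis by (simp add: bounded_ops_def M_op_apply)
qed

lemma D_op_bounded_ops: "D_op b \<in> bounded_ops"
proof -
  have "translate_L2 m (scaleC_L2 c f) = scaleC_L2 c (translate_L2 m f)" for m c f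
    by transfer (auto simp: L2_rel_def intro!: sq_integrable_mult_left sq_integrable_translate)
  then show ?thesis by (simp add: bounded_ops_def D_op_apply)
qed

lemma V_op_bounded_ops: "V_op t \<in> bounded_ops"
proof -
  have "dilate_L2 t (scaleC_L2 c f) = scaleC_L2 c (dilate_L2 t f)" for t c f
    by transfer (auto simp: L2_rel_def mult.left_commute
        intro!: sq_integrable_mult_left sq_integrable_dilate)
  then show ?thesis by (simp add: bounded_ops_def V_op_apply)
qed

lemma Mon_bounded_ops: "Mon i \<in> bounded_ops"
  by (cases i) (simp add: compose_bounded_ops M_op_bounded_ops D_op_bounded_ops V_op_bounded_ops)

text \<open>Normal ordering: moving \<open>V\<close> to the right stretches the frequency of \<open>M\<close> and shrinks the
  translation length of \<open>D\<close>.\<close>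

lemma Mon_compose:
  "Mon (a, b, n) o\<^sub>L Mon (a', b', n') = scaleC_op (cis (- (b * (exp n * a'))))
     (Mon (a + exp n * a', b + exp (- real n) * b', n + n'))"
proof -
  have "Mon (a, b, n) o\<^sub>L Mon (a', b', n')
    = M_op a o\<^sub>L D_op b o\<^sub>L (V_op n o\<^sub>L M_op a') o\<^sub>L D_op b' o\<^sub>L V_op n'"
    by (simp add: blinfun_compose_assoc)
  also have "\<dots> = M_op a o\<^sub>L (D_op b o\<^sub>L M_op (exp n * a')) o\<^sub>L (V_op n o\<^sub>L D_op b') o\<^sub>L V_op n'"
    by (simp add: V_M_op blinfun_compose_assoc)
  also have "\<dots> = M_op a o\<^sub>L scaleC_op (cis (- (b * (exp n * a')))) (M_op (exp n * a') o\<^sub>L D_op b)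
      o\<^sub>L D_op (exp (- real n) * b') o\<^sub>L (V_op n o\<^sub>L V_op n')"
    by (simp add: V_D_op D_M_op blinfun_compose_assoc)
  also have "\<dots> = scaleC_op (cis (- (b * (exp n * a'))))
      ((M_op a o\<^sub>L M_op (exp n * a')) o\<^sub>L (D_op b o\<^sub>L D_op (exp (- real n) * b')) o\<^sub>L V_op (n + n'))"
    by (simp add: scaleC_op_compose_left scaleC_op_compose_right M_op_bounded_ops V_op_add
        blinfun_compose_assoc)
  finally show ?thesis by (simp add: M_op_add D_op_add)
qed

lemma compose_op_of_polys:
  assumes p: "p \<in> polys" and q: "q \<in> polys"
  shows "op_of p o\<^sub>L op_of q \<in> op_of ` polys"
proof -
  have add: "X + Y \<in> op_of ` polys" if XY: "X \<in> op_of ` polys" "Y \<in> op_of ` polys" for X Y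
  proof -
    obtain p q where "p \<in> polys" "q \<in> polys" "X = op_of p" "Y = op_of q" using XY by blast
    then show ?thesis by (intro image_eqI[of _ _ "p @ q"]) (simp_all add: op_of_append)
  qed
  have mon: "scaleC_op c (Mon i) o\<^sub>L scaleC_op d (Mon j) \<in> op_of ` polys"
    if "i \<in> indices" "j \<in> indices" for c d i j
  proof -
    obtain a b n a' b' n' where ij: "i = (a, b, n)" "j = (a', b', n')" by (cases i, cases j) auto
    let ?k = "(a + exp n * a', b + exp (- real n) * b', n + n')"
    let ?c = "c * (d * cis (- (b * (exp n * a'))))"
    have "scaleC_op c (Mon i) o\<^sub>L scaleC_op d (Mon j) = op_of [(?c, ?k)]"
      by (simp add: ij scaleC_op_compose_left scaleC_op_compose_right Mon_bounded_ops Mon_compose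
          scaleC_op_scaleC_op del: Mon.simps)
    moreover have "[(?c, ?k)] \<in> polys" using that by (simp add: ij indices_def)
    ultimately show ?thesis by blast
  qed
  have "scaleC_op c (Mon i) o\<^sub>L op_of q \<in> op_of ` polys" if "i \<in> indices" for c i
    using q
  proof (induction q)
    case Nil
    have "[] \<in> polys" by simp
    then show ?case by (auto intro!: image_eqI[of _ _ "[]"])
  next
    case (Cons x q)
    then show ?case
      using mon[OF that, of "snd x" c "fst x"] by (auto simp: blinfun_compose_add_right intro!: add)
  qed
  then show ?thesis
    using p
  proof (induction p)
    case Nil
    have "[] \<in> polys" by simp
    then show ?case by (auto intro!: image_eqI[of _ _ "[]"])
  next
    case (Cons x p)
    then show ?case by (auto simp: blinfun_compose_add_left intro!: add)
  qed
qed

lemma op_algebra_A_ph: "op_algebra A_ph" and closed_A_ph: "closed A_ph"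
  using closed_op_algebra_A_ph by (simp_all add: closed_op_algebra_def)

lemma A_ph_bounded_ops: "X \<in> A_ph \<Longrightarrow> X \<in> bounded_ops"
  and A_ph_add: "X \<in> A_ph \<Longrightarrow> Y \<in> A_ph \<Longrightarrow> X + Y \<in> A_ph"
  and A_ph_scaleC: "X \<in> A_ph \<Longrightarrow> scaleC_op c X \<in> A_ph"
  and A_ph_compose: "X \<in> A_ph \<Longrightarrow> Y \<in> A_ph \<Longrightarrow> X o\<^sub>L Y \<in> A_ph"
  and A_ph_zero: "0 \<in> A_ph"
  using op_algebra_A_ph by (auto simp: op_algebra_def)

lemma A_ph_minus: "X \<in> A_ph \<Longrightarrow> Y \<in> A_ph \<Longrightarrow> X - Y \<in> A_ph"
  using A_ph_add[OF _ A_ph_scaleC, of X Y "- 1"] by (simp add: scaleC_op_minus_one)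

lemma gens_A_ph: "X \<in> A_ph_gens \<Longrightarrow> X \<in> A_ph"
  unfolding A_ph_def using hull_subset by (metis subsetD)

lemma M_op_A_ph: "0 \<le> a \<Longrightarrow> M_op a \<in> A_ph"
  and D_op_A_ph: "0 \<le> b \<Longrightarrow> D_op b \<in> A_ph"
  and V_op_A_ph: "V_op (real n) \<in> A_ph"
  by (auto intro!: gens_A_ph simp: A_ph_gens_def)

lemma Mon_A_ph: "i \<in> indices \<Longrightarrow> Mon i \<in> A_ph"
  by (auto simp: indices_def intro!: A_ph_compose M_op_A_ph D_op_A_ph V_op_A_ph)

lemma op_of_A_ph: "p \<in> polys \<Longrightarrow> op_of p \<in> A_ph"
  by (induction p) (auto intro!: A_ph_add A_ph_scaleC Mon_A_ph A_ph_zero)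

text \<open>By normal ordering the linear span of the monomials is closed under products, so its closure is a
  closed algebra.\<close>

lemma A_ph_subset_closure: "A_ph \<subseteq> closure (op_of ` polys)"
  unfolding A_ph_def
proof (rule hull_minimal)
  let ?S = "op_of ` polys"
  have one: "Mon i \<in> ?S" if "i \<in> indices" for i
    using that by (intro image_eqI[of _ _ "[(1, i)]"]) (auto simp: scaleC_op_one)
  show "A_ph_gens \<subseteq> closure ?S"
  proof
    fix X assume "X \<in> A_ph_gens"
    then consider a where "X = M_op a" "0 \<le> a" | b where "X = D_op b" "0 \<le> b"
      | n :: nat where "X = V_op n"
      by (auto simp: A_ph_gens_def)
    then have "\<exists>i\<in>indices. X = Mon i"
    proof cases
      case (1 a) then show ?thesis
        by (intro bexI[of _ "(a, 0, 0)"]) (auto simp: D_op_0 V_op_0 indices_def)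
    next
      case (2 b) then show ?thesis
        by (intro bexI[of _ "(0, b, 0)"]) (auto simp: M_op_0 V_op_0 indices_def)
    next
      case (3 n) then show ?thesis
        by (intro bexI[of _ "(0, 0, n)"]) (auto simp: M_op_0 D_op_0 indices_def)
    qed
    then show "X \<in> closure ?S" using one closure_subset by blast
  qed
  have bo: "op_of p \<in> bounded_ops" if "p \<in> polys" for p
    using op_of_A_ph[OF that] A_ph_bounded_ops by blast
  have "closed bounded_ops"
    using closed_op_algebra_bounded_ops by (simp add: closed_op_algebra_def)
  then have sub: "closure ?S \<subseteq> bounded_ops"
    using bo by (intro closure_minimal) auto
  have lim2: "h X Y \<in> closure ?S"
    if XY: "X \<in> closure ?S" "Y \<in> closure ?S"
      and h: "\<And>X Y. X \<in> ?S \<Longrightarrow> Y \<in> ?S \<Longrightarrow> h X Y \<in> ?S"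
      and cont: "\<And>u v X Y. u \<longlonglongrightarrow> X \<Longrightarrow> v \<longlonglongrightarrow> Y \<Longrightarrow> (\<lambda>n. h (u n) (v n)) \<longlonglongrightarrow> h X Y"
    for h X Y
  proof -
    obtain u v where "\<And>n. u n \<in> ?S" "u \<longlonglongrightarrow> X" "\<And>n. v n \<in> ?S" "v \<longlonglongrightarrow> Y"
      using XY unfolding closure_sequential by blast
    then have "\<And>n. h (u n) (v n) \<in> ?S" "(\<lambda>n. h (u n) (v n)) \<longlonglongrightarrow> h X Y"
      using h cont by auto
    then show ?thesis unfolding closure_sequential by (intro exI[of _ "\<lambda>n. h (u n) (v n)"]) auto
  qed
  show "closed_op_algebra (closure ?S)"
    unfolding closed_op_algebra_def op_algebra_def
  proof (intro conjI ballI allI sub closed_closure)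
    have "[] \<in> polys" by simp
    then have "op_of [] \<in> ?S" by (rule imageI)
    then show "0 \<in> closure ?S" using closure_subset by fastforce
    fix X assume X: "X \<in> closure ?S"
    show "scaleC_op c X \<in> closure ?S" for c
    proof (rule lim2[OF X X])
      show "scaleC_op c X \<in> ?S" if "X \<in> ?S" for X
        using that by (auto simp flip: op_of_map_mult intro!: imageI map_mult_polys)
    qed (rule bounded_linear.tendsto[OF bounded_linear_scaleC_op])

    fix Y assume Y: "Y \<in> closure ?S"
    show "X + Y \<in> closure ?S"
    proof (rule lim2[OF X Y])
      show "X + Y \<in> ?S" if XY: "X \<in> ?S" "Y \<in> ?S" for X Y
      proof -
        obtain p q where "p \<in> polys" "q \<in> polys" "X = op_of p" "Y = op_of q" using XY by blast
        then show ?thesis by (intro image_eqI[of _ _ "p @ q"]) (simp_all add: op_of_append)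
      qed
    qed (rule tendsto_add)
    show "X o\<^sub>L Y \<in> closure ?S"
    proof (rule lim2[OF X Y])
      show "X o\<^sub>L Y \<in> ?S" if "X \<in> ?S" "Y \<in> ?S" for X Y
        using that compose_op_of_polys by blast
    qed (rule bounded_bilinear.tendsto[OF bounded_bilinear_blinfun_compose])
  qed
qed

lemma A_ph_approx:
  assumes "X \<in> A_ph" "0 < e"
  obtains p where "p \<in> polys" "norm (X - op_of p) < e"
proof -
  have "X \<in> closure (op_of ` polys)" using assms A_ph_subset_closure by blast
  then obtain Y where "Y \<in> op_of ` polys" "dist Y X < e"
    using assms(2) unfolding closure_approachable by blast
  then show ?thesis using that by (auto simp: dist_norm norm_minus_commute)
qed

lemma LIMSEQ_null_bound:
  fixes f :: "nat \<Rightarrow> 'a :: real_normed_vector"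
  shows "(\<And>n. norm (f n) \<le> g n) \<Longrightarrow> g \<longlonglongrightarrow> 0 \<Longrightarrow> f \<longlonglongrightarrow> 0"
  by (rule Lim_null_comparison[OF always_eventually]) auto

section \<open>Extending functionals from the monomials to the algebra\<close>

text \<open>This is the condition under which prescribed values on the monomials extend to a contractive linear
  functional on the algebra. It also takes care of well-definedness, since an operator may be a
  combination of monomials in more than one way.\<close>

definition bounded_index :: "(real \<times> real \<times> nat \<Rightarrow> complex) \<Rightarrow> bool" where
  "bounded_index E \<longleftrightarrow> (\<forall>p\<in>polys. cmod (val E p) \<le> norm (op_of p))"

text \<open>An arbitrary approximating sequence of combinations is fixed; by \<open>extend_tendsto\<close> the extension does
  not depend on it.\<close>

definition approx :: "(L2 \<Rightarrow>\<^sub>L L2) \<Rightarrow> nat \<Rightarrow> (complex \<times> real \<times> real \<times> nat) list" where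
  "approx X k = (SOME p. p \<in> polys \<and> norm (X - op_of p) < inverse (real (Suc k)))"

definition extend :: "(real \<times> real \<times> nat \<Rightarrow> complex) \<Rightarrow> (L2 \<Rightarrow>\<^sub>L L2) \<Rightarrow> complex" where
  "extend E X = lim (\<lambda>k. val E (approx X k))"

lemma approx:
  assumes "X \<in> A_ph"
  shows "approx X k \<in> polys" "norm (X - op_of (approx X k)) < inverse (real (Suc k))"
proof -
  obtain p where "p \<in> polys" "norm (X - op_of p) < inverse (real (Suc k))"
    by (rule A_ph_approx[OF assms, of "inverse (real (Suc k))"]) auto
  then have "\<exists>p. p \<in> polys \<and> norm (X - op_of p) < inverse (real (Suc k))" by blast
  then have "approx X k \<in> polys \<and> norm (X - op_of (approx X k)) < inverse (real (Suc k))"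
    unfolding approx_def by (rule someI_ex)
  then show "approx X k \<in> polys" "norm (X - op_of (approx X k)) < inverse (real (Suc k))"
    by auto
qed

lemma approx_tendsto:
  assumes "X \<in> A_ph"
  shows "(\<lambda>k. op_of (approx X k)) \<longlonglongrightarrow> X"
proof -
  have "norm (op_of (approx X k) - X) \<le> inverse (real (Suc k))" for k
    using approx(2)[OF assms, of k] by (simp add: norm_minus_commute)
  then have "(\<lambda>k. op_of (approx X k) - X) \<longlonglongrightarrow> 0"
    by (rule LIMSEQ_null_bound[OF _ LIMSEQ_inverse_real_of_nat])
  then show ?thesis by (rule LIM_zero_cancel)
qed

lemma bounded_index_diff:
  assumes "bounded_index E" "p \<in> polys" "q \<in> polys"
  shows "cmod (val E p - val E q) \<le> norm (op_of p - op_of q)"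
proof -
  let ?r = "p @ map (apfst ((*) (- 1))) q"
  have "?r \<in> polys" using assms map_mult_polys[of q "- 1"] by simp
  then have "cmod (val E ?r) \<le> norm (op_of ?r)" using assms by (simp add: bounded_index_def)
  then show ?thesis
    by (simp add: val_append op_of_append val_map_mult op_of_map_mult scaleC_op_minus_one
        del: map_append)
qed

lemma extend_tendsto:
  assumes E: "bounded_index E" and X: "X \<in> A_ph" and p: "\<And>k. p k \<in> polys"
    and lim: "(\<lambda>k. op_of (p k)) \<longlonglongrightarrow> X"
  shows "(\<lambda>k. val E (p k)) \<longlonglongrightarrow> extend E X"
proof -
  let ?q = "approx X"
  have "Cauchy (\<lambda>k. op_of (?q k))" by (rule LIMSEQ_imp_Cauchy[OF approx_tendsto[OF X]])
  then have "Cauchy (\<lambda>k. val E (?q k))"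
    unfolding Cauchy_def dist_norm
    by (meson E X approx(1) bounded_index_diff order.strict_trans1)
  then have q: "(\<lambda>k. val E (?q k)) \<longlonglongrightarrow> extend E X"
    unfolding extend_def by (simp add: Cauchy_convergent_iff convergent_LIMSEQ_iff)
  have "(\<lambda>k. op_of (p k) - op_of (?q k)) \<longlonglongrightarrow> X - X"
    by (intro tendsto_intros lim approx_tendsto X)
  then have null: "(\<lambda>k. norm (op_of (p k) - op_of (?q k))) \<longlonglongrightarrow> 0"
    by (simp add: tendsto_norm_zero)
  have "cmod (val E (p k) - val E (?q k)) \<le> norm (op_of (p k) - op_of (?q k))" for k
    by (rule bounded_index_diff[OF E p approx(1)[OF X]])
  then have "(\<lambda>k. val E (p k) - val E (?q k)) \<longlonglongrightarrow> 0"
    by (rule LIMSEQ_null_bound[OF _ null])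
  from tendsto_add[OF this q] show ?thesis by simp
qed

lemma extend_op_of: "bounded_index E \<Longrightarrow> p \<in> polys \<Longrightarrow> extend E (op_of p) = val E p"
  using extend_tendsto[of E "op_of p" "\<lambda>_. p"] op_of_A_ph[of p]
  by (simp add: LIMSEQ_const_iff)

lemma extend_Mon: "bounded_index E \<Longrightarrow> i \<in> indices \<Longrightarrow> extend E (Mon i) = E i"
  using extend_op_of[of E "[(1, i)]"] by (simp add: scaleC_op_one)

lemma extend_add:
  assumes E: "bounded_index E" and X: "X \<in> A_ph" and Y: "Y \<in> A_ph"
  shows "extend E (X + Y) = extend E X + extend E Y"
proof -
  have "(\<lambda>k. val E (approx X k @ approx Y k)) \<longlonglongrightarrow> extend E (X + Y)"
    using approx(1)[OF X] approx(1)[OF Y]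
    by (intro extend_tendsto[OF E A_ph_add[OF X Y]])
      (auto simp: op_of_append intro!: tendsto_add approx_tendsto X Y)
  moreover have "(\<lambda>k. val E (approx X k @ approx Y k)) \<longlonglongrightarrow> extend E X + extend E Y"
    unfolding val_append using X Y
    by (intro tendsto_add extend_tendsto[OF E] approx_tendsto approx)
  ultimately show ?thesis by (rule LIMSEQ_unique)
qed

lemma extend_scaleC:
  assumes E: "bounded_index E" and X: "X \<in> A_ph"
  shows "extend E (scaleC_op c X) = c * extend E X"
proof -
  let ?p = "\<lambda>k. map (apfst ((*) c)) (approx X k)"
  have "(\<lambda>k. val E (?p k)) \<longlonglongrightarrow> extend E (scaleC_op c X)"
    using approx(1)[OF X] map_mult_polys
    by (intro extend_tendsto[OF E A_ph_scaleC[OF X]])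
      (auto simp: op_of_map_mult
        intro!: bounded_linear.tendsto[OF bounded_linear_scaleC_op] approx_tendsto X)
  moreover have "(\<lambda>k. val E (?p k)) \<longlonglongrightarrow> c * extend E X"
    unfolding val_map_mult using X
    by (intro tendsto_mult_left extend_tendsto[OF E] approx_tendsto approx)
  ultimately show ?thesis by (rule LIMSEQ_unique)
qed

lemma extend_norm:
  assumes E: "bounded_index E" and X: "X \<in> A_ph"
  shows "cmod (extend E X) \<le> norm X"
proof (rule LIMSEQ_le)
  show "(\<lambda>k. cmod (val E (approx X k))) \<longlonglongrightarrow> cmod (extend E X)"
    by (intro tendsto_norm extend_tendsto[OF E X] approx approx_tendsto X)
  show "(\<lambda>k. norm (op_of (approx X k))) \<longlonglongrightarrow> norm X"
    by (intro tendsto_norm approx_tendsto X)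
  show "\<exists>N. \<forall>n\<ge>N. cmod (val E (approx X n)) \<le> norm (op_of (approx X n))"
    using E approx(1)[OF X] by (auto simp: bounded_index_def)
qed

lemma extend_diff:
  assumes E: "bounded_index E" and X: "X \<in> A_ph" and Y: "Y \<in> A_ph"
  shows "extend E (X - Y) = extend E X - extend E Y"
  using extend_add[OF E X A_ph_scaleC[OF Y], of "- 1"] extend_scaleC[OF E Y, of "- 1"]
  by (simp add: scaleC_op_minus_one)

lemma extend_continuous:
  assumes E: "bounded_index E" and u: "\<And>n. u n \<in> A_ph" "u \<longlonglongrightarrow> X"
  shows "(\<lambda>n. extend E (u n)) \<longlonglongrightarrow> extend E X"
proof -
  have X: "X \<in> A_ph" using closed_A_ph u closed_sequentially by blast
  have "cmod (extend E (u n) - extend E X) \<le> norm (u n - X)" for n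
    using extend_norm[OF E A_ph_minus[OF u(1) X]] by (simp add: extend_diff[OF E u(1) X])
  then have "(\<lambda>n. extend E (u n) - extend E X) \<longlonglongrightarrow> 0"
    by (rule LIMSEQ_null_bound[OF _ tendsto_norm_zero[OF LIM_zero[OF u(2)]]])
  then show ?thesis by (rule LIM_zero_cancel)
qed

lemma extend_limit:
  assumes E: "\<And>n. bounded_index (E n)" and E': "bounded_index E'" and X: "X \<in> A_ph"
    and lim: "\<And>i. i \<in> indices \<Longrightarrow> (\<lambda>n. E n i) \<longlonglongrightarrow> E' i"
  shows "(\<lambda>n. extend (E n) X) \<longlonglongrightarrow> extend E' X"
proof (rule LIMSEQ_I)
  fix e :: real assume "0 < e"
  then obtain p where p: "p \<in> polys" "norm (X - op_of p) < e / 3"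
    using A_ph_approx[OF X, of "e / 3"] by auto
  have close: "cmod (extend F X - val F p) < e / 3" if "bounded_index F" for F
    using extend_norm[OF that A_ph_minus[OF X op_of_A_ph[OF p(1)]]] p that
    by (simp add: extend_diff X op_of_A_ph extend_op_of)
  have "(\<lambda>n. val (E n) p) \<longlonglongrightarrow> val E' p"
    using p(1) by (intro tendsto_val lim) (auto simp: in_lists_conv_set)
  then obtain N where N: "\<And>n. N \<le> n \<Longrightarrow> cmod (val (E n) p - val E' p) < e / 3"
    using LIMSEQ_D[of "\<lambda>n. val (E n) p" "val E' p" "e / 3"] \<open>0 < e\<close> by auto
  have "cmod (extend (E n) X - extend E' X) < e" if "N \<le> n" for n
  proof -
    have "extend (E n) X - extend E' X = (extend (E n) X - val (E n) p) + (val (E n) p - val E' p)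
        - (extend E' X - val E' p)" by simp
    also have "cmod \<dots> \<le> cmod (extend (E n) X - val (E n) p) + cmod (val (E n) p - val E' p)
        + cmod (extend E' X - val E' p)"
      by (rule order_trans[OF norm_triangle_ineq4 add_right_mono[OF norm_triangle_ineq]])
    finally show ?thesis using close[OF E, of n] close[OF E'] N[OF that] by linarith
  qed
  then show "\<exists>no. \<forall>n\<ge>no. norm (extend (E n) X - extend E' X) < e" by blast
qed

lemma val_cinner: "val (\<lambda>i. cinner_L2 (blinfun_apply (Mon i) \<xi>) \<eta>) p = cinner_L2 (blinfun_apply (op_of p) \<xi>) \<eta>"
proof (induction p)
  case Nil
  have "cinner_L2 0 \<eta> = 0" using cinner_diff_left[of 0 0 \<eta>] by simp
  then show ?case by simp
qed (simp add: blinfun.add_left scaleC_op_apply cinner_add_left cinner_scaleC_left)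

lemma norm_cinner_op_le:
  assumes "norm \<xi> \<le> 1" "norm \<eta> \<le> 1"
  shows "cmod (cinner_L2 (blinfun_apply X \<xi>) \<eta>) \<le> norm X"
proof -
  have "norm (blinfun_apply X \<xi>) * norm \<eta> \<le> (norm X * 1) * 1"
    using assms by (intro mult_mono order_trans[OF norm_blinfun] mult_left_mono) auto
  then show ?thesis using cinner_Cauchy_Schwarz[of "blinfun_apply X \<xi>" \<eta>] by simp
qed

lemma bounded_index_cinner:
  "norm \<xi> \<le> 1 \<Longrightarrow> norm \<eta> \<le> 1 \<Longrightarrow> bounded_index (\<lambda>i. cinner_L2 (blinfun_apply (Mon i) \<xi>) \<eta>)"
  by (simp add: bounded_index_def val_cinner norm_cinner_op_le)

lemma extend_cinner:
  assumes n: "norm \<xi> \<le> 1" "norm \<eta> \<le> 1" and X: "X \<in> A_ph"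
  shows "extend (\<lambda>i. cinner_L2 (blinfun_apply (Mon i) \<xi>) \<eta>) X = cinner_L2 (blinfun_apply X \<xi>) \<eta>"
proof (rule LIMSEQ_unique)
  show "(\<lambda>k. val (\<lambda>i. cinner_L2 (blinfun_apply (Mon i) \<xi>) \<eta>) (approx X k))
      \<longlonglongrightarrow> extend (\<lambda>i. cinner_L2 (blinfun_apply (Mon i) \<xi>) \<eta>) X"
    by (intro extend_tendsto bounded_index_cinner n X approx approx_tendsto)
  have "cmod (cinner_L2 (blinfun_apply (op_of (approx X k)) \<xi>) \<eta> - cinner_L2 (blinfun_apply X \<xi>) \<eta>)
      \<le> norm (op_of (approx X k) - X)" for k
    using norm_cinner_op_le[OF n, of "op_of (approx X k) - X"]
    by (simp add: blinfun.diff_left cinner_diff_left)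
  then have "(\<lambda>k. cinner_L2 (blinfun_apply (op_of (approx X k)) \<xi>) \<eta> - cinner_L2 (blinfun_apply X \<xi>) \<eta>) \<longlonglongrightarrow> 0"
    by (rule LIMSEQ_null_bound[OF _ tendsto_norm_zero[OF LIM_zero[OF approx_tendsto[OF X]]]])
  then show "(\<lambda>k. val (\<lambda>i. cinner_L2 (blinfun_apply (Mon i) \<xi>) \<eta>) (approx X k))
      \<longlonglongrightarrow> cinner_L2 (blinfun_apply X \<xi>) \<eta>"
    unfolding val_cinner by (rule LIM_zero_cancel)
qed

section \<open>Waves on intervals\<close>

text \<open>Cut-off waves \<open>c e\<^bsup>i\<phi>(x)\<^esup>\<close> are permuted by \<open>M\<close>, \<open>D\<close> and \<open>V\<close>, and their inner products are elementary
  when the phases differ by an affine function. All test vectors below are of this kind.\<close>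

definition wave_fun :: "real \<Rightarrow> real \<Rightarrow> real \<Rightarrow> (real \<Rightarrow> real) \<Rightarrow> real \<Rightarrow> complex" where
  "wave_fun p q c \<phi> x = indicator {p..q} x *\<^sub>R (of_real c * cis (\<phi> x))"

definition wave :: "real \<Rightarrow> real \<Rightarrow> real \<Rightarrow> (real \<Rightarrow> real) \<Rightarrow> L2" where
  "wave p q c \<phi> = abs_L2 (wave_fun p q c \<phi>)"

lemma sq_integrable_wave_fun:
  assumes "continuous_on UNIV \<phi>"
  shows "sq_integrable (wave_fun p q c \<phi>)"
proof -
  have [measurable]: "\<phi> \<in> borel_measurable borel"
    by (rule borel_measurable_continuous_onI[OF assms])
  have [measurable]: "cis \<in> borel_measurable borel"
    by (intro borel_measurable_continuous_onI continuous_intros)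
  have "(\<lambda>x. (cmod (wave_fun p q c \<phi> x))\<^sup>2) = (\<lambda>x. indicator {p..q} x *\<^sub>R c\<^sup>2)"
    by (rule ext) (simp add: wave_fun_def norm_mult indicator_def)
  moreover have "integrable lborel (\<lambda>x. indicator {p..q} x *\<^sub>R c\<^sup>2)"
    by (rule borel_integrable_compact) auto
  moreover have "wave_fun p q c \<phi> \<in> borel_measurable lborel"
    unfolding wave_fun_def by measurable
  ultimately show ?thesis by (simp add: sq_integrable_def)
qed

lemma L2_rel_wave: "continuous_on UNIV \<phi> \<Longrightarrow> L2_rel (wave_fun p q c \<phi>) (wave_fun p q c \<phi>)"
  by (simp add: L2_rel_def sq_integrable_wave_fun)

lemma M_op_wave:
  assumes "continuous_on UNIV \<phi>"
  shows "blinfun_apply (M_op a) (wave p q c \<phi>) = wave p q c (\<lambda>x. a * x + \<phi> x)"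
proof -
  have "(\<lambda>x. cis (a * x) * wave_fun p q c \<phi> x) = wave_fun p q c (\<lambda>x. a * x + \<phi> x)"
    by (rule ext) (simp add: wave_fun_def cis_mult[symmetric])
  then show ?thesis
    by (simp add: M_op_apply wave_def mult_L2.abs_eq[OF L2_rel_wave[OF assms]])
qed

lemma D_op_wave:
  assumes "continuous_on UNIV \<phi>"
  shows "blinfun_apply (D_op b) (wave p q c \<phi>) = wave (p + b) (q + b) c (\<lambda>x. \<phi> (x - b))"
proof -
  have "(\<lambda>x. wave_fun p q c \<phi> (x - b)) = wave_fun (p + b) (q + b) c (\<lambda>x. \<phi> (x - b))"
    by (rule ext) (auto simp: wave_fun_def indicator_def)
  then show ?thesis
    by (simp add: D_op_apply wave_def translate_L2.abs_eq[OF L2_rel_wave[OF assms]])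
qed

lemma V_op_wave:
  assumes "continuous_on UNIV \<phi>"
  shows "blinfun_apply (V_op t) (wave p q c \<phi>)
    = wave (exp (- t) * p) (exp (- t) * q) (exp (t / 2) * c) (\<lambda>x. \<phi> (exp t * x))"
proof -
  have "p \<le> exp t * x \<longleftrightarrow> exp (- t) * p \<le> x" "exp t * x \<le> q \<longleftrightarrow> x \<le> exp (- t) * q" for x
    by (simp_all add: exp_minus field_simps)
  then have "(\<lambda>x. complex_of_real (exp (t / 2)) * wave_fun p q c \<phi> (exp t * x))
      = wave_fun (exp (- t) * p) (exp (- t) * q) (exp (t / 2) * c) (\<lambda>x. \<phi> (exp t * x))"
    by (intro ext) (simp add: wave_fun_def indicator_def)
  then show ?thesis
    by (simp add: V_op_apply wave_def dilate_L2.abs_eq[OF L2_rel_wave[OF assms]])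
qed

lemma cinner_wave:
  assumes "continuous_on UNIV \<phi>" "continuous_on UNIV \<phi>'"
  shows "cinner_L2 (wave p q c \<phi>) (wave p' q' c' \<phi>') = of_real (c * c') *
    (LINT x|lborel. indicator {max p p'..min q q'} x *\<^sub>R cis (\<phi> x - \<phi>' x))"
proof -
  have "wave_fun p q c \<phi> x * cnj (wave_fun p' q' c' \<phi>' x)
    = of_real (c * c') * (indicator {max p p'..min q q'} x *\<^sub>R cis (\<phi> x - \<phi>' x))" for x
    by (auto simp: wave_fun_def indicator_def cis_cnj cis_mult[of _ "- _", simplified, symmetric])
  then show ?thesis
    unfolding wave_def cinner_L2.abs_eq[OF L2_rel_wave[OF assms(1)] L2_rel_wave[OF assms(2)]]
    by (simp only: Bochner_Integration.integral_mult_right_zero)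
qed

lemma cinner_wave_disjoint:
  assumes "continuous_on UNIV \<phi>" "continuous_on UNIV \<phi>'" "q < p' \<or> q' < p"
  shows "cinner_L2 (wave p q c \<phi>) (wave p' q' c' \<phi>') = 0"
proof -
  have "{max p p'..min q q'} = {}" using assms(3) by auto
  then show ?thesis unfolding cinner_wave[OF assms(1,2)] by simp
qed

lemma cinner_wave_constant_phase:
  assumes "continuous_on UNIV \<phi>" "continuous_on UNIV \<phi>'" "\<And>x. \<phi> x - \<phi>' x = \<kappa>"
  shows "cinner_L2 (wave p q c \<phi>) (wave p' q' c' \<phi>')
    = of_real (c * c' * max 0 (min q q' - max p p')) * cis \<kappa>"
proof -
  have "(LINT x|lborel. indicator {max p p'..min q q'} x *\<^sub>R cis \<kappa>)
      = of_real (max 0 (min q q' - max p p')) * cis \<kappa>"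
    by (simp add: measure_def scaleR_conv_of_real max_def)
  then show ?thesis unfolding cinner_wave[OF assms(1,2)] assms(3) by simp
qed

lemma cinner_wave_linear_phase:
  assumes "continuous_on UNIV \<phi>" "continuous_on UNIV \<phi>'"
    and phase: "\<And>x. \<phi> x - \<phi>' x = \<omega> * x + \<kappa>" and \<omega>: "\<omega> \<noteq> 0"
    and le: "max p p' \<le> min q q'"
  shows "cinner_L2 (wave p q c \<phi>) (wave p' q' c' \<phi>') = of_real (c * c') *
    ((cis (\<omega> * min q q' + \<kappa>) - cis (\<omega> * max p p' + \<kappa>)) / (\<i> * of_real \<omega>))"
proof -
  define F where "F x = cis (\<omega> * x + \<kappa>) / (\<i> * of_real \<omega>)" for x
  have "(F has_vector_derivative cis (\<omega> * x + \<kappa>)) (at x within S)" for x S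
  proof -
    have "((\<lambda>z. exp (\<i> * (of_real \<omega> * z + of_real \<kappa>)) / (\<i> * of_real \<omega>)) has_field_derivative
        exp (\<i> * (of_real \<omega> * of_real x + of_real \<kappa>))) (at (of_real x))"
      using \<omega> by (auto intro!: derivative_eq_intros) (simp add: complex_eq_iff)
    from has_vector_derivative_real_field[OF this] show ?thesis
      by (simp add: F_def[abs_def] cis_conv_exp)
  qed
  then have "(LINT x|lborel. indicator {max p p'..min q q'} x *\<^sub>R cis (\<omega> * x + \<kappa>))
      = F (min q q') - F (max p p')"
    by (intro integral_FTC_atLeastAtMost le continuous_intros)
  then show ?thesis
    unfolding cinner_wave[OF assms(1,2)] phase F_def by (simp add: diff_divide_distrib)
qed

lemma cinner_wave_oscillating:
  assumes "continuous_on UNIV \<phi>" "continuous_on UNIV \<phi>'"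
    and "\<And>x. \<phi> x - \<phi>' x = \<omega> * x + \<kappa>" and "\<omega> \<noteq> 0"
  shows "cmod (cinner_L2 (wave p q c \<phi>) (wave p' q' c' \<phi>')) \<le> \<bar>c * c'\<bar> * (2 / \<bar>\<omega>\<bar>)"
proof (cases "max p p' \<le> min q q'")
  case True
  have "cmod (cis (\<omega> * min q q' + \<kappa>) - cis (\<omega> * max p p' + \<kappa>)) \<le> 1 + 1"
    by (rule order_trans[OF norm_triangle_ineq4]) simp
  then show ?thesis
    unfolding cinner_wave_linear_phase[OF assms True] norm_mult norm_divide norm_of_real
    by (intro mult_left_mono) (simp_all add: divide_right_mono)
next
  case False
  then have "{max p p'..min q q'} = {}" by auto
  then show ?thesis unfolding cinner_wave[OF assms(1,2)] by simp
qed

lemma norm_wave: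
  assumes "continuous_on UNIV \<phi>" "p \<le> q" "0 \<le> c"
  shows "norm (wave p q c \<phi>) = c * sqrt (q - p)"
proof -
  have "cinner_L2 (wave p q c \<phi>) (wave p q c \<phi>) = of_real (c * c * (q - p))"
    using cinner_wave_constant_phase[OF assms(1,1), of 0 p q c p q c] assms(2) by simp
  then have "complex_of_real ((norm (wave p q c \<phi>))\<^sup>2) = of_real (c * c * (q - p))"
    by (simp only: cinner_self[symmetric])
  then have "(norm (wave p q c \<phi>))\<^sup>2 = c * c * (q - p)" by (simp only: of_real_eq_iff)
  also have "\<dots> = (c * sqrt (q - p))\<^sup>2" using assms(2) by (simp add: power_mult_distrib power2_eq_square)
  finally show ?thesis using assms by (simp add: power2_eq_iff_nonneg)
qed

section \<open>Boundary characters of the algebra\<close>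

text \<open>The Boolean selects one of the two families of characters: for \<open>True\<close> they read off the exponent of
  \<open>M\<close> and are supported where that of \<open>D\<close> is zero, for \<open>False\<close> conversely.\<close>

definition freq :: "bool \<Rightarrow> real \<times> real \<times> nat \<Rightarrow> real" where
  "freq s i = (if s then fst i else fst (snd i))"

definition cofreq :: "bool \<Rightarrow> real \<times> real \<times> nat \<Rightarrow> real" where
  "cofreq s i = (if s then fst (snd i) else fst i)"

definition char_index :: "bool \<Rightarrow> nat \<Rightarrow> complex \<Rightarrow> real \<times> real \<times> nat \<Rightarrow> complex" where
  "char_index s m z = expo (\<lambda>i. cofreq s i = 0 \<and> snd (snd i) = m) (freq s) z"

lemma Mon_V_apply:
  "blinfun_apply (Mon (a, b, n)) (blinfun_apply (V_op (- real m)) \<eta>)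
    = blinfun_apply (M_op a) (blinfun_apply (D_op b) (blinfun_apply (V_op (real n - real m)) \<eta>))"
proof -
  have "V_op (real n - real m) = V_op (real n) o\<^sub>L V_op (- real m)" by (simp add: V_op_add)
  then show ?thesis by simp
qed

lemma norm_V_apply: "norm (blinfun_apply (V_op t) \<eta>) = norm \<eta>"
  by (simp add: V_op_apply norm_dilate_L2)

text \<open>A normalised bump at \<open>x0\<close> is almost an eigenvector of each \<open>M\<^sub>a\<close>, while a monomial that moves the point
  \<open>x0\<close> makes the supports disjoint. The power of \<open>V\<close> applied beforehand selects the terms of degree \<open>m\<close>.\<close>

lemma bump_limit:
  fixes x0 :: real and m n :: nat
  defines "\<eta> \<equiv> \<lambda>k. wave x0 (x0 + inverse (real (Suc k))) (1 / sqrt (inverse (real (Suc k)))) (\<lambda>_. 0)"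
  assumes "(b = 0 \<and> n = m) \<or> b + (exp (- (real n - real m)) - 1) * x0 \<noteq> 0"
  shows "(\<lambda>k. cinner_L2 (blinfun_apply (Mon (a, b, n)) (blinfun_apply (V_op (- real m)) (\<eta> k))) (\<eta> k))
    \<longlonglongrightarrow> (if b = 0 \<and> n = m then exp (\<i> * of_real a * of_real x0) else 0)"
proof -
  let ?f = "\<lambda>k. cinner_L2 (blinfun_apply (Mon (a, b, n)) (blinfun_apply (V_op (- real m)) (\<eta> k))) (\<eta> k)"
  define h where "h k = inverse (real (Suc k))" for k
  have h0: "h \<longlonglongrightarrow> 0" unfolding h_def by (rule LIMSEQ_inverse_real_of_nat)
  have h: "0 < h k" for k by (simp add: h_def)
  define t where "t = real n - real m"
  have W: "blinfun_apply (Mon (a, b, n)) (blinfun_apply (V_op (- real m)) (\<eta> k))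
    = wave (exp (- t) * x0 + b) (exp (- t) * (x0 + h k) + b) (exp (t / 2) * (1 / sqrt (h k))) (\<lambda>x. a * x + 0)" for k
    unfolding Mon_V_apply \<eta>_def t_def h_def
    by (simp add: V_op_wave D_op_wave M_op_wave continuous_on_const)
  show ?thesis
  proof (cases "b = 0 \<and> n = m")
    case True
    have sq: "1 / sqrt (h k) * (1 / sqrt (h k)) = 1 / h k" for k
      using h[of k] by (simp add: field_simps)
    have val: "?f k
      = (if a = 0 then 1 else (exp (\<i> * of_real a * (of_real x0 + of_real (h k))) / (\<i> * of_real a)
        - exp (\<i> * of_real a * of_real x0) / (\<i> * of_real a)) / of_real (h k))" for k
    proof (cases "a = 0")
      case a: True
      show ?thesis
        unfolding W unfolding \<eta>_def h_def[symmetric]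
        using cinner_wave_constant_phase[of "\<lambda>x. a * x + 0" "\<lambda>_. 0" 0] True a h[of k]
        by (simp add: t_def continuous_on_const field_simps flip: of_real_mult)
    next
      case a: False
      have c: "continuous_on UNIV (\<lambda>x. a * x + 0)" "continuous_on UNIV (\<lambda>x::real. 0::real)"
        by (intro continuous_intros)+
      have "?f k
        = of_real (1 / sqrt (h k) * (1 / sqrt (h k))) *
          ((cis (a * (x0 + h k)) - cis (a * x0)) / (\<i> * of_real a))"
        unfolding W unfolding \<eta>_def h_def[symmetric]
        using cinner_wave_linear_phase[OF c, of a 0] True a h[of k]
        by (simp add: t_def less_imp_le flip: of_real_mult)
      then show ?thesis
        unfolding sq using a by (simp add: cis_conv_exp diff_divide_distrib mult_ac)
    qed
    show ?thesis
    proof (cases "a = 0")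
      case a: True
      then show ?thesis using True unfolding val by simp
    next
      case a: False
      let ?G = "\<lambda>z. exp (\<i> * of_real a * z) / (\<i> * of_real a)"
      have "(?G has_field_derivative exp (\<i> * of_real a * of_real x0)) (at (of_real x0))"
        using a by (auto intro!: derivative_eq_intros)
      then have "((\<lambda>w. (?G (of_real x0 + w) - ?G (of_real x0)) / w) \<longlongrightarrow> exp (\<i> * of_real a * of_real x0)) (at 0)"
        by (rule DERIV_D)
      moreover have "filterlim (\<lambda>k. complex_of_real (h k)) (at 0) sequentially"
        using tendsto_of_real[OF h0, where 'a = complex] h
        by (auto simp: filterlim_at intro!: always_eventually) (metis less_irrefl)
      ultimately have "(\<lambda>k. (?G (of_real x0 + of_real (h k)) - ?G (of_real x0)) / of_real (h k))
          \<longlonglongrightarrow> exp (\<i> * of_real a * of_real x0)"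
        by (rule filterlim_compose)
      then show ?thesis using True a unfolding val by simp
    qed
  next
    case False
    define u where "u = exp (- t) * x0 + b"
    have u: "u \<noteq> x0" using False assms(2) by (auto simp: u_def t_def algebra_simps)
    have "\<forall>\<^sub>F k in sequentially. exp (- t) * (x0 + h k) + b < x0 \<or> x0 + h k < exp (- t) * x0 + b"
    proof (cases "u < x0")
      case True
      have "(\<lambda>k. exp (- t) * (x0 + h k) + b) \<longlonglongrightarrow> exp (- t) * (x0 + 0) + b"
        by (intro tendsto_intros h0)
      then have "\<forall>\<^sub>F k in sequentially. exp (- t) * (x0 + h k) + b < x0"
        using True by (intro order_tendstoD(2)) (auto simp: u_def)
      then show ?thesis by eventually_elim simp
    next
      case False
      have "(\<lambda>k. x0 + h k) \<longlonglongrightarrow> x0 + 0" by (intro tendsto_intros h0)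
      then have "\<forall>\<^sub>F k in sequentially. x0 + h k < u"
        using False u by (intro order_tendstoD(2)) auto
      then show ?thesis by eventually_elim (simp add: u_def)
    qed
    then have "\<forall>\<^sub>F k in sequentially. ?f k = 0"
      unfolding W unfolding \<eta>_def h_def[symmetric]
      by eventually_elim (rule cinner_wave_disjoint, auto intro!: continuous_intros)
    then show ?thesis unfolding if_not_P[OF False] by (rule tendsto_eventually)
  qed
qed

text \<open>Dually, a long plane wave of frequency \<open>-x0\<close> is almost an eigenvector of each \<open>D\<^sub>b\<close>, and a monomial that
  changes the frequency produces an oscillating integral.\<close>

lemma packet_limit:
  fixes x0 :: real and m n :: nat
  defines "\<eta> \<equiv> \<lambda>k. wave 0 (real (Suc k)) (1 / sqrt (real (Suc k))) (\<lambda>x. - (x0 * x))"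
  assumes b: "0 \<le> b" and gen: "(a = 0 \<and> n = m) \<or> a + (1 - exp (real n - real m)) * x0 \<noteq> 0"
  shows "(\<lambda>k. cinner_L2 (blinfun_apply (Mon (a, b, n)) (blinfun_apply (V_op (- real m)) (\<eta> k))) (\<eta> k))
    \<longlonglongrightarrow> (if a = 0 \<and> n = m then exp (\<i> * of_real b * of_real x0) else 0)"
proof -
  let ?f = "\<lambda>k. cinner_L2 (blinfun_apply (Mon (a, b, n)) (blinfun_apply (V_op (- real m)) (\<eta> k))) (\<eta> k)"
  define N where "N k = real (Suc k)" for k
  have N: "0 < N k" for k by (simp add: N_def)
  have N0: "(\<lambda>k. 1 / N k) \<longlonglongrightarrow> 0"
    unfolding N_def using LIMSEQ_inverse_real_of_nat by (simp add: divide_inverse)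
  define t where "t = real n - real m"
  let ?\<phi> = "\<lambda>x. a * x + - (x0 * (exp t * (x - b)))"
  let ?\<phi>' = "\<lambda>x. - (x0 * x)"
  have c: "continuous_on UNIV ?\<phi>" "continuous_on UNIV ?\<phi>'"
    by (intro continuous_intros)+
  have W: "blinfun_apply (Mon (a, b, n)) (blinfun_apply (V_op (- real m)) (\<eta> k))
    = wave (exp (- t) * 0 + b) (exp (- t) * N k + b) (exp (t / 2) * (1 / sqrt (N k))) ?\<phi>" for k
    unfolding Mon_V_apply \<eta>_def t_def N_def
    by (subst V_op_wave D_op_wave M_op_wave, (intro continuous_intros)?)+ simp
  have phase: "?\<phi> x - ?\<phi>' x = (a + (1 - exp t) * x0) * x + x0 * exp t * b" for x
    by (simp add: algebra_simps)
  have sq: "1 / sqrt (N k) * (1 / sqrt (N k)) = 1 / N k" for k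
    using N[of k] by (simp add: field_simps)
  show ?thesis
  proof (cases "a = 0 \<and> n = m")
    case True
    have "?f k
      = of_real (max 0 (1 - b * (1 / N k))) * exp (\<i> * of_real b * of_real x0)" for k
    proof -
      have "?f k
        = of_real (1 / sqrt (N k) * (1 / sqrt (N k)) * max 0 (min (N k + b) (N k) - max b 0)) * cis (x0 * b)"
        unfolding W unfolding \<eta>_def N_def[symmetric]
        using cinner_wave_constant_phase[OF c, of "x0 * b"] phase True
        by (simp add: t_def flip: of_real_mult)
      also have "1 / sqrt (N k) * (1 / sqrt (N k)) * max 0 (min (N k + b) (N k) - max b 0) = max 0 (1 - b * (1 / N k))"
        unfolding sq using N[of k] b by (auto simp: max_def min_def field_simps)
      finally show ?thesis by (simp add: cis_conv_exp mult_ac)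
    qed
    moreover have "(\<lambda>k. complex_of_real (max 0 (1 - b * (1 / N k))) * exp (\<i> * of_real b * of_real x0))
        \<longlonglongrightarrow> of_real (max 0 (1 - b * 0)) * exp (\<i> * of_real b * of_real x0)"
      by (intro tendsto_intros N0)
    ultimately show ?thesis using True by simp
  next
    case False
    define \<omega> where "\<omega> = a + (1 - exp t) * x0"
    have "\<omega> \<noteq> 0" using False gen by (auto simp: \<omega>_def t_def)
    have "cmod (?f k)
      \<le> exp (t / 2) * (2 / \<bar>\<omega>\<bar>) * (1 / N k)" for k
    proof -
      have "cmod (?f k)
        \<le> \<bar>exp (t / 2) * (1 / sqrt (N k)) * (1 / sqrt (N k))\<bar> * (2 / \<bar>\<omega>\<bar>)"
        unfolding W unfolding \<eta>_def N_def[symmetric]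
        by (rule cinner_wave_oscillating[OF c phase[folded \<omega>_def] \<open>\<omega> \<noteq> 0\<close>])
      also have "\<bar>exp (t / 2) * (1 / sqrt (N k)) * (1 / sqrt (N k))\<bar> = exp (t / 2) * (1 / N k)"
        unfolding mult.assoc sq using N[of k] by (simp add: abs_mult)
      finally show ?thesis by (simp add: mult_ac)
    qed
    moreover have "(\<lambda>k. exp (t / 2) * (2 / \<bar>\<omega>\<bar>) * (1 / N k)) \<longlonglongrightarrow> 0"
      by (intro tendsto_mult_right_zero N0)
    ultimately show ?thesis unfolding if_not_P[OF False] by (rule LIMSEQ_null_bound)
  qed
qed

lemma affine_zero_finite:
  fixes \<alpha> \<beta> :: real
  assumes "\<alpha> \<noteq> 0 \<or> \<beta> \<noteq> 0"
  shows "finite {x. \<alpha> + \<beta> * x = 0}"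
proof (cases "\<beta> = 0")
  case False
  then have "{x. \<alpha> + \<beta> * x = 0} = {- \<alpha> / \<beta>}" by (auto simp: field_simps)
  then show ?thesis by simp
qed (use assms in simp)

text \<open>For all but finitely many points \<open>x\<close> the test vectors above single out the wanted monomials of the
  given combination; continuity in \<open>x\<close> covers the exceptions.\<close>

lemma char_index_real_bound:
  assumes p: "p \<in> polys"
  shows "cmod (val (char_index s m (of_real x)) p) \<le> norm (op_of p)"
proof -
  let ?\<alpha> = "cofreq s"
  let ?\<beta> = "\<lambda>i. if s then exp (- (real (snd (snd i)) - real m)) - 1 else 1 - exp (real (snd (snd i)) - real m)"
  let ?B = "{i \<in> snd ` set p. \<not> (cofreq s i = 0 \<and> snd (snd i) = m)}"
  define bad where "bad = (\<Union>i\<in>?B. {x. ?\<alpha> i + ?\<beta> i * x = 0})"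
  have "finite bad"
    unfolding bad_def
  proof (intro finite_UN_I affine_zero_finite)
    show "?\<alpha> i \<noteq> 0 \<or> ?\<beta> i \<noteq> 0" if "i \<in> ?B" for i
      using that by (cases s) auto
  qed simp
  have generic: "cmod (val (char_index s m (of_real x0)) p) \<le> norm (op_of p)" if "x0 \<notin> bad" for x0
  proof -
    define \<eta> where "\<eta> k = (if s
      then wave x0 (x0 + inverse (real (Suc k))) (1 / sqrt (inverse (real (Suc k)))) (\<lambda>_. 0)
      else wave 0 (real (Suc k)) (1 / sqrt (real (Suc k))) (\<lambda>x. - (x0 * x)))" for k
    have norm1: "norm (\<eta> k) = 1" for k
      unfolding \<eta>_def by (cases s) (auto simp: norm_wave continuous_intros)
    have lim: "(\<lambda>k. cinner_L2 (blinfun_apply (Mon i) (blinfun_apply (V_op (- real m)) (\<eta> k))) (\<eta> k))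
      \<longlonglongrightarrow> char_index s m (of_real x0) i" if i: "i \<in> snd ` set p" for i
    proof -
      obtain a b n where abn: "i = (a, b, n)" by (cases i)
      have "0 \<le> b" using p i by (auto simp: in_lists_conv_set indices_def abn)
      have gen: "(cofreq s i = 0 \<and> n = m) \<or> ?\<alpha> i + ?\<beta> i * x0 \<noteq> 0"
        using \<open>x0 \<notin> bad\<close> i by (auto simp: bad_def abn)
      show ?thesis
      proof (cases s)
        case True
        then show ?thesis
          using bump_limit[of b n m x0 a] gen
          by (auto simp: \<eta>_def char_index_def expo_def cofreq_def freq_def abn simp del: Mon.simps
              split: if_splits)
      next
        case False
        then show ?thesis
          using packet_limit[of b a n m x0] gen \<open>0 \<le> b\<close>
          by (auto simp: \<eta>_def char_index_def expo_def cofreq_def freq_def abn simp del: Mon.simps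
              split: if_splits)
      qed
    qed
    have "(\<lambda>k. cmod (val (\<lambda>i. cinner_L2 (blinfun_apply (Mon i) (blinfun_apply (V_op (- real m)) (\<eta> k))) (\<eta> k)) p))
      \<longlonglongrightarrow> cmod (val (char_index s m (of_real x0)) p)"
      by (intro tendsto_norm tendsto_val lim)
    moreover have "cmod (val (\<lambda>i. cinner_L2 (blinfun_apply (Mon i) (blinfun_apply (V_op (- real m)) (\<eta> k))) (\<eta> k)) p)
      \<le> norm (op_of p)" for k
      using bounded_index_cinner[of "blinfun_apply (V_op (- real m)) (\<eta> k)" "\<eta> k"] p
      by (simp add: norm_V_apply norm1 bounded_index_def)
    ultimately show ?thesis by (intro LIMSEQ_le_const2) auto
  qed
  have "continuous_on UNIV (\<lambda>z. val (char_index s m z) p)"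
    unfolding char_index_def by (rule holomorphic_on_imp_continuous_on[OF holomorphic_val_expo])
  then have *: "isCont (\<lambda>z. val (char_index s m z) p) z" for z
    by (simp add: continuous_on_eq_continuous_at)
  have "isCont (\<lambda>x. val (char_index s m (of_real x)) p) x"
    by (rule isCont_o2[where f = complex_of_real, OF _ *]) (intro continuous_intros)
  then have "((\<lambda>x. cmod (val (char_index s m (of_real x)) p)) \<longlongrightarrow> cmod (val (char_index s m (of_real x)) p)) (at x)"
    by (intro tendsto_norm) (simp add: isCont_def)
  moreover have "\<forall>\<^sub>F y in at x. y \<notin> bad"
    using islimpt_iff_eventually[of x bad] islimpt_finite[OF \<open>finite bad\<close>] by blast
  then have "\<forall>\<^sub>F y in at x. cmod (val (char_index s m (of_real y)) p) \<le> norm (op_of p)"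
    by eventually_elim (rule generic)
  ultimately show ?thesis by (rule tendsto_upperbound) simp
qed

lemma freq_nonneg: "i \<in> indices \<Longrightarrow> 0 \<le> freq s i" and cofreq_nonneg: "i \<in> indices \<Longrightarrow> 0 \<le> cofreq s i"
  by (auto simp: freq_def cofreq_def indices_def)

lemma polys_indices: "p \<in> polys \<Longrightarrow> i \<in> snd ` set p \<Longrightarrow> i \<in> indices"
  by (auto simp: in_lists_conv_set)

lemma bounded_char_index:
  assumes "0 < Im z"
  shows "bounded_index (char_index s m z)"
  unfolding bounded_index_def char_index_def
proof
  fix p assume p: "p \<in> polys"
  show "cmod (val (expo (\<lambda>i. cofreq s i = 0 \<and> snd (snd i) = m) (freq s) z) p) \<le> norm (op_of p)"
    by (rule val_expo_Phragmen_Lindelof[OF _ char_index_real_bound[OF p, unfolded char_index_def] assms])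
      (use p in \<open>auto intro!: freq_nonneg dest: polys_indices\<close>)
qed

text \<open>The symbol of degree \<open>m\<close> at a point \<open>z\<close> of the upper half-plane: for \<open>m = 0\<close> it is a character, for \<open>m = 1\<close> the off-diagonal entry of a
  triangular representation.\<close>

definition symb :: "bool \<Rightarrow> nat \<Rightarrow> (L2 \<Rightarrow>\<^sub>L L2) \<Rightarrow> complex \<Rightarrow> complex" where
  "symb s m X z = extend (char_index s m z) X"

lemma symb_holomorphic:
  assumes X: "X \<in> A_ph"
  shows "symb s m X holomorphic_on uhp"
proof (rule holomorphic_uniform_sequence[OF open_halfspace_Im_gt])
  show "(\<lambda>z. val (char_index s m z) (approx X n)) holomorphic_on uhp" for n
    unfolding char_index_def by (rule holomorphic_val_expo)
  fix z assume z: "z \<in> uhp"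
  obtain d where d: "0 < d" "cball z d \<subseteq> uhp"
    using open_halfspace_Im_gt[of 0] z unfolding open_contains_cball by blast
  have "uniform_limit (cball z d) (\<lambda>n w. val (char_index s m w) (approx X n)) (symb s m X) sequentially"
  proof (rule uniform_limitI)
    fix e :: real assume "0 < e"
    have "\<forall>\<^sub>F n in sequentially. inverse (real (Suc n)) < e"
      using order_tendstoD(2)[OF LIMSEQ_inverse_real_of_nat \<open>0 < e\<close>] .
    then show "\<forall>\<^sub>F n in sequentially. \<forall>w\<in>cball z d. dist (val (char_index s m w) (approx X n)) (symb s m X w) < e"
    proof eventually_elim
      case (elim n)
      show ?case
      proof
        fix w assume "w \<in> cball z d"
        then have b: "bounded_index (char_index s m w)" using d by (intro bounded_char_index) auto
        have "val (char_index s m w) (approx X n) - symb s m X w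
          = - extend (char_index s m w) (X - op_of (approx X n))"
          by (simp add: symb_def extend_diff b X op_of_A_ph approx extend_op_of)
        then have "dist (val (char_index s m w) (approx X n)) (symb s m X w)
          \<le> norm (X - op_of (approx X n))"
          using extend_norm[OF b A_ph_minus[OF X op_of_A_ph[OF approx(1)[OF X]]]] by (simp add: dist_norm)
        then show "dist (val (char_index s m w) (approx X n)) (symb s m X w) < e"
          using approx(2)[OF X, of n] elim by linarith
      qed
    qed
  qed
  then show "\<exists>d>0. cball z d \<subseteq> uhp \<and> uniform_limit (cball z d)
      (\<lambda>n w. val (char_index s m w) (approx X n)) (symb s m X) sequentially"
    using d by blast
qed

lemma A_ph_induct [consumes 1, case_names Mon add scaleC limit]:
  assumes X: "X \<in> A_ph"
    and mon: "\<And>i. i \<in> indices \<Longrightarrow> P (Mon i)"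
    and add: "\<And>X Y. X \<in> A_ph \<Longrightarrow> Y \<in> A_ph \<Longrightarrow> P X \<Longrightarrow> P Y \<Longrightarrow> P (X + Y)"
    and scale: "\<And>c X. X \<in> A_ph \<Longrightarrow> P X \<Longrightarrow> P (scaleC_op c X)"
    and lim: "\<And>u X. X \<in> A_ph \<Longrightarrow> (\<And>n. u n \<in> A_ph) \<Longrightarrow> (\<And>n. P (u n)) \<Longrightarrow> u \<longlonglongrightarrow> X \<Longrightarrow> P X"
  shows "P X"
proof (rule lim[OF X _ _ approx_tendsto[OF X]])
  have "P (op_of p)" if "p \<in> polys" for p
    using that
  proof (induction p)
    case Nil
    have i: "(0, 0, 0) \<in> indices" by (simp add: indices_def)
    have "scaleC_op 0 (Mon (0, 0, 0)) = 0"
      by (metis mult_zero_left norm_eq_zero norm_scaleC_op norm_zero)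
    then show ?case using scale[OF Mon_A_ph[OF i] mon[OF i], of 0] by simp
  qed (auto intro!: add scale mon Mon_A_ph A_ph_scaleC op_of_A_ph)
  then show "P (op_of (approx X n))" for n using approx(1)[OF X] .
  show "op_of (approx X n) \<in> A_ph" for n using op_of_A_ph approx(1)[OF X] .
qed

text \<open>Both multiplication laws below only have to be checked on monomials.\<close>

lemma extend_compose_eq:
  assumes E: "bounded_index E" "bounded_index E1" "bounded_index E2" "bounded_index E3" "bounded_index E4"
    and mon: "\<And>i j. i \<in> indices \<Longrightarrow> j \<in> indices \<Longrightarrow> extend E (Mon i o\<^sub>L Mon j) = E1 i * E2 j + E3 i * E4 j"
    and X: "X \<in> A_ph" and Y: "Y \<in> A_ph"
  shows "extend E (X o\<^sub>L Y) = extend E1 X * extend E2 Y + extend E3 X * extend E4 Y"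
proof -
  note tend = bounded_bilinear.tendsto[OF bounded_bilinear_blinfun_compose]
  have left: "extend E (X o\<^sub>L Mon j) = extend E1 X * E2 j + extend E3 X * E4 j" if j: "j \<in> indices" for j
    using X
  proof (induction rule: A_ph_induct)
    case (Mon i)
    then show ?case using mon j by (simp add: extend_Mon E)
  next
    case (add X Y)
    then show ?case
      by (simp add: blinfun_compose_add_left extend_add E A_ph_compose Mon_A_ph j algebra_simps)
  next
    case (scaleC c X)
    then show ?case
      by (simp add: scaleC_op_compose_left extend_scaleC E A_ph_compose Mon_A_ph j algebra_simps)
  next
    case (limit u X)
    have "(\<lambda>n. extend E (u n o\<^sub>L Mon j)) \<longlonglongrightarrow> extend E (X o\<^sub>L Mon j)"
      using limit by (intro extend_continuous E A_ph_compose Mon_A_ph j tend tendsto_const)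
    moreover have "(\<lambda>n. extend E1 (u n) * E2 j + extend E3 (u n) * E4 j) \<longlonglongrightarrow> extend E1 X * E2 j + extend E3 X * E4 j"
      using limit by (intro tendsto_intros extend_continuous E)
    ultimately show ?case unfolding limit.IH by (rule LIMSEQ_unique)
  qed
  show ?thesis
    using Y
  proof (induction rule: A_ph_induct)
    case (Mon j)
    then show ?case using left by (simp add: extend_Mon E)
  next
    case (add Y Z)
    then show ?case
      by (simp add: blinfun_compose_add_right extend_add E A_ph_compose X algebra_simps)
  next
    case (scaleC c Y)
    then show ?case
      by (simp add: scaleC_op_compose_right A_ph_bounded_ops extend_scaleC E A_ph_compose X algebra_simps)
  next
    case (limit u Y)
    have "(\<lambda>n. extend E (X o\<^sub>L u n)) \<longlonglongrightarrow> extend E (X o\<^sub>L Y)"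
      using limit by (intro extend_continuous E A_ph_compose X tend tendsto_const)
    moreover have "(\<lambda>n. extend E1 X * extend E2 (u n) + extend E3 X * extend E4 (u n))
        \<longlonglongrightarrow> extend E1 X * extend E2 Y + extend E3 X * extend E4 Y"
      using limit by (intro tendsto_intros extend_continuous E)
    ultimately show ?case unfolding limit.IH by (rule LIMSEQ_unique)
  qed
qed

lemma val_zero: "val (\<lambda>i. 0) p = 0"
  by (induction p) auto

lemma bounded_index_zero: "bounded_index (\<lambda>i. 0)"
  by (simp add: bounded_index_def val_zero)

lemma extend_zero: "extend (\<lambda>i. 0) X = 0"
  unfolding extend_def val_zero by (rule limI) simp

text \<open>The factor by which conjugation with \<open>V\<close> stretches the exponent of \<open>M\<close> and of \<open>D\<close>, respectively.\<close>

definition rate :: "bool \<Rightarrow> real" where "rate s = (if s then exp 1 else exp (- 1))"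

lemma rate_pos: "0 < rate s"
  by (simp add: rate_def)

lemma extend_Mon_compose:
  assumes "bounded_index E" "(a, b, n) \<in> indices" "(a', b', n') \<in> indices"
  shows "extend E (Mon (a, b, n) o\<^sub>L Mon (a', b', n')) = cis (- (b * (exp n * a'))) *
    E (a + exp n * a', b + exp (- real n) * b', n + n')"
proof -
  have i: "(a + exp n * a', b + exp (- real n) * b', n + n') \<in> indices"
    using assms by (simp add: indices_def)
  show ?thesis
    unfolding Mon_compose extend_scaleC[OF assms(1) Mon_A_ph[OF i]] extend_Mon[OF assms(1) i] ..
qed

lemma nonneg_combination_zero: "0 \<le> x \<Longrightarrow> 0 \<le> y \<Longrightarrow> x + exp t * y = 0 \<longleftrightarrow> x = 0 \<and> y = (0::real)"
  by (simp add: add_nonneg_eq_0_iff)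

lemma symb_0_compose:
  assumes z: "0 < Im z" and X: "X \<in> A_ph" and Y: "Y \<in> A_ph"
  shows "symb s 0 (X o\<^sub>L Y) z = symb s 0 X z * symb s 0 Y z"
proof -
  have "extend (char_index s 0 z) (X o\<^sub>L Y) = extend (char_index s 0 z) X * extend (char_index s 0 z) Y
      + extend (\<lambda>_. 0) X * extend (\<lambda>_. 0) Y"
  proof (rule extend_compose_eq)
    fix i j assume ij: "i \<in> indices" "j \<in> indices"
    obtain a b n where i: "i = (a, b, n)" by (cases i)
    obtain a' b' n' where j: "j = (a', b', n')" by (cases j)
    have nn: "0 \<le> a" "0 \<le> b" "0 \<le> a'" "0 \<le> b'" using ij by (auto simp: indices_def i j)
    show "extend (char_index s 0 z) (Mon i o\<^sub>L Mon j) = char_index s 0 z i * char_index s 0 z j + 0 * 0"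
      unfolding i j extend_Mon_compose[OF bounded_char_index[OF z] ij[unfolded i j]]
      by (cases s; simp add: char_index_def expo_def freq_def cofreq_def nn nonneg_combination_zero;
          auto simp: exp_add[symmetric] algebra_simps)
  qed (use z X Y in \<open>auto intro: bounded_char_index bounded_index_zero\<close>)
  then show ?thesis by (simp add: symb_def extend_zero)
qed

text \<open>Together with the previous lemma: \<open>X\<close> acts as the upper triangular matrix with diagonal
  \<open>symb s 0 X z\<close>, \<open>symb s 0 X (rate s * z)\<close> and corner \<open>symb s 1 X z\<close>. The second diagonal entry has a dilated
  argument because \<open>V\<close> has to be moved past the second factor.\<close>

lemma symb_1_compose:
  assumes z: "0 < Im z" and X: "X \<in> A_ph" and Y: "Y \<in> A_ph"
  shows "symb s 1 (X o\<^sub>L Y) z = symb s 0 X z * symb s 1 Y z + symb s 1 X z * symb s 0 Y (of_real (rate s) * z)"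
proof -
  have z': "0 < Im (of_real (rate s) * z)" using z by (simp add: rate_pos)
  show ?thesis
    unfolding symb_def
  proof (rule extend_compose_eq)
    fix i j assume ij: "i \<in> indices" "j \<in> indices"
    obtain a b n where i: "i = (a, b, n)" by (cases i)
    obtain a' b' n' where j: "j = (a', b', n')" by (cases j)
    have nn: "0 \<le> a" "0 \<le> b" "0 \<le> a'" "0 \<le> b'" using ij by (auto simp: indices_def i j)
    have deg: "n + n' = Suc 0 \<longleftrightarrow> n = 0 \<and> n' = 1 \<or> n = 1 \<and> n' = 0" by auto
    show "extend (char_index s 1 z) (Mon i o\<^sub>L Mon j) = char_index s 0 z i * char_index s 1 z j
        + char_index s 1 z i * char_index s 0 (of_real (rate s) * z) j"
      unfolding i j extend_Mon_compose[OF bounded_char_index[OF z] ij[unfolded i j]]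
      by (cases s; simp add: char_index_def expo_def freq_def cofreq_def rate_def nn deg nonneg_combination_zero;
          auto simp: exp_add[symmetric] algebra_simps)
  qed (use z z' X Y in \<open>auto intro: bounded_char_index\<close>)
qed

section \<open>Fourier coefficients and chirps\<close>

text \<open>The quadratic phase with growing rate spreads these vectors over a growing range of frequencies, and their
  supports move off to infinity; this separates the effects of \<open>M\<close>, \<open>D\<close> and \<open>V\<close> all at once.\<close>

definition chirp :: "nat \<Rightarrow> L2" where
  "chirp k = wave ((real (Suc k))\<^sup>2) ((real (Suc k))\<^sup>2 + real (Suc k)) (1 / sqrt (real (Suc k)))
     (\<lambda>x. real (Suc k) * x\<^sup>2)"

lemma norm_chirp: "norm (chirp k) = 1"
  unfolding chirp_def by (subst norm_wave) (auto intro!: continuous_intros)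

lemma eventually_Suc_ge: "\<forall>\<^sub>F k in sequentially. c \<le> real (Suc k)"
proof -
  obtain N where "c \<le> real N" using real_arch_simple by blast
  then show ?thesis by (intro eventually_sequentiallyI[of N]) simp
qed

text \<open>A dilation moves the support, at a distance of order \<open>k\<^sup>2\<close>, by more than its length \<open>k\<close>. A translation changes
  the frequency by an amount growing with \<open>k\<close>, a modulation by a fixed amount, and in both cases
  oscillation over an interval of length \<open>k\<close> makes the inner product small.\<close>

lemma chirp_limit:
  "(\<lambda>k. cinner_L2 (blinfun_apply (Mon (a, b, n)) (chirp k))
      (blinfun_apply (M_op \<alpha>) (blinfun_apply (D_op \<beta>) (chirp k))))
    \<longlonglongrightarrow> (if a = \<alpha> \<and> b = \<beta> \<and> n = 0 then 1 else 0)"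
  (is "?f \<longlonglongrightarrow> _")
proof -
  define N where "N k = real (Suc k)" for k
  have N: "0 < N k" for k by (simp add: N_def)
  let ?\<phi> = "\<lambda>k x. a * x + N k * (exp (real n) * (x - b))\<^sup>2"
  let ?\<phi>' = "\<lambda>k x. \<alpha> * x + N k * (x - \<beta>)\<^sup>2"
  have c: "continuous_on UNIV (?\<phi> k)" "continuous_on UNIV (?\<phi>' k)" for k
    by (intro continuous_intros)+
  have W: "blinfun_apply (Mon (a, b, n)) (chirp k)
    = wave (exp (- real n) * (N k)\<^sup>2 + b) (exp (- real n) * ((N k)\<^sup>2 + N k) + b)
        (exp (real n / 2) * (1 / sqrt (N k))) (?\<phi> k)" for k
    unfolding chirp_def N_def Mon.simps blinfun_apply_blinfun_compose
    by (subst V_op_wave D_op_wave M_op_wave, (intro continuous_intros)?)+ simp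
  have W': "blinfun_apply (M_op \<alpha>) (blinfun_apply (D_op \<beta>) (chirp k))
    = wave ((N k)\<^sup>2 + \<beta>) ((N k)\<^sup>2 + N k + \<beta>) (1 / sqrt (N k)) (?\<phi>' k)" for k
    unfolding chirp_def N_def
    by (subst D_op_wave M_op_wave, (intro continuous_intros)?)+ simp
  have sq: "1 / sqrt (N k) * (1 / sqrt (N k)) = 1 / N k" for k
    using N[of k] by (simp add: field_simps)
  consider (far) "n \<noteq> 0" | (same) "n = 0" "a = \<alpha>" "b = \<beta>" | (osc) "n = 0" "a \<noteq> \<alpha> \<or> b \<noteq> \<beta>" by blast
  then show ?thesis
  proof cases
    case far
    have "exp (- real n) \<le> 1 / 2"
    proof -
      have "2 \<le> 1 + real n" using far by simp
      also have "\<dots> \<le> exp (real n)" by (rule exp_ge_add_one_self)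
      finally show ?thesis by (simp add: exp_minus divide_simps)
    qed
    have "\<forall>\<^sub>F k in sequentially. max 3 (b - \<beta> + 1) \<le> N k"
      unfolding N_def by (rule eventually_Suc_ge)
    then have "\<forall>\<^sub>F k in sequentially. exp (- real n) * ((N k)\<^sup>2 + N k) + b < (N k)\<^sup>2 + \<beta>"
    proof eventually_elim
      case (elim k)
      have "exp (- real n) * ((N k)\<^sup>2 + N k) \<le> 1 / 2 * ((N k)\<^sup>2 + N k)"
        using \<open>exp (- real n) \<le> 1 / 2\<close> N[of k] by (intro mult_right_mono) auto
      moreover have "3 * N k \<le> (N k)\<^sup>2"
        unfolding power2_eq_square using elim N[of k] by (intro mult_right_mono) auto
      moreover have "b - \<beta> + 1 \<le> N k" using elim by simp
      moreover have "y + b < q + \<beta>"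
        if "y \<le> 1 / 2 * (q + M)" "3 * M \<le> q" "b - \<beta> + 1 \<le> M" for y q M :: real
        using that by (simp add: field_simps)
      ultimately show ?case by blast
    qed
    then have "\<forall>\<^sub>F k in sequentially. ?f k = 0"
      unfolding W W' by eventually_elim (rule cinner_wave_disjoint[OF c], simp)
    then show ?thesis using far by (simp add: tendsto_eventually del: Mon.simps)
  next
    case same
    have "?f k = 1" for k
    proof -
      have "?f k = of_real (1 / sqrt (N k) * (1 / sqrt (N k)) * max 0 (N k)) * cis 0"
        unfolding W W'
        using cinner_wave_constant_phase[OF c, of k k 0 "(N k)\<^sup>2 + b" "(N k)\<^sup>2 + N k + b" "1 / sqrt (N k)"
            "(N k)\<^sup>2 + b" "(N k)\<^sup>2 + N k + b" "1 / sqrt (N k)"] same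
        by simp
      then show ?thesis unfolding sq using N[of k] by simp
    qed
    then show ?thesis using same by simp
  next
    case osc
    define \<omega> where "\<omega> k = a - \<alpha> - 2 * N k * (b - \<beta>)" for k
    have phase: "?\<phi> k x - ?\<phi>' k x = \<omega> k * x + N k * (b\<^sup>2 - \<beta>\<^sup>2)" for k x
      using osc(1) by (simp add: \<omega>_def power2_eq_square algebra_simps)
    obtain d where d: "0 < d" "\<forall>\<^sub>F k in sequentially. d \<le> \<bar>\<omega> k\<bar>"
    proof (cases "b = \<beta>")
      case True
      then show ?thesis using osc by (intro that[of "\<bar>a - \<alpha>\<bar>"]) (auto simp: \<omega>_def)
    next
      case False
      have "\<forall>\<^sub>F k in sequentially. (1 + \<bar>a - \<alpha>\<bar>) / (2 * \<bar>b - \<beta>\<bar>) \<le> N k"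
        unfolding N_def by (rule eventually_Suc_ge)
      then have "\<forall>\<^sub>F k in sequentially. 1 \<le> \<bar>\<omega> k\<bar>"
      proof eventually_elim
        case (elim k)
        have "\<bar>2 * N k * (b - \<beta>)\<bar> = N k * (2 * \<bar>b - \<beta>\<bar>)"
          using N[of k] by (simp only: abs_mult abs_of_pos)
        then have "1 + \<bar>a - \<alpha>\<bar> \<le> \<bar>2 * N k * (b - \<beta>)\<bar>"
          using elim False by (simp add: divide_le_eq)
        moreover have "1 \<le> \<bar>x - y\<bar>" if "1 + \<bar>x\<bar> \<le> \<bar>y\<bar>" for x y :: real
          using that by linarith
        ultimately show ?case unfolding \<omega>_def by blast
      qed
      then show ?thesis using that[of 1] by simp
    qed
    have "\<forall>\<^sub>F k in sequentially. cmod (?f k) \<le> 2 / d * (1 / N k)"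
      using d(2)
    proof eventually_elim
      case (elim k)
      have "cmod (?f k) \<le> \<bar>exp (real n / 2) * (1 / sqrt (N k)) * (1 / sqrt (N k))\<bar> * (2 / \<bar>\<omega> k\<bar>)"
        unfolding W W' by (rule cinner_wave_oscillating[OF c phase]) (use elim d(1) in auto)
      also have "\<bar>exp (real n / 2) * (1 / sqrt (N k)) * (1 / sqrt (N k))\<bar> = 1 / N k"
        unfolding mult.assoc sq using N[of k] osc(1) by simp
      also have "1 / N k * (2 / \<bar>\<omega> k\<bar>) \<le> 1 / N k * (2 / d)"
        using elim d(1) N[of k] by (intro mult_left_mono divide_left_mono) auto
      finally show ?case by (simp add: mult.commute)
    qed
    moreover have "(\<lambda>k. 2 / d * (1 / N k)) \<longlonglongrightarrow> 0"
      unfolding N_def using LIMSEQ_inverse_real_of_nat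
      by (intro tendsto_mult_right_zero) (simp add: divide_inverse)
    ultimately have "?f \<longlonglongrightarrow> 0" by (rule Lim_null_comparison)
    moreover have "(if a = \<alpha> \<and> b = \<beta> \<and> n = 0 then 1 else 0) = (0::complex)" using osc by auto
    ultimately show ?thesis by (simp only:)
  qed
qed

definition coef_index :: "bool \<Rightarrow> real \<Rightarrow> real \<times> real \<times> nat \<Rightarrow> complex" where
  "coef_index s \<alpha> i = (if (cofreq s i = 0 \<and> snd (snd i) = 0) \<and> freq s i = \<alpha> then 1 else 0)"

definition coef :: "bool \<Rightarrow> real \<Rightarrow> (L2 \<Rightarrow>\<^sub>L L2) \<Rightarrow> complex" where
  "coef s \<alpha> X = extend (coef_index s \<alpha>) X"

lemma val_coef_index_bound:
  assumes "\<And>z. 0 < Im z \<Longrightarrow> cmod (val (char_index s 0 z) p) \<le> K"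
  shows "cmod (val (coef_index s \<alpha>) p) \<le> K"
  using val_expo_coefficient_bound[of "\<lambda>i. cofreq s i = 0 \<and> snd (snd i) = 0" "freq s" p K \<alpha>] assms
  unfolding char_index_def coef_index_def[abs_def] by blast

lemma bounded_coef_index: "bounded_index (coef_index s \<alpha>)"
  unfolding bounded_index_def
  using bounded_char_index by (auto simp: bounded_index_def intro!: val_coef_index_bound)

text \<open>The symbol is an almost periodic function with these numbers as Fourier coefficients.\<close>

lemma coef_eq_0_of_symb:
  assumes X: "X \<in> A_ph" and zero: "\<And>z. 0 < Im z \<Longrightarrow> symb s 0 X z = 0"
  shows "coef s \<alpha> X = 0"
proof -
  have "cmod (val (coef_index s \<alpha>) (approx X k)) \<le> norm (op_of (approx X k) - X)" for k
  proof (rule val_coef_index_bound)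
    fix z assume z: "0 < Im z"
    have p: "op_of (approx X k) \<in> A_ph" by (rule op_of_A_ph[OF approx(1)[OF X]])
    have "val (char_index s 0 z) (approx X k) = extend (char_index s 0 z) (op_of (approx X k) - X)"
      using zero[OF z] by (simp add: extend_diff bounded_char_index z p X extend_op_of approx(1) symb_def)
    then show "cmod (val (char_index s 0 z) (approx X k)) \<le> norm (op_of (approx X k) - X)"
      using extend_norm[OF bounded_char_index[OF z] A_ph_minus[OF p X]] by simp
  qed
  then have "(\<lambda>k. val (coef_index s \<alpha>) (approx X k)) \<longlonglongrightarrow> 0"
    by (rule LIMSEQ_null_bound[OF _ tendsto_norm_zero[OF LIM_zero[OF approx_tendsto[OF X]]]])
  moreover have "(\<lambda>k. val (coef_index s \<alpha>) (approx X k)) \<longlonglongrightarrow> coef s \<alpha> X"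
    unfolding coef_def by (intro extend_tendsto bounded_coef_index X approx approx_tendsto)
  ultimately show ?thesis using LIMSEQ_unique by blast
qed

text \<open>High up in the half-plane only the constant term of an exponential polynomial survives.\<close>

lemma symb_tendsto_coef_0:
  assumes X: "X \<in> A_ph" and w: "\<And>n. 0 < Im (w n)" "filterlim (\<lambda>n. Im (w n)) at_top sequentially"
  shows "(\<lambda>n. symb s 0 X (w n)) \<longlonglongrightarrow> coef s 0 X"
  unfolding symb_def coef_def
proof (rule extend_limit[OF bounded_char_index[OF w(1)] bounded_coef_index X])
  fix i assume i: "i \<in> indices"
  show "(\<lambda>n. char_index s 0 (w n) i) \<longlonglongrightarrow> coef_index s 0 i"
  proof (cases "cofreq s i = 0 \<and> snd (snd i) = 0 \<and> freq s i \<noteq> 0")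
    case True
    then have "0 < freq s i" using freq_nonneg[OF i, of s] by simp
    then have "filterlim (\<lambda>n. - freq s i * Im (w n)) at_bot sequentially"
      using w(2) by (intro filterlim_tendsto_neg_mult_at_bot[OF tendsto_const]) auto
    then have "(\<lambda>n. exp (- freq s i * Im (w n))) \<longlonglongrightarrow> 0"
      by (rule filterlim_compose[OF exp_at_bot])
    then have "(\<lambda>n. cmod (char_index s 0 (w n) i)) \<longlonglongrightarrow> 0"
      using True by (simp add: char_index_def expo_def)
    then have "(\<lambda>n. char_index s 0 (w n) i) \<longlonglongrightarrow> 0"
      by (simp add: tendsto_norm_zero_iff)
    then show ?thesis using True by (simp add: coef_index_def)
  qed (auto simp: char_index_def coef_index_def expo_def)
qed

definition U_op :: "bool \<Rightarrow> real \<Rightarrow> (L2 \<Rightarrow>\<^sub>L L2)" where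
  "U_op s a = (if s then M_op a else D_op a)"

lemma norm_U_apply: "norm (blinfun_apply (U_op s a) f) = norm f"
  by (simp add: U_op_def M_op_apply D_op_apply norm_mult_L2 norm_translate_L2)

lemma U_op_A_ph: "0 \<le> a \<Longrightarrow> U_op s a \<in> A_ph"
  by (simp add: U_op_def M_op_A_ph D_op_A_ph)

lemma blinfun_apply_scaleC: "X \<in> bounded_ops \<Longrightarrow> blinfun_apply X (scaleC_L2 c f) = scaleC_L2 c (blinfun_apply X f)"
  by (simp add: bounded_ops_def)

text \<open>The chirps may first be moved by a fixed operator of the other family: multiplying
  both operators in the inner product by it on the right does not affect the limit. This is needed to evaluate products of two operators on chirps.\<close>

lemma coef_limit:
  assumes X: "X \<in> A_ph"
  shows "(\<lambda>k. cinner_L2 (blinfun_apply X (blinfun_apply (U_op (\<not> s) c) (chirp k)))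
      (blinfun_apply (U_op s \<alpha>) (blinfun_apply (U_op (\<not> s) c) (chirp k)))) \<longlonglongrightarrow> coef s \<alpha> X"
proof -
  define \<eta> where "\<eta> k = blinfun_apply (U_op (\<not> s) c) (chirp k)" for k
  define \<zeta> where "\<zeta> k = blinfun_apply (U_op s \<alpha>) (\<eta> k)" for k
  have n1: "norm (\<eta> k) \<le> 1" "norm (\<zeta> k) \<le> 1" for k
    by (simp_all add: \<eta>_def \<zeta>_def norm_U_apply norm_chirp)
  have "(\<lambda>k. extend (\<lambda>i. cinner_L2 (blinfun_apply (Mon i) (\<eta> k)) (\<zeta> k)) X) \<longlonglongrightarrow> coef s \<alpha> X"
    unfolding coef_def
  proof (rule extend_limit[OF bounded_index_cinner[OF n1] bounded_coef_index X])
    fix i :: "real \<times> real \<times> nat"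
    obtain a b n where i: "i = (a, b, n)" by (cases i)
    show "(\<lambda>k. cinner_L2 (blinfun_apply (Mon i) (\<eta> k)) (\<zeta> k)) \<longlonglongrightarrow> coef_index s \<alpha> i"
    proof (cases s)
      case True
      have "blinfun_apply (Mon i) (\<eta> k) = blinfun_apply (Mon (a, b + exp (- real n) * c, n)) (chirp k)" for k
        using Mon_compose[of a b n 0 c 0] True
        by (simp add: \<eta>_def U_op_def i M_op_0 V_op_0 scaleC_op_one del: Mon.simps)
          (simp add: M_op_0 V_op_0 flip: blinfun_apply_blinfun_compose)
      then have "(\<lambda>k. cinner_L2 (blinfun_apply (Mon i) (\<eta> k)) (\<zeta> k))
          \<longlonglongrightarrow> (if a = \<alpha> \<and> b + exp (- real n) * c = c \<and> n = 0 then 1 else 0)"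
        using chirp_limit[of a "b + exp (- real n) * c" n \<alpha> c] True
        by (simp add: \<zeta>_def \<eta>_def U_op_def del: Mon.simps)
      moreover have "(if a = \<alpha> \<and> b + exp (- real n) * c = c \<and> n = 0 then 1 else 0) = coef_index s \<alpha> i"
        using True by (auto simp: coef_index_def i cofreq_def freq_def)
      ultimately show ?thesis by (simp only:)
    next
      case False
      have "blinfun_apply (Mon i) (\<eta> k) = scaleC_L2 (cis (- (b * (exp n * c))))
          (blinfun_apply (Mon (a + exp n * c, b, n)) (chirp k))" for k
      proof -
        have "Mon (c, 0, 0) = M_op c" by (simp add: D_op_0 V_op_0)
        then have "blinfun_apply (Mon i) (\<eta> k) = blinfun_apply (Mon (a, b, n) o\<^sub>L Mon (c, 0, 0)) (chirp k)"
          using False by (simp add: \<eta>_def U_op_def i del: Mon.simps)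
        then show ?thesis unfolding Mon_compose scaleC_op_apply by simp
      qed
      moreover have "\<zeta> k = scaleC_L2 (cis (- (\<alpha> * c))) (blinfun_apply (M_op c) (blinfun_apply (D_op \<alpha>) (chirp k)))" for k
      proof -
        have "\<zeta> k = blinfun_apply (D_op \<alpha> o\<^sub>L M_op c) (chirp k)" using False by (simp add: \<zeta>_def \<eta>_def U_op_def)
        then show ?thesis unfolding D_M_op scaleC_op_apply by simp
      qed
      ultimately have eq: "cinner_L2 (blinfun_apply (Mon i) (\<eta> k)) (\<zeta> k)
        = cis (- (b * (exp n * c))) * cnj (cis (- (\<alpha> * c))) *
          cinner_L2 (blinfun_apply (Mon (a + exp n * c, b, n)) (chirp k))
            (blinfun_apply (M_op c) (blinfun_apply (D_op \<alpha>) (chirp k)))" for k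
        by (simp add: cinner_scaleC_left cinner_scaleC_right del: Mon.simps)
      have "(\<lambda>k. cinner_L2 (blinfun_apply (Mon i) (\<eta> k)) (\<zeta> k))
          \<longlonglongrightarrow> cis (- (b * (exp n * c))) * cnj (cis (- (\<alpha> * c))) *
            (if a + exp n * c = c \<and> b = \<alpha> \<and> n = 0 then 1 else 0)"
        unfolding eq by (intro tendsto_intros chirp_limit)
      moreover have "cis (- (b * (exp n * c))) * cnj (cis (- (\<alpha> * c))) *
            (if a + exp n * c = c \<and> b = \<alpha> \<and> n = 0 then 1 else 0) = coef_index s \<alpha> i"
        using False by (auto simp: coef_index_def i cofreq_def freq_def cis_cnj cis_mult)
      ultimately show ?thesis by (simp only:)
    qed
  qed
  then show ?thesis unfolding extend_cinner[OF n1 X] by (simp add: \<eta>_def \<zeta>_def)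
qed

lemma norm_diff_power2: "(norm (x - y))\<^sup>2 = (norm x)\<^sup>2 - 2 * inner x y + (norm y)\<^sup>2"
  for x y :: "'a :: real_inner"
  by (simp add: power2_norm_eq_inner inner_diff_left inner_diff_right inner_commute)

text \<open>A contraction with a Fourier coefficient of modulus one acts on the chirps like the corresponding
  monomial: this is the equality case of Bessel's inequality.\<close>

lemma coef_modulus_one:
  assumes X: "X \<in> A_ph" and contr: "norm X \<le> 1" and C: "coef s \<alpha> X = C" "cmod C = 1"
  defines "\<eta> \<equiv> \<lambda>c k. blinfun_apply (U_op (\<not> s) c) (chirp k)"
  shows "(\<lambda>k. blinfun_apply X (\<eta> c k) - scaleC_L2 C (blinfun_apply (U_op s \<alpha>) (\<eta> c k))) \<longlonglongrightarrow> 0"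
proof -
  let ?q = "\<lambda>k. cinner_L2 (blinfun_apply X (\<eta> c k)) (blinfun_apply (U_op s \<alpha>) (\<eta> c k))"
  let ?d = "\<lambda>k. (norm (blinfun_apply X (\<eta> c k) - scaleC_L2 C (blinfun_apply (U_op s \<alpha>) (\<eta> c k))))\<^sup>2"
  let ?g = "\<lambda>k. 2 - 2 * Re (cnj C * ?q k)"
  have n1: "norm (\<eta> c k) = 1" for k by (simp add: \<eta>_def norm_U_apply norm_chirp)
  have "?d k \<le> ?g k" for k
  proof -
    have "norm (blinfun_apply X (\<eta> c k)) \<le> 1"
      using norm_blinfun[of X "\<eta> c k"] contr by (simp add: n1)
    then have "(norm (blinfun_apply X (\<eta> c k)))\<^sup>2 \<le> 1"
      by (simp add: power_le_one)
    moreover have "norm (scaleC_L2 C (blinfun_apply (U_op s \<alpha>) (\<eta> c k))) = 1"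
      by (simp add: norm_scaleC_L2 C norm_U_apply n1)
    moreover have "inner (blinfun_apply X (\<eta> c k)) (scaleC_L2 C (blinfun_apply (U_op s \<alpha>) (\<eta> c k)))
        = Re (cnj C * ?q k)"
      by (simp add: inner_L2_def cinner_scaleC_right)
    ultimately show ?thesis
      unfolding norm_diff_power2 by (simp only: one_power2)
  qed
  then have le: "norm (?d k) \<le> ?g k" for k by simp
  have "(\<lambda>k. 2 - 2 * Re (cnj C * ?q k)) \<longlonglongrightarrow> 2 - 2 * Re (cnj C * C)"
    unfolding \<eta>_def using coef_limit[OF X, of s c \<alpha>] C(1) by (intro tendsto_intros) simp
  moreover have "cnj C * C = 1"
    using C(2) complex_norm_square[of C] by (simp add: mult.commute)
  ultimately have "?g \<longlonglongrightarrow> 0" by simp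
  with le have "?d \<longlonglongrightarrow> 0" by (rule LIMSEQ_null_bound)
  from tendsto_real_sqrt[OF this]
  have "(\<lambda>k. norm (blinfun_apply X (\<eta> c k) - scaleC_L2 C (blinfun_apply (U_op s \<alpha>) (\<eta> c k)))) \<longlonglongrightarrow> 0"
    by simp
  then show ?thesis by (rule tendsto_norm_zero_cancel)
qed

lemma coef_U_op: "0 \<le> \<beta> \<Longrightarrow> coef s \<alpha> (U_op s \<beta>) = (if \<alpha> = \<beta> then 1 else 0)"
proof -
  assume "0 \<le> \<beta>"
  let ?i = "if s then (\<beta>, 0, 0) else (0, \<beta>, 0) :: real \<times> real \<times> nat"
  have "U_op s \<beta> = Mon ?i" by (simp add: U_op_def M_op_0 D_op_0 V_op_0)
  moreover have "?i \<in> indices" using \<open>0 \<le> \<beta>\<close> by (simp add: indices_def)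
  ultimately show ?thesis
    unfolding coef_def by (simp only: extend_Mon[OF bounded_coef_index])
      (auto simp: coef_index_def cofreq_def freq_def)
qed

section \<open>Rigidity of anti-automorphisms\<close>

lemma symb_add: "0 < Im z \<Longrightarrow> X \<in> A_ph \<Longrightarrow> Y \<in> A_ph \<Longrightarrow> symb s m (X + Y) z = symb s m X z + symb s m Y z"
  and symb_scaleC: "0 < Im z \<Longrightarrow> X \<in> A_ph \<Longrightarrow> symb s m (scaleC_op c X) z = c * symb s m X z"
  and symb_diff: "0 < Im z \<Longrightarrow> X \<in> A_ph \<Longrightarrow> Y \<in> A_ph \<Longrightarrow> symb s m (X - Y) z = symb s m X z - symb s m Y z"
  and symb_bound: "0 < Im z \<Longrightarrow> X \<in> A_ph \<Longrightarrow> cmod (symb s m X z) \<le> norm X"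
  and symb_Mon: "0 < Im z \<Longrightarrow> i \<in> indices \<Longrightarrow> symb s m (Mon i) z = char_index s m z i"
  and symb_continuous: "0 < Im z \<Longrightarrow> (\<And>n. u n \<in> A_ph) \<Longrightarrow> u \<longlonglongrightarrow> X \<Longrightarrow> (\<lambda>n. symb s m (u n) z) \<longlonglongrightarrow> symb s m X z"
  by (simp_all add: symb_def extend_add extend_scaleC extend_diff extend_norm extend_Mon extend_continuous bounded_char_index
      del: Mon.simps)

lemma id_eq_Mon: "id_blinfun = Mon (0, 0, 0)"
  and V_eq_Mon: "V_op 1 = Mon (0, 0, 1)"
  and U_eq_Mon: "U_op s a = Mon (if s then (a, 0, 0) else (0, a, 0))"
  by (simp_all add: M_op_0 D_op_0 V_op_0 U_op_def)

lemma id_A_ph: "id_blinfun \<in> A_ph" and V1_A_ph: "V_op 1 \<in> A_ph"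
  by (simp_all add: id_eq_Mon V_eq_Mon Mon_A_ph indices_def del: Mon.simps)

lemma symb_id: "0 < Im z \<Longrightarrow> symb s m id_blinfun z = (if m = 0 then 1 else 0)"
  and symb_U: "0 < Im z \<Longrightarrow> 0 \<le> a \<Longrightarrow> symb s m (U_op s a) z = (if m = 0 then exp (\<i> * of_real a * z) else 0)"
  and symb_V: "0 < Im z \<Longrightarrow> symb s m (V_op 1) z = (if m = 1 then 1 else 0)"
  unfolding id_eq_Mon V_eq_Mon U_eq_Mon
  by (subst symb_Mon; auto simp: indices_def char_index_def expo_def cofreq_def freq_def)+

lemma U_op_0: "U_op s 0 = id_blinfun"
  by (simp add: U_op_def M_op_0 D_op_0)

lemma U_op_add: "U_op s a o\<^sub>L U_op s b = U_op s (a + b)"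
  by (simp add: U_op_def M_op_add D_op_add)

lemma V_U_op: "V_op 1 o\<^sub>L U_op s a = U_op s (rate s * a) o\<^sub>L V_op 1"
  by (simp add: U_op_def V_M_op V_D_op rate_def)

lemma coef_diff: "X \<in> A_ph \<Longrightarrow> Y \<in> A_ph \<Longrightarrow> coef s \<alpha> (X - Y) = coef s \<alpha> X - coef s \<alpha> Y"
  and coef_add: "X \<in> A_ph \<Longrightarrow> Y \<in> A_ph \<Longrightarrow> coef s \<alpha> (X + Y) = coef s \<alpha> X + coef s \<alpha> Y"
  and coef_scaleC: "X \<in> A_ph \<Longrightarrow> coef s \<alpha> (scaleC_op c X) = c * coef s \<alpha> X"
  and coef_continuous: "(\<And>n. u n \<in> A_ph) \<Longrightarrow> u \<longlonglongrightarrow> X \<Longrightarrow> (\<lambda>n. coef s \<alpha> (u n)) \<longlonglongrightarrow> coef s \<alpha> X"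
  by (simp_all add: coef_def extend_diff extend_add extend_scaleC extend_continuous bounded_coef_index)

lemma coef_eqI_symb:
  assumes X: "X \<in> A_ph" and \<beta>: "0 \<le> \<beta>"
    and eq: "\<And>z. 0 < Im z \<Longrightarrow> symb s 0 X z = C * exp (\<i> * of_real \<beta> * z)"
  shows "coef s \<alpha> X = (if \<alpha> = \<beta> then C else 0)"
proof -
  have CU: "scaleC_op C (U_op s \<beta>) \<in> A_ph" by (intro A_ph_scaleC U_op_A_ph \<beta>)
  have "coef s \<alpha> (X - scaleC_op C (U_op s \<beta>)) = 0"
    using X CU \<beta> U_op_A_ph[OF \<beta>, of s]
    by (intro coef_eq_0_of_symb A_ph_minus) (simp_all add: symb_diff symb_scaleC symb_U eq)
  then show ?thesis
    using coef_U_op[OF \<beta>, of s \<alpha>] by (simp add: coef_diff X CU coef_scaleC U_op_A_ph \<beta> split: if_splits)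
qed

text \<open>Equality of the corners of the two products \<open>X Y\<close> and \<open>Y X\<close> in the triangular representation.\<close>

definition commuting_at :: "bool \<Rightarrow> complex \<Rightarrow> (L2 \<Rightarrow>\<^sub>L L2) \<Rightarrow> (L2 \<Rightarrow>\<^sub>L L2) \<Rightarrow> bool" where
  "commuting_at s z X Y \<longleftrightarrow>
     symb s 1 X z * (symb s 0 Y (of_real (rate s) * z) - symb s 0 Y z)
   = symb s 1 Y z * (symb s 0 X (of_real (rate s) * z) - symb s 0 X z)"

lemma commuting_at_sym: "commuting_at s z X Y \<Longrightarrow> commuting_at s z Y X"
  by (simp add: commuting_at_def)

lemma commuting_at_if_commute:
  assumes "0 < Im z" "X \<in> A_ph" "Y \<in> A_ph" "X o\<^sub>L Y = Y o\<^sub>L X"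
  shows "commuting_at s z X Y"
  using symb_1_compose[of z X Y s] symb_1_compose[of z Y X s] assms
  by (simp add: commuting_at_def algebra_simps)

lemma commuting_at_compose:
  assumes z: "0 < Im z" and A: "X \<in> A_ph" "Y \<in> A_ph"
    and c: "commuting_at s z X G" "commuting_at s z Y G"
  shows "commuting_at s z (X o\<^sub>L Y) G"
proof -
  define r where "r = complex_of_real (rate s) * z"
  have r: "0 < Im r" using z by (simp add: r_def rate_pos)
  show ?thesis
    using c unfolding commuting_at_def r_def[symmetric]
      symb_1_compose[OF z A, of s, folded r_def] symb_0_compose[OF z A] symb_0_compose[OF r A]
    by algebra
qed

text \<open>Such maps arise when an isomorphism onto the adjoint algebra is followed by the adjoint. The range
  condition is restricted to the generators because their adjoints are explicit, so that they
  are seen to be reached without the completeness of the Hilbert space.\<close>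

locale anti_automorphism =
  fixes \<Psi> :: "(L2 \<Rightarrow>\<^sub>L L2) \<Rightarrow> (L2 \<Rightarrow>\<^sub>L L2)"
  assumes psi_A: "X \<in> A_ph \<Longrightarrow> \<Psi> X \<in> A_ph"
    and psi_add: "X \<in> A_ph \<Longrightarrow> Y \<in> A_ph \<Longrightarrow> \<Psi> (X + Y) = \<Psi> X + \<Psi> Y"
    and psi_scaleC: "X \<in> A_ph \<Longrightarrow> \<Psi> (scaleC_op c X) = scaleC_op (cnj c) (\<Psi> X)"
    and psi_comp: "X \<in> A_ph \<Longrightarrow> Y \<in> A_ph \<Longrightarrow> \<Psi> (X o\<^sub>L Y) = \<Psi> Y o\<^sub>L \<Psi> X"
    and psi_norm: "X \<in> A_ph \<Longrightarrow> norm (\<Psi> X) = norm X"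
    and psi_one: "\<Psi> id_blinfun = id_blinfun"
    and psi_range: "X \<in> A_ph_gens \<Longrightarrow> \<exists>Y\<in>A_ph. \<Psi> Y = X"
begin

lemma psi_continuous:
  assumes u: "\<And>n. u n \<in> A_ph" "u \<longlonglongrightarrow> X" and X: "X \<in> A_ph"
  shows "(\<lambda>n. \<Psi> (u n)) \<longlonglongrightarrow> \<Psi> X"
proof -
  have "norm (\<Psi> (u n) - \<Psi> X) = norm (u n - X)" for n
  proof -
    have mX: "- X \<in> A_ph" using A_ph_scaleC[OF X, of "- 1"] by (simp add: scaleC_op_minus_one)
    have "\<Psi> (- X) = - \<Psi> X" using psi_scaleC[OF X, of "- 1"] by (simp add: scaleC_op_minus_one)
    then have "\<Psi> (u n - X) = \<Psi> (u n) - \<Psi> X" using psi_add[OF u(1) mX, of n] by simp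
    then show ?thesis using psi_norm[OF A_ph_minus[OF u(1) X]] by metis
  qed
  then have "(\<lambda>n. norm (\<Psi> (u n) - \<Psi> X)) \<longlonglongrightarrow> 0"
    using tendsto_norm_zero[OF LIM_zero[OF u(2)]] by simp
  then have "(\<lambda>n. \<Psi> (u n) - \<Psi> X) \<longlonglongrightarrow> 0" by (rule tendsto_norm_zero_cancel)
  then show ?thesis by (rule LIM_zero_cancel)
qed

definition T :: "bool \<Rightarrow> real \<Rightarrow> (L2 \<Rightarrow>\<^sub>L L2)" where "T s a = \<Psi> (U_op s a)"

definition W :: "L2 \<Rightarrow>\<^sub>L L2" where "W = \<Psi> (V_op 1)"

lemma T_A: "0 \<le> a \<Longrightarrow> T s a \<in> A_ph" and W_A: "W \<in> A_ph"
  by (simp_all add: T_def W_def psi_A U_op_A_ph V1_A_ph)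

lemma T_0: "T s 0 = id_blinfun"
  by (simp add: T_def U_op_0 psi_one)

lemma T_add: "0 \<le> a \<Longrightarrow> 0 \<le> b \<Longrightarrow> T s (a + b) = T s a o\<^sub>L T s b"
  using psi_comp[of "U_op s b" "U_op s a"] by (simp add: T_def U_op_A_ph U_op_add add.commute)

lemma T_W: "0 \<le> a \<Longrightarrow> T s a o\<^sub>L W = W o\<^sub>L T s (rate s * a)"
  using psi_comp[of "V_op 1" "U_op s a"] psi_comp[of "U_op s (rate s * a)" "V_op 1"] rate_pos[of s]
  by (simp add: T_def W_def U_op_A_ph V1_A_ph V_U_op)

lemma T_commutation:
  assumes "0 \<le> a" "0 \<le> b"
  shows "T True a o\<^sub>L T False b = scaleC_op (cis (a * b)) (T False b o\<^sub>L T True a)"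
proof -
  have AM: "M_op a \<in> A_ph" "D_op b \<in> A_ph" using assms by (simp_all add: M_op_A_ph D_op_A_ph)
  have "\<Psi> (D_op b o\<^sub>L M_op a) = scaleC_op (cnj (cis (- (b * a)))) (\<Psi> (M_op a o\<^sub>L D_op b))"
    by (simp only: D_M_op psi_scaleC A_ph_compose AM)
  then show ?thesis by (simp add: T_def U_op_def psi_comp AM cis_cnj mult.commute)
qed

lemma T_norm: "0 \<le> a \<Longrightarrow> norm (T s a) \<le> 1"
  using psi_norm[OF U_op_A_ph, of a s] norm_M_op[of a] norm_D_op[of a]
  by (simp add: T_def U_op_def)

lemma V_Suc: "V_op (real (Suc n)) = V_op 1 o\<^sub>L V_op (real n)"
  by (simp add: V_op_add)

lemma Psi_Mon:
  assumes "(a, b, n) \<in> indices"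
  shows "\<Psi> (Mon (a, b, n)) = \<Psi> (V_op (real n)) o\<^sub>L (T False b o\<^sub>L T True a)"
  using assms
  by (simp add: psi_comp A_ph_compose M_op_A_ph D_op_A_ph V_op_A_ph indices_def T_def U_op_def)

lemma commuting_generators_imp_all:
  assumes z: "0 < Im z" and G: "G \<in> A_ph"
    and T: "\<And>s' a. 0 < a \<Longrightarrow> commuting_at s z (T s' a) G" and W: "commuting_at s z W G"
    and X: "X \<in> A_ph"
  shows "commuting_at s z (\<Psi> X) G"
  using X
proof (induction rule: A_ph_induct)
  case (Mon i)
  have z': "0 < Im (of_real (rate s) * z)" using z by (simp add: rate_pos)
  have id: "commuting_at s z id_blinfun G"
    using z z' by (simp add: commuting_at_def symb_id)
  have T': "commuting_at s z (T s' a) G" if "0 \<le> a" for s' a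
    using T[of a s'] id that by (cases "a = 0") (auto simp: T_0)
  have V: "commuting_at s z (\<Psi> (V_op (real n))) G" for n
  proof (induction n)
    case 0
    then show ?case using id by (simp add: V_op_0 psi_one)
  next
    case (Suc n)
    have "\<Psi> (V_op (real (Suc n))) = \<Psi> (V_op (real n)) o\<^sub>L W"
      unfolding V_Suc W_def by (intro psi_comp V1_A_ph V_op_A_ph)
    then show ?case using Suc W z by (simp only:) (intro commuting_at_compose psi_A V_op_A_ph W_A)
  qed
  obtain a b n where i: "i = (a, b, n)" by (cases i)
  have ab: "0 \<le> a" "0 \<le> b" using Mon by (auto simp: i indices_def)
  show ?case
    using Mon ab z unfolding i by (subst Psi_Mon) (auto intro!: commuting_at_compose A_ph_compose V T' T_A psi_A V_op_A_ph)
next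
  case (add X Y)
  have z': "0 < Im (of_real (rate s) * z)" using z by (simp add: rate_pos)
  show ?case
    using add.IH unfolding commuting_at_def psi_add[OF add.hyps(1,2)]
      symb_add[OF z psi_A[OF add.hyps(1)] psi_A[OF add.hyps(2)]]
      symb_add[OF z' psi_A[OF add.hyps(1)] psi_A[OF add.hyps(2)]]
    by algebra
next
  case (scaleC c X)
  have z': "0 < Im (of_real (rate s) * z)" using z by (simp add: rate_pos)
  from scaleC show ?case
    using z z' by (simp add: psi_scaleC commuting_at_def symb_scaleC psi_A mult.assoc mult.left_commute
        flip: right_diff_distrib)
next
  case (limit u X)
  have z': "0 < Im (of_real (rate s) * z)" using z by (simp add: rate_pos)
  let ?r = "of_real (rate s) * z"
  have lim: "(\<lambda>n. symb s m (\<Psi> (u n)) w) \<longlonglongrightarrow> symb s m (\<Psi> X) w" if "0 < Im w" for m w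
    using limit that by (intro symb_continuous psi_continuous psi_A)
  have "(\<lambda>n. symb s 1 (\<Psi> (u n)) z * (symb s 0 G ?r - symb s 0 G z))
      \<longlonglongrightarrow> symb s 1 (\<Psi> X) z * (symb s 0 G ?r - symb s 0 G z)"
    by (intro tendsto_intros lim z)
  moreover have "(\<lambda>n. symb s 1 G z * (symb s 0 (\<Psi> (u n)) ?r - symb s 0 (\<Psi> (u n)) z))
      \<longlonglongrightarrow> symb s 1 G z * (symb s 0 (\<Psi> X) ?r - symb s 0 (\<Psi> X) z)"
    by (intro tendsto_intros lim z z')
  ultimately show ?case
    unfolding commuting_at_def limit.IH[unfolded commuting_at_def] by (rule LIMSEQ_unique)
qed

text \<open>The images of the generators cannot pairwise commute to first order in \<open>V\<close>, because
  \<open>V\<close> and \<open>U\<^sub>1\<close> are in the range of \<open>\<Psi>\<close> and do not.\<close>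

lemma not_all_commuting:
  assumes TT: "\<And>s1 s2 a b. 0 < a \<Longrightarrow> 0 < b \<Longrightarrow> commuting_at s \<i> (T s1 a) (T s2 b)"
    and TW: "\<And>s1 a. 0 < a \<Longrightarrow> commuting_at s \<i> (T s1 a) W"
  shows False
proof -
  have WW: "commuting_at s \<i> W W" by (simp add: commuting_at_def)
  have all_W: "commuting_at s \<i> (\<Psi> X) W" if "X \<in> A_ph" for X
    by (rule commuting_generators_imp_all[OF _ W_A TW WW that]) auto
  have all_T: "commuting_at s \<i> (\<Psi> X) (T s2 b)" if "X \<in> A_ph" "0 < b" for X s2 b
    by (rule commuting_generators_imp_all[OF _ T_A TT commuting_at_sym[OF TW] that(1)]) (use that in auto)
  have all: "commuting_at s \<i> (\<Psi> X) (\<Psi> Y)" if "X \<in> A_ph" "Y \<in> A_ph" for X Y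
    by (rule commuting_generators_imp_all[OF _ psi_A commuting_at_sym[OF all_T] commuting_at_sym[OF all_W] that(1)])
      (use that in auto)
  have "U_op s 1 \<in> A_ph_gens" "V_op 1 \<in> A_ph_gens"
    by (auto simp: A_ph_gens_def U_op_def intro!: image_eqI[of _ _ 1])
  then obtain X Y where XY: "X \<in> A_ph" "\<Psi> X = U_op s 1" "Y \<in> A_ph" "\<Psi> Y = V_op 1"
    using psi_range by meson
  have r: "0 < Im (of_real (rate s) * \<i>)" by (simp add: rate_pos)
  have "exp (- complex_of_real (rate s)) = exp (- 1)"
    using all[OF XY(1,3)] r unfolding XY commuting_at_def
    by (simp add: symb_U symb_V mult.commute)
  then have "exp (- rate s) = exp (- 1)"
    by (metis exp_of_real of_real_1 of_real_eq_iff of_real_minus)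
  then show False by (auto simp: rate_def split: if_splits)
qed

lemma symb_T_add:
  "0 \<le> a \<Longrightarrow> 0 \<le> b \<Longrightarrow> 0 < Im z \<Longrightarrow> symb s 0 (T s' (a + b)) z = symb s 0 (T s' a) z * symb s 0 (T s' b) z"
  by (simp add: T_add symb_0_compose T_A)

lemma symb_T_le_1: "0 \<le> a \<Longrightarrow> 0 < Im z \<Longrightarrow> cmod (symb s m (T s' a) z) \<le> 1"
  using symb_bound[OF _ T_A] T_norm order_trans by blast

lemma symb_T_vanishing:
  assumes "0 < t0" "0 < Im z0" "symb s 0 (T s' t0) z0 = 0" "0 < t" "0 < Im z"
  shows "symb s 0 (T s' t) z = 0"
  by (rule semigroup_vanishing[of "\<lambda>t. symb s 0 (T s' t)", OF _ _ _ assms])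
    (auto intro: symb_holomorphic T_A[OF less_imp_le] symb_T_le_1 symb_T_add)

text \<open>Scalars commute, so the phase \<open>e\<^sup>i \<noteq> 1\<close> in the relation between \<open>T True 1\<close> and \<open>T False 1\<close> makes the product
  of their symbols zero.\<close>

lemma symb_T_one_family_vanishes:
  obtains s0 where "\<And>t z. 0 < t \<Longrightarrow> 0 < Im z \<Longrightarrow> symb s 0 (T s0 t) z = 0"
proof -
  have cis1: "cis 1 \<noteq> 1"
  proof
    assume "cis 1 = 1"
    then have "sin (1 :: real) = 0" by (simp add: complex_eq_iff)
    then show False using sin_gt_zero[of 1] pi_gt3 by simp
  qed
  have "symb s 0 (T True 1) z * symb s 0 (T False 1) z = 0" if "0 < Im z" for z
  proof -
    have "symb s 0 (T True 1) z * symb s 0 (T False 1) z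
        = cis 1 * (symb s 0 (T False 1) z * symb s 0 (T True 1) z)"
      using T_commutation[of 1 1] that
      by (simp add: T_A A_ph_compose symb_scaleC flip: symb_0_compose)
    then have "(1 - cis 1) * (symb s 0 (T True 1) z * symb s 0 (T False 1) z) = 0"
      by (simp add: algebra_simps)
    then show ?thesis using cis1 by simp
  qed
  then have "(\<forall>z\<in>uhp. symb s 0 (T True 1) z = 0) \<or> (\<forall>z\<in>uhp. symb s 0 (T False 1) z = 0)"
    by (intro holomorphic_mult_eq_0 open_halfspace_Im_gt connected_uhp symb_holomorphic T_A) auto
  then obtain s0 where "symb s 0 (T s0 1) \<i> = 0" by force
  then show ?thesis using symb_T_vanishing[of 1 \<i> s s0] by (intro that[of s0]) auto
qed

text \<open>With zero on the diagonal, an element and its square root are strictly triangular, so the square is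
  zero. With one on the diagonal, the corner is additive in the parameter and bounded, so it is zero.\<close>

lemma symb_1_T_eq_0:
  assumes const: "(\<forall>t>0. \<forall>z. 0 < Im z \<longrightarrow> symb s 0 (T s' t) z = 0) \<or>
      (\<forall>t>0. \<forall>z. 0 < Im z \<longrightarrow> symb s 0 (T s' t) z = 1)"
    and a: "0 < a" and z: "0 < Im z"
  shows "symb s 1 (T s' a) z = 0"
proof -
  have z': "0 < Im (of_real (rate s) * z)" using z by (simp add: rate_pos)
  have sum: "symb s 1 (T s' (a + b)) z
    = symb s 0 (T s' a) z * symb s 1 (T s' b) z + symb s 1 (T s' a) z * symb s 0 (T s' b) (of_real (rate s) * z)"
    if "0 < a" "0 < b" for a b
    using that z symb_1_compose[OF z T_A T_A] by (simp add: T_add)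
  from const show ?thesis
  proof
    assume "\<forall>t>0. \<forall>z. 0 < Im z \<longrightarrow> symb s 0 (T s' t) z = 0"
    then show ?thesis using sum[of "a / 2" "a / 2"] a z z' by simp
  next
    assume one: "\<forall>t>0. \<forall>z. 0 < Im z \<longrightarrow> symb s 0 (T s' t) z = 1"
    have mult: "symb s 1 (T s' (real (Suc n) * a)) z = of_nat (Suc n) * symb s 1 (T s' a) z" for n
    proof (induction n)
      case (Suc n)
      have "symb s 1 (T s' (real (Suc n) * a + a)) z = symb s 1 (T s' a) z + symb s 1 (T s' (real (Suc n) * a)) z"
        using sum[of "real (Suc n) * a" a] one a z z' by simp
      then show ?case unfolding Suc by (simp add: algebra_simps)
    qed simp
    have le: "real (Suc n) * cmod (symb s 1 (T s' a) z) \<le> 1" for n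
    proof -
      have "cmod (of_nat (Suc n) * symb s 1 (T s' a) z) \<le> 1"
        unfolding mult[symmetric] by (rule symb_T_le_1) (use a z in auto)
      then show ?thesis by (simp only: norm_mult norm_of_nat)
    qed
    show ?thesis
    proof (rule ccontr)
      assume "symb s 1 (T s' a) z \<noteq> 0"
      then obtain n where "1 < real n * cmod (symb s 1 (T s' a) z)"
        using reals_Archimedean3[of "cmod (symb s 1 (T s' a) z)"] by auto
      also have "\<dots> \<le> real (Suc n) * cmod (symb s 1 (T s' a) z)" by (intro mult_right_mono) auto
      finally show False using le[of n] by simp
    qed
  qed
qed

text \<open>If the character of \<open>W\<close> did not vanish, it could be cancelled from the scaling relation, so that
  the characters of both one-parameter families would be constant zero or one, and everything
  would commute to first order.\<close>

lemma symb_0_W: "0 < Im z \<Longrightarrow> symb s 0 W z = 0"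
proof (rule ccontr)
  assume "0 < Im z" "symb s 0 W z \<noteq> 0"
  have const: "(\<forall>t>0. \<forall>z. 0 < Im z \<longrightarrow> symb s 0 (T s' t) z = 0) \<or>
      (\<forall>t>0. \<forall>z. 0 < Im z \<longrightarrow> symb s 0 (T s' t) z = 1)" for s'
  proof (cases "\<exists>t>0. \<exists>z. 0 < Im z \<and> symb s 0 (T s' t) z = 0")
    case True
    then show ?thesis using symb_T_vanishing by blast
  next
    case False
    have inv: "symb s 0 (T s' t) w = symb s 0 (T s' (rate s' * t)) w" if t: "0 < t" and w: "0 < Im w" for t w
    proof -
      have rt: "0 < rate s' * t" using t by (simp add: rate_pos)
      have "(\<forall>w\<in>uhp. symb s 0 W w = 0) \<or> (\<forall>w\<in>uhp. symb s 0 (T s' t) w - symb s 0 (T s' (rate s' * t)) w = 0)"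
      proof (intro holomorphic_mult_eq_0 open_halfspace_Im_gt connected_uhp symb_holomorphic W_A holomorphic_on_diff T_A)
        fix w assume "w \<in> uhp"
        then have "symb s 0 (T s' t) w * symb s 0 W w = symb s 0 W w * symb s 0 (T s' (rate s' * t)) w"
          using T_W[of t s'] t rt by (simp add: T_A W_A flip: symb_0_compose)
        then show "symb s 0 W w * (symb s 0 (T s' t) w - symb s 0 (T s' (rate s' * t)) w) = 0"
          by (simp add: algebra_simps)
      qed (use t rt in auto)
      then show ?thesis using \<open>0 < Im z\<close> \<open>symb s 0 W z \<noteq> 0\<close> w by auto
    qed
    have "symb s 0 (T s' b) w = 1" if b: "0 < b" and w: "0 < Im w" for b w
    proof -
      \<comment> \<open>\<open>b\<close> is written as the difference of \<open>t\<close> and \<open>rate s' * t\<close>, up to sign\<close>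
      define d where "d = \<bar>rate s' - 1\<bar>"
      have d: "0 < d" by (auto simp: d_def rate_def)
      define t where "t = b / d"
      have t: "0 < t" "d * t = b" using b d by (simp_all add: t_def)
      have rt: "0 < rate s' * t" using t by (simp add: rate_pos)
      show ?thesis
      proof (cases "1 < rate s'")
        case True
        then have "rate s' * t = t + b" using t(2) by (simp add: d_def algebra_simps)
        then have "symb s 0 (T s' t) w = symb s 0 (T s' t) w * symb s 0 (T s' b) w"
          using inv[OF t(1) w] symb_T_add[of t b w s s'] t b w by simp
        then show ?thesis using False t w by auto
      next
        case nr: False
        then have "t = rate s' * t + b" using t(2) by (simp add: d_def algebra_simps)
        then have "symb s 0 (T s' (rate s' * t)) w = symb s 0 (T s' (rate s' * t)) w * symb s 0 (T s' b) w"
          using inv[OF t(1) w] symb_T_add[of "rate s' * t" b w s s'] rt b w by simp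
        then show ?thesis using False rt w by auto
      qed
    qed
    then show ?thesis by blast
  qed
  have r: "0 < Im (of_real (rate s) * \<i>)" by (simp add: rate_pos)
  have same: "symb s 0 (T s' a) (of_real (rate s) * \<i>) = symb s 0 (T s' a) \<i>" if "0 < a" for s' a
    using const[of s'] that r by (metis imaginary_unit.sel(2) zero_less_one)
  have "commuting_at s \<i> (T s' a) G" if "0 < a" for s' a G
    unfolding commuting_at_def using same[OF that] symb_1_T_eq_0[OF const that, of \<i>] by simp
  then show False by (intro not_all_commuting[of s])
qed

text \<open>Otherwise \<open>W\<close> and one of the two families are represented by zero, and the other family commutes with itself.\<close>

lemma symb_1_W_nonzero: obtains z where "0 < Im z" "symb s 1 W z \<noteq> 0"
proof -
  have "\<exists>z. 0 < Im z \<and> symb s 1 W z \<noteq> 0"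
  proof (rule ccontr)
    assume "\<nexists>z. 0 < Im z \<and> symb s 1 W z \<noteq> 0"
    then have W1: "symb s 1 W \<i> = 0" by simp
    have r: "0 < Im (of_real (rate s) * \<i>)" by (simp add: rate_pos)
    have CW: "commuting_at s \<i> G W" for G
      unfolding commuting_at_def W1 using symb_0_W[OF r, of s] symb_0_W[of \<i> s] by simp
    obtain s0 where s0: "\<And>t z. 0 < t \<Longrightarrow> 0 < Im z \<Longrightarrow> symb s 0 (T s0 t) z = 0"
      by (rule symb_T_one_family_vanishes[of s]) blast
    have dead: "commuting_at s \<i> (T s0 a) G" if "0 < a" for a G
    proof -
      have "symb s 1 (T s0 a) \<i> = 0" using s0 that by (intro symb_1_T_eq_0) auto
      then show ?thesis unfolding commuting_at_def using s0[OF that r] s0[OF that, of \<i>] by simp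
    qed
    have "commuting_at s \<i> (T s1 a) (T s2 b)" if "0 < a" "0 < b" for s1 s2 a b
    proof -
      consider "s1 = s0" | "s2 = s0" | "s1 = s2" by (cases s1; cases s2; cases s0) auto
      then show ?thesis
      proof cases
        case 3
        then have "T s1 a o\<^sub>L T s2 b = T s2 b o\<^sub>L T s1 a"
          using that by (simp add: add.commute flip: T_add)
        then show ?thesis using that by (intro commuting_at_if_commute T_A) auto
      qed (use dead that commuting_at_sym in blast)+
    qed
    then show False by (rule not_all_commuting[of s, OF _ CW])
  qed
  then show ?thesis using that by blast
qed

text \<open>Compare the corners in \<open>T W = W T\<close> and cancel that of \<open>W\<close>.\<close>

lemma symb_T_scaling:
  assumes a: "0 < a" and z: "0 < Im z"
  shows "symb s 0 (T s' a) z = symb s 0 (T s' (rate s' * a)) (of_real (rate s) * z)"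
proof -
  let ?g = "\<lambda>z. symb s 0 (T s' (rate s' * a)) (of_real (rate s) * z)"
  have ra: "0 < rate s' * a" using a by (simp add: rate_pos)
  have r: "0 < Im (of_real (rate s) * w)" if "0 < Im w" for w using that by (simp add: rate_pos)
  have hol: "?g holomorphic_on uhp"
  proof -
    have "(symb s 0 (T s' (rate s' * a)) \<circ> (\<lambda>z. of_real (rate s) * z)) holomorphic_on uhp"
      using r ra by (intro holomorphic_on_compose_gen[OF _ symb_holomorphic] T_A holomorphic_intros) auto
    then show ?thesis by (simp add: o_def)
  qed
  have "(\<forall>w\<in>uhp. symb s 1 W w = 0) \<or> (\<forall>w\<in>uhp. symb s 0 (T s' a) w - ?g w = 0)"
  proof (intro holomorphic_mult_eq_0 open_halfspace_Im_gt connected_uhp symb_holomorphic W_A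
      holomorphic_on_diff T_A hol)
    fix w assume "w \<in> uhp"
    then have w: "0 < Im w" by simp
    have "symb s 1 (T s' a o\<^sub>L W) w = symb s 1 (W o\<^sub>L T s' (rate s' * a)) w"
      using T_W[of a s'] a by simp
    then have "symb s 0 (T s' a) w * symb s 1 W w = symb s 1 W w * ?g w"
      using w r[OF w] a ra by (simp add: symb_1_compose[unfolded One_nat_def] T_A W_A symb_0_W)
    then show "symb s 1 W w * (symb s 0 (T s' a) w - ?g w) = 0"
      by (simp add: algebra_simps)
  qed (use a in auto)
  moreover obtain w where "0 < Im w" "symb s 1 W w \<noteq> 0" by (rule symb_1_W_nonzero)
  ultimately show ?thesis using z by auto
qed

text \<open>The range of \<open>\<Psi>\<close> contains \<open>U\<^sub>1\<close>, whose Fourier coefficient at \<open>1\<close> is one. When one family has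
  vanishing symbols, only the images of pure powers in the other can contribute to that
  coefficient.\<close>

lemma coef_1_nonzero:
  assumes dead: "\<And>t z. 0 < t \<Longrightarrow> 0 < Im z \<Longrightarrow> symb s 0 (T (\<not> s1) t) z = 0"
  obtains t where "0 < t" "coef s 1 (T s1 t) \<noteq> 0"
proof -
  have "\<exists>t>0. coef s 1 (T s1 t) \<noteq> 0"
  proof (rule ccontr)
    assume "\<not> (\<exists>t>0. coef s 1 (T s1 t) \<noteq> 0)"
    then have c0: "coef s 1 (T s1 t) = 0" if "0 < t" for t using that by blast
    have "coef s 1 (\<Psi> X) = 0" if "X \<in> A_ph" for X
      using that
    proof (induction rule: A_ph_induct)
      case (Mon i)
      obtain a b n where i: "i = (a, b, n)" by (cases i)
      have ab: "0 \<le> a" "0 \<le> b" using Mon by (auto simp: i indices_def)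
      have PM: "\<Psi> (Mon i) = \<Psi> (V_op (real n)) o\<^sub>L (T False b o\<^sub>L T True a)"
        using Mon unfolding i by (rule Psi_Mon)
      have PA: "\<Psi> (Mon i) \<in> A_ph" using Mon by (intro psi_A Mon_A_ph)
      have symb: "symb s 0 (\<Psi> (Mon i)) z
          = symb s 0 (\<Psi> (V_op (real n))) z * (symb s 0 (T False b) z * symb s 0 (T True a) z)" if "0 < Im z" for z
        unfolding PM using that ab by (simp add: symb_0_compose psi_A V_op_A_ph A_ph_compose T_A)
      define a1 where "a1 = (if s1 then a else b)"
      define a0 where "a0 = (if s1 then b else a)"
      show ?case
      proof (cases "n = 0 \<and> a0 = 0")
        case True
        then have "\<Psi> (Mon i) = T s1 a1"
          unfolding PM by (cases s1) (auto simp: a0_def a1_def T_0 V_op_0 psi_one)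
        moreover have "coef s 1 (T s1 a1) = 0"
        proof (cases "a1 = 0")
          case True
          then show ?thesis using coef_U_op[of 0 s 1] by (simp add: T_0 U_op_0)
        next
          case False
          then show ?thesis using c0 ab by (auto simp: a1_def)
        qed
        ultimately show ?thesis by simp
      next
        case False
        have "symb s 0 (\<Psi> (Mon i)) z = 0" if z: "0 < Im z" for z
        proof (cases "a0 = 0")
          case True
          then obtain k where "n = Suc k" using False by (cases n) auto
          then have "\<Psi> (V_op (real n)) = \<Psi> (V_op (real k)) o\<^sub>L W"
            unfolding W_def by (simp only: V_Suc psi_comp V1_A_ph V_op_A_ph)
          then have "symb s 0 (\<Psi> (V_op (real n))) z = 0"
            using z by (simp add: symb_0_compose psi_A V_op_A_ph W_A symb_0_W)
          then show ?thesis using symb[OF z] by simp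
        next
          case False
          then have "0 < a0" using ab by (auto simp: a0_def)
          from dead[OF this z] show ?thesis using symb[OF z] by (cases s1) (auto simp: a0_def)
        qed
        then show ?thesis by (rule coef_eq_0_of_symb[OF PA])
      qed
    next
      case (limit u X)
      have "(\<lambda>n. coef s 1 (\<Psi> (u n))) \<longlonglongrightarrow> coef s 1 (\<Psi> X)"
        using limit by (intro coef_continuous psi_continuous psi_A)
      then show ?case unfolding limit.IH using LIMSEQ_const_iff by metis
    qed (simp_all add: psi_add psi_scaleC psi_A coef_add coef_scaleC)
    moreover have "U_op s 1 \<in> A_ph_gens" by (auto simp: A_ph_gens_def U_op_def)
    ultimately have "coef s 1 (U_op s 1) = 0" using psi_range by metis
    then show False by (simp add: coef_U_op)
  qed
  then show ?thesis using that by blast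
qed

end

text \<open>A contraction that agrees with a monomial on the chirps is orthogonal there to all other monomials.\<close>

lemma coef_modulus_one_other:
  assumes X: "X \<in> A_ph" and contr: "norm X \<le> 1" and C: "cmod (coef s \<alpha> X) = 1"
    and \<alpha>: "0 \<le> \<alpha>" "\<beta> \<noteq> \<alpha>"
  shows "coef s \<beta> X = 0"
proof -
  define \<eta> where "\<eta> k = blinfun_apply (U_op (\<not> s) 0) (chirp k)" for k
  define U where "U k = blinfun_apply (U_op s \<beta>) (\<eta> k)" for k
  define \<delta> where "\<delta> k = blinfun_apply X (\<eta> k) - scaleC_L2 (coef s \<alpha> X) (blinfun_apply (U_op s \<alpha>) (\<eta> k))" for k
  have U1: "norm (U k) = 1" for k by (simp add: U_def \<eta>_def norm_U_apply norm_chirp)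
  have "\<delta> \<longlonglongrightarrow> 0"
    unfolding \<delta>_def \<eta>_def by (rule coef_modulus_one[OF X contr refl C])
  then have \<delta>: "(\<lambda>k. norm (\<delta> k)) \<longlonglongrightarrow> 0" by (rule tendsto_norm_zero)
  have "cmod (cinner_L2 (\<delta> k) (U k)) \<le> norm (\<delta> k)" for k
    using cinner_Cauchy_Schwarz[of "\<delta> k" "U k"] by (simp add: U1)
  then have "(\<lambda>k. cinner_L2 (\<delta> k) (U k)) \<longlonglongrightarrow> 0" by (rule LIMSEQ_null_bound[OF _ \<delta>])
  moreover have "(\<lambda>k. cinner_L2 (blinfun_apply (U_op s \<alpha>) (\<eta> k)) (U k)) \<longlonglongrightarrow> coef s \<beta> (U_op s \<alpha>)"
    unfolding U_def \<eta>_def by (rule coef_limit[OF U_op_A_ph[OF \<alpha>(1)]])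
  then have "(\<lambda>k. cinner_L2 (blinfun_apply (U_op s \<alpha>) (\<eta> k)) (U k)) \<longlonglongrightarrow> 0"
    using \<alpha> by (simp add: coef_U_op)
  then have "(\<lambda>k. coef s \<alpha> X * cinner_L2 (blinfun_apply (U_op s \<alpha>) (\<eta> k)) (U k)) \<longlonglongrightarrow> 0"
    by (rule tendsto_mult_right_zero)
  ultimately have "(\<lambda>k. cinner_L2 (\<delta> k) (U k)
      + coef s \<alpha> X * cinner_L2 (blinfun_apply (U_op s \<alpha>) (\<eta> k)) (U k)) \<longlonglongrightarrow> 0 + 0"
    by (rule tendsto_add)
  then have "(\<lambda>k. cinner_L2 (blinfun_apply X (\<eta> k)) (U k)) \<longlonglongrightarrow> 0"
    by (simp add: \<delta>_def cinner_diff_left cinner_scaleC_left)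
  moreover have "(\<lambda>k. cinner_L2 (blinfun_apply X (\<eta> k)) (U k)) \<longlonglongrightarrow> coef s \<beta> X"
    unfolding U_def \<eta>_def by (rule coef_limit[OF X])
  ultimately show ?thesis using LIMSEQ_unique by blast
qed

context anti_automorphism
begin

lemma symb_T_modulus_powr:
  assumes nz: "\<And>t. 0 < t \<Longrightarrow> symb s 0 (T s' t) z \<noteq> 0" and z: "0 < Im z" and "0 < r" "0 < t"
  shows "cmod (symb s 0 (T s' (r * t)) z) = cmod (symb s 0 (T s' t) z) powr r"
  by (rule bounded_semigroup_powr[of "\<lambda>t. cmod (symb s 0 (T s' t) z)"])
    (use assms in \<open>auto simp: symb_T_le_1 symb_T_add norm_mult\<close>)

lemma symb_T_scaling_same:
  assumes t: "0 < t" and z: "0 < Im z"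
  shows "symb s 0 (T s t) (of_real (exp 1) * z) = symb s 0 (T s (exp (- 1) * t)) z"
proof (cases s)
  case True
  have e: "exp 1 * (exp (- 1) * t) = t" by (simp flip: mult.assoc exp_add)
  have "symb s 0 (T s (exp (- 1) * t)) z = symb s 0 (T s (exp 1 * (exp (- 1) * t))) (of_real (exp 1) * z)"
    using symb_T_scaling[of "exp (- 1) * t" z s s] t z True by (simp add: rate_def)
  then show ?thesis unfolding e by simp
next
  case False
  have e: "complex_of_real (exp (- 1)) * (of_real (exp 1) * z) = z"
    by (simp flip: mult.assoc of_real_mult exp_add)
  have "symb s 0 (T s t) (of_real (exp 1) * z)
      = symb s 0 (T s (exp (- 1) * t)) (of_real (exp (- 1)) * (of_real (exp 1) * z))"
    using symb_T_scaling[of t "of_real (exp 1) * z" s s] t z False by (simp add: rate_def)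
  then show ?thesis unfolding e .
qed

lemma symb_T_scaling_other:
  assumes t: "0 < t" and z: "0 < Im z"
  shows "symb s 0 (T (\<not> s) t) (of_real (exp 1) * z) = symb s 0 (T (\<not> s) (exp 1 * t)) z"
proof (cases s)
  case True
  have e: "exp (- 1) * (exp 1 * t) = t" by (simp flip: mult.assoc exp_add)
  have "symb s 0 (T (\<not> s) (exp 1 * t)) z = symb s 0 (T (\<not> s) (exp (- 1) * (exp 1 * t))) (of_real (exp 1) * z)"
    using symb_T_scaling[of "exp 1 * t" z s "\<not> s"] t z True by (simp add: rate_def)
  then show ?thesis unfolding e by simp
next
  case False
  have e: "complex_of_real (exp (- 1)) * (of_real (exp 1) * z) = z"
    by (simp flip: mult.assoc of_real_mult exp_add)
  have "symb s 0 (T (\<not> s) t) (of_real (exp 1) * z)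
      = symb s 0 (T (\<not> s) (exp 1 * t)) (of_real (exp (- 1)) * (of_real (exp 1) * z))"
    using symb_T_scaling[of t "of_real (exp 1) * z" s "\<not> s"] t z False by (simp add: rate_def)
  then show ?thesis unfolding e .
qed

text \<open>The family of \<open>U\<^sub>s\<close> becomes nearly unimodular high up in the half-plane, where its character
  approaches its mean value; if it did not vanish, the mean would have modulus one and no other
  Fourier coefficient would survive.\<close>

lemma symb_T_same_vanishes:
  assumes "0 < t" "0 < Im z"
  shows "symb s 0 (T s t) z = 0"
proof (rule ccontr)
  assume alive: "symb s 0 (T s t) z \<noteq> 0"
  then have nz: "symb s 0 (T s t) z \<noteq> 0" if "0 < t" "0 < Im z" for t z
    using symb_T_vanishing[of t z s s] assms that by blast
  have dead: "symb s 0 (T (\<not> s) t) z = 0" if "0 < t" "0 < Im z" for t z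
  proof -
    obtain s0 where s0: "\<And>t z. 0 < t \<Longrightarrow> 0 < Im z \<Longrightarrow> symb s 0 (T s0 t) z = 0"
      by (rule symb_T_one_family_vanishes[of s]) blast
    then have "s0 \<noteq> s" using alive assms by blast
    then have "s0 = (\<not> s)" by auto
    then show ?thesis using s0[OF that] by simp
  qed
  obtain u where u: "0 < u" "coef s 1 (T s u) \<noteq> 0"
    using coef_1_nonzero[of s s] dead by blast
  have "symb s 0 (T s v) (of_real (exp (real n)) * \<i>) = symb s 0 (T s (exp (- real n) * v)) \<i>"
    if "0 < v" for n v
    using that
  proof (induction n arbitrary: v)
    case (Suc n)
    have "complex_of_real (exp (real (Suc n))) * \<i> = of_real (exp 1) * (of_real (exp (real n)) * \<i>)"
      by (simp add: exp_add)
    then have "symb s 0 (T s v) (of_real (exp (real (Suc n))) * \<i>)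
        = symb s 0 (T s (exp (- 1) * v)) (of_real (exp (real n)) * \<i>)"
      using symb_T_scaling_same[of v "of_real (exp (real n)) * \<i>" s] Suc.prems by (simp only:) simp
    also have "\<dots> = symb s 0 (T s (exp (- real n) * (exp (- 1) * v))) \<i>"
      using Suc.prems by (intro Suc.IH) simp
    also have "exp (- real n) * (exp (- 1) * v) = exp (- real (Suc n)) * v"
      by (simp flip: mult.assoc exp_add)
    finally show ?case .
  qed simp
  then have "cmod (symb s 0 (T s u) (of_real (exp (real n)) * \<i>))
      = cmod (symb s 0 (T s u) \<i>) powr exp (- real n)" for n
    using symb_T_modulus_powr[of s s \<i> "exp (- real n)" u] nz u by simp
  moreover have "(\<lambda>n. cmod (symb s 0 (T s u) \<i>) powr exp (- real n)) \<longlonglongrightarrow> cmod (symb s 0 (T s u) \<i>) powr 0"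
  proof (rule tendsto_powr[OF tendsto_const])
    show "(\<lambda>n. exp (- real n)) \<longlonglongrightarrow> 0"
      by (rule filterlim_compose[OF exp_at_bot])
        (rule filterlim_compose[OF filterlim_uminus_at_bot_at_top filterlim_real_sequentially])
  qed (use nz u in auto)
  ultimately have "(\<lambda>n. cmod (symb s 0 (T s u) (of_real (exp (real n)) * \<i>))) \<longlonglongrightarrow> 1"
    using nz[OF u(1), of \<i>] by simp
  moreover have "(\<lambda>n. symb s 0 (T s u) (of_real (exp (real n)) * \<i>)) \<longlonglongrightarrow> coef s 0 (T s u)"
    using u by (intro symb_tendsto_coef_0 T_A)
      (auto intro: filterlim_compose[OF exp_at_top filterlim_real_sequentially])
  then have "(\<lambda>n. cmod (symb s 0 (T s u) (of_real (exp (real n)) * \<i>))) \<longlonglongrightarrow> cmod (coef s 0 (T s u))"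
    by (rule tendsto_norm)
  ultimately have "cmod (coef s 0 (T s u)) = 1" using LIMSEQ_unique by blast
  then have "coef s 1 (T s u) = 0"
    using u by (intro coef_modulus_one_other[where \<alpha> = 0] T_A T_norm) auto
  with u show False by simp
qed

text \<open>The other family cannot vanish or be constant, since \<open>U\<^sub>1\<close> has to be in the range of \<open>\<Psi>\<close>; so its symbols have modulus
  strictly between zero and one, and the scaling law provides the hypothesis of
  \<open>scaling_modulus_imp_exponential\<close>.\<close>

lemma symb_T_other_exponential:
  obtains \<kappa> where "0 < \<kappa>"
    "\<And>t. 0 < t \<Longrightarrow> \<exists>C. cmod C = 1 \<and> (\<forall>z. 0 < Im z \<longrightarrow> symb s 0 (T (\<not> s) t) z = C * exp (\<i> * of_real (\<kappa> * t) * z))"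
proof -
  define q where "q t z = symb s 0 (T (\<not> s) t) z" for t z
  have hol: "q t holomorphic_on uhp" if "0 < t" for t
    unfolding q_def[abs_def] using that symb_holomorphic[OF T_A, of t s 0 "\<not> s"] by simp
  obtain u where u: "0 < u" "coef s 1 (T (\<not> s) u) \<noteq> 0"
    using coef_1_nonzero[of s "\<not> s"] symb_T_same_vanishes by auto
  have nz: "q t z \<noteq> 0" if "0 < t" "0 < Im z" for t z
  proof
    assume "q t z = 0"
    then have "coef s 1 (T (\<not> s) u) = 0"
      using symb_T_vanishing[of t z s "\<not> s" u] that u
      by (intro coef_eq_0_of_symb T_A) (auto simp: q_def)
    with u show False by simp
  qed
  have powr: "cmod (q (r * t) z) = cmod (q t z) powr r" if "0 < r" "0 < t" "0 < Im z" for r t z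
    using symb_T_modulus_powr[of s "\<not> s" z r t] nz that by (simp add: q_def)
  have less: "cmod (q t z) < 1" if tz: "0 < t" "0 < Im z" for t z
  proof (rule ccontr)
    assume "\<not> cmod (q t z) < 1"
    then have "cmod (q t z) = 1" using symb_T_le_1[of t z s 0 "\<not> s"] tz by (simp add: q_def)
    then have one: "cmod (q u z) = 1" using powr[of "u / t" t z] tz u by simp
    have "q u constant_on uhp"
    proof (rule maximum_modulus_principle[OF hol[OF u(1)] open_halfspace_Im_gt connected_uhp
          open_halfspace_Im_gt order_refl])
      show "z \<in> uhp" using tz by simp
      show "cmod (q u w) \<le> cmod (q u z)" if "w \<in> uhp" for w
        unfolding one using that u symb_T_le_1[of u w s 0 "\<not> s"] by (simp add: q_def)
    qed
    then obtain c where "\<And>w. 0 < Im w \<Longrightarrow> q u w = c" by (auto simp: constant_on_def)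
    then have "coef s 1 (T (\<not> s) u) = (if 1 = (0::real) then c else 0)"
      using u by (intro coef_eqI_symb T_A) (auto simp: q_def)
    with u show False by simp
  qed
  define \<kappa> where "\<kappa> = - ln (cmod (q 1 \<i>))"
  have "0 < \<kappa>" using less[of 1 \<i>] nz[of 1 \<i>] by (simp add: \<kappa>_def)
  moreover have "\<exists>C. cmod C = 1 \<and> (\<forall>z. 0 < Im z \<longrightarrow> q t z = C * exp (\<i> * of_real (\<kappa> * t) * z))"
    if t: "0 < t" for t
  proof -
    have "q t (of_real (exp 1) * \<i>) = q (exp 1 * t) \<i>"
      unfolding q_def by (rule symb_T_scaling_other[OF t]) simp
    then have "cmod (q t (\<i> * of_real (exp 1))) = cmod (q t \<i>) powr exp 1"
      using powr[of "exp 1" t \<i>] t by (simp add: mult.commute)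
    then obtain C where C: "cmod C = 1"
      "\<And>z. 0 < Im z \<Longrightarrow> q t z = C * exp (\<i> * of_real (- ln (cmod (q t \<i>))) * z)"
      using scaling_modulus_imp_exponential[OF hol[OF t] conjI[OF nz[OF t] less[OF t]], of "exp 1"] by auto
    have "- ln (cmod (q t \<i>)) = \<kappa> * t"
      using powr[of t 1 \<i>] t nz[of 1 \<i>] by (simp add: \<kappa>_def ln_powr)
    then show ?thesis using C by metis
  qed
  ultimately show ?thesis using that unfolding q_def by blast
qed

text \<open>Comparing phases: on chirps the images of \<open>M\<^sub>1\<close> and \<open>D\<^sub>\<mu>\<close> behave like a translation and a
  modulation by positive amounts \<open>b\<close> and \<open>a\<close>. Their commutation factor is \<open>e\<^bsup>-iab\<^esup>\<close>, whereas
  the relation for the images demands \<open>e\<^bsup>i\<mu>\<^esup>\<close>.\<close>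

lemma no_anti_automorphism: False
proof -
  obtain \<kappa> where \<kappa>: "0 < \<kappa>" "\<And>t. 0 < t \<Longrightarrow> \<exists>C. cmod C = 1 \<and>
      (\<forall>z. 0 < Im z \<longrightarrow> symb True 0 (T False t) z = C * exp (\<i> * of_real (\<kappa> * t) * z))"
    using symb_T_other_exponential[of True] by auto
  obtain \<kappa>' where \<kappa>': "0 < \<kappa>'" "\<And>t. 0 < t \<Longrightarrow> \<exists>C. cmod C = 1 \<and>
      (\<forall>z. 0 < Im z \<longrightarrow> symb False 0 (T True t) z = C * exp (\<i> * of_real (\<kappa>' * t) * z))"
    using symb_T_other_exponential[of False] by auto
  \<comment> \<open>chosen such that \<open>\<mu> + a b = \<pi>\<close>, so that the two phases differ by the factor \<open>-1\<close>\<close>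
  define \<mu> where "\<mu> = pi / (1 + \<kappa> * \<kappa>')"
  have den: "0 < 1 + \<kappa> * \<kappa>'" using \<kappa>(1) \<kappa>'(1) by (simp add: add_pos_pos)
  then have \<mu>: "0 < \<mu>" by (simp add: \<mu>_def)
  define a where "a = \<kappa> * \<mu>"
  define b where "b = \<kappa>'"
  have ab: "0 < a" "0 < b" using \<kappa>(1) \<kappa>'(1) \<mu> by (simp_all add: a_def b_def)
  define S where "S = T False \<mu>"
  define R where "R = T True 1"
  have SA: "S \<in> A_ph" and RA: "R \<in> A_ph" using \<mu> by (simp_all add: S_def R_def T_A)
  have SN: "norm S \<le> 1" and RN: "norm R \<le> 1" using \<mu> by (simp_all add: S_def R_def T_norm)
  obtain C where C: "cmod C = 1" "coef True a S = C"
  proof -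
    obtain C where "cmod C = 1" "\<And>z. 0 < Im z \<Longrightarrow> symb True 0 S z = C * exp (\<i> * of_real a * z)"
      using \<kappa>(2)[OF \<mu>] by (auto simp: S_def a_def)
    then show ?thesis using coef_eqI_symb[OF SA, of a True C a] ab that by auto
  qed
  obtain C' where C': "cmod C' = 1" "coef False b R = C'"
  proof -
    obtain C' where "cmod C' = 1" "\<And>z. 0 < Im z \<Longrightarrow> symb False 0 R z = C' * exp (\<i> * of_real b * z)"
      using \<kappa>'(2)[of 1] by (auto simp: R_def b_def)
    then show ?thesis using coef_eqI_symb[OF RA, of b False C' b] ab that by auto
  qed
  have S_lim: "(\<lambda>k. blinfun_apply S (blinfun_apply (D_op c) (chirp k))
      - scaleC_L2 C (blinfun_apply (M_op a) (blinfun_apply (D_op c) (chirp k)))) \<longlonglongrightarrow> 0" for c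
    using coef_modulus_one[OF SA SN C(2,1), of c] by (simp add: U_op_def)
  have R_lim: "(\<lambda>k. blinfun_apply R (blinfun_apply (M_op c) (chirp k))
      - scaleC_L2 C' (blinfun_apply (D_op b) (blinfun_apply (M_op c) (chirp k)))) \<longlonglongrightarrow> 0" for c
    using coef_modulus_one[OF RA RN C'(2,1), of c] by (simp add: U_op_def)
  have lin: "blinfun_apply X (scaleC_L2 d f) = scaleC_L2 d (blinfun_apply X f)" if "X \<in> A_ph" for X d f
    using A_ph_bounded_ops[OF that] by (rule blinfun_apply_scaleC)
  have sdiff: "scaleC_L2 d (f - g) = scaleC_L2 d f - scaleC_L2 d g" for d f g
    by (rule linear_diff[OF bounded_linear.linear[OF bounded_linear_scaleC_L2]])
  define \<xi> where "\<xi> k = blinfun_apply (M_op a) (blinfun_apply (D_op b) (chirp k))" for k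
  have DM: "blinfun_apply (D_op b) (blinfun_apply (M_op a) (chirp k)) = scaleC_L2 (cis (- (b * a))) (\<xi> k)" for k
  proof -
    have "blinfun_apply (D_op b) (blinfun_apply (M_op a) (chirp k)) = blinfun_apply (D_op b o\<^sub>L M_op a) (chirp k)"
      by simp
    then show ?thesis unfolding D_M_op scaleC_op_apply by (simp add: \<xi>_def)
  qed
  have RS: "(\<lambda>k. blinfun_apply R (blinfun_apply S (chirp k)) - scaleC_L2 (C * C' * cis (- (b * a))) (\<xi> k)) \<longlonglongrightarrow> 0"
  proof -
    have "(\<lambda>k. blinfun_apply R (blinfun_apply S (chirp k) - scaleC_L2 C (blinfun_apply (M_op a) (chirp k)))
      + scaleC_L2 C (blinfun_apply R (blinfun_apply (M_op a) (chirp k))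
        - scaleC_L2 C' (blinfun_apply (D_op b) (blinfun_apply (M_op a) (chirp k)))))
      \<longlonglongrightarrow> blinfun_apply R 0 + scaleC_L2 C 0"
      using S_lim[of 0] R_lim[of a]
      by (intro tendsto_add blinfun.tendsto tendsto_const bounded_linear.tendsto[OF bounded_linear_scaleC_L2])
        (simp_all add: D_op_0)
    then show ?thesis
      by (simp add: blinfun.diff_right lin RA sdiff DM scaleC_scaleC mult.assoc
          linear_0[OF bounded_linear.linear[OF bounded_linear_scaleC_L2]])
  qed
  have SR: "(\<lambda>k. blinfun_apply S (blinfun_apply R (chirp k)) - scaleC_L2 (C * C') (\<xi> k)) \<longlonglongrightarrow> 0"
  proof -
    have "(\<lambda>k. blinfun_apply S (blinfun_apply R (chirp k) - scaleC_L2 C' (blinfun_apply (D_op b) (chirp k)))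
      + scaleC_L2 C' (blinfun_apply S (blinfun_apply (D_op b) (chirp k)) - scaleC_L2 C (\<xi> k)))
      \<longlonglongrightarrow> blinfun_apply S 0 + scaleC_L2 C' 0"
      using S_lim[of b] R_lim[of 0] unfolding \<xi>_def
      by (intro tendsto_add blinfun.tendsto tendsto_const bounded_linear.tendsto[OF bounded_linear_scaleC_L2])
        (simp_all add: M_op_0)
    then show ?thesis
      by (simp add: blinfun.diff_right lin SA sdiff scaleC_scaleC mult.commute
          linear_0[OF bounded_linear.linear[OF bounded_linear_scaleC_L2]])
  qed
  define d where "d = C * C' * cis \<mu> - C * C' * cis (- (b * a))"
  have comm: "blinfun_apply R (blinfun_apply S f) = scaleC_L2 (cis \<mu>) (blinfun_apply S (blinfun_apply R f))" for f
  proof -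
    have "blinfun_apply (R o\<^sub>L S) f = blinfun_apply (scaleC_op (cis (1 * \<mu>)) (S o\<^sub>L R)) f"
      unfolding R_def S_def using \<mu> by (subst T_commutation) auto
    then show ?thesis by (simp add: scaleC_op_apply)
  qed
  have "(\<lambda>k. (blinfun_apply R (blinfun_apply S (chirp k)) - scaleC_L2 (C * C' * cis (- (b * a))) (\<xi> k))
      - scaleC_L2 (cis \<mu>) (blinfun_apply S (blinfun_apply R (chirp k)) - scaleC_L2 (C * C') (\<xi> k)))
      \<longlonglongrightarrow> 0 - scaleC_L2 (cis \<mu>) 0"
    by (intro tendsto_diff RS bounded_linear.tendsto[OF bounded_linear_scaleC_L2] SR)
  moreover have "(blinfun_apply R (blinfun_apply S (chirp k)) - scaleC_L2 (C * C' * cis (- (b * a))) (\<xi> k))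
      - scaleC_L2 (cis \<mu>) (blinfun_apply S (blinfun_apply R (chirp k)) - scaleC_L2 (C * C') (\<xi> k))
      = scaleC_L2 d (\<xi> k)" for k
  proof -
    have "scaleC_L2 d (\<xi> k) = scaleC_L2 (cis \<mu> * (C * C')) (\<xi> k) - scaleC_L2 (C * C' * cis (- (b * a))) (\<xi> k)"
      using scaleC_add_left[of d "C * C' * cis (- (b * a))" "\<xi> k"] by (simp add: d_def mult.commute)
    then show ?thesis unfolding comm sdiff scaleC_scaleC by simp
  qed
  ultimately have "(\<lambda>k. scaleC_L2 d (\<xi> k)) \<longlonglongrightarrow> 0"
    by (simp add: linear_0[OF bounded_linear.linear[OF bounded_linear_scaleC_L2]])
  then have "(\<lambda>k. norm (scaleC_L2 d (\<xi> k))) \<longlonglongrightarrow> 0" by (rule tendsto_norm_zero)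
  moreover have "norm (scaleC_L2 d (\<xi> k)) = cmod d" for k
    by (simp add: norm_scaleC_L2 \<xi>_def M_op_apply D_op_apply norm_mult_L2 norm_translate_L2 norm_chirp)
  ultimately have "d = 0" by (simp add: LIMSEQ_const_iff)
  then have "cis \<mu> = cis (- (b * a))" using C(1) C'(1) by (auto simp: d_def)
  then have "cis \<mu> * cis (b * a) = 1" by (simp add: cis_mult)
  then have "cis (\<mu> + b * a) = 1" by (simp add: cis_mult)
  moreover have "\<mu> + b * a = \<mu> * (1 + \<kappa> * \<kappa>')" by (simp add: a_def b_def algebra_simps)
  then have "\<mu> + b * a = pi" using den by (simp add: \<mu>_def)
  ultimately show False by simp
qed

end

section \<open>Chirality\<close>

lemma is_adjoint_unique: "is_adjoint X Y \<Longrightarrow> is_adjoint X' Y \<Longrightarrow> X = X'"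
proof (rule blinfun_eqI)
  fix f assume "is_adjoint X Y" "is_adjoint X' Y"
  then have "cinner_L2 (blinfun_apply X f - blinfun_apply X' f) g = 0" for g
    by (simp add: cinner_diff_left is_adjoint_def)
  then have "cinner_L2 (blinfun_apply X f - blinfun_apply X' f) (blinfun_apply X f - blinfun_apply X' f) = 0" .
  then show "blinfun_apply X f = blinfun_apply X' f" by (simp add: cinner_self)
qed

lemma is_adjoint_sym: "is_adjoint X Y \<Longrightarrow> is_adjoint Y X"
  unfolding is_adjoint_def by (metis cinner_commute)

lemma is_adjoint_norm_le:
  assumes "is_adjoint X Y" shows "norm X \<le> norm Y"
proof (rule norm_blinfun_bound)
  fix f
  show "norm (blinfun_apply X f) \<le> norm Y * norm f"
  proof (cases "norm (blinfun_apply X f) = 0")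
    case False
    have "(norm (blinfun_apply X f))\<^sup>2 = cmod (cinner_L2 (blinfun_apply X f) (blinfun_apply X f))"
      by (simp add: cinner_self norm_power)
    also have "\<dots> = cmod (cinner_L2 f (blinfun_apply Y (blinfun_apply X f)))"
      using assms by (simp add: is_adjoint_def)
    also have "\<dots> \<le> norm f * norm (blinfun_apply Y (blinfun_apply X f))" by (rule cinner_Cauchy_Schwarz)
    also have "\<dots> \<le> norm f * (norm Y * norm (blinfun_apply X f))"
      by (intro mult_left_mono norm_blinfun) simp
    finally have "norm (blinfun_apply X f) * norm (blinfun_apply X f) \<le> (norm Y * norm f) * norm (blinfun_apply X f)"
      by (simp add: power2_eq_square mult_ac)
    then show ?thesis using False by (simp only: mult_le_cancel_right) auto
  qed simp
qed simp

lemma is_adjoint_norm: "is_adjoint X Y \<Longrightarrow> norm X = norm Y"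
  using is_adjoint_norm_le is_adjoint_sym by (metis antisym)

lemma is_adjoint_add: "is_adjoint X Y \<Longrightarrow> is_adjoint X' Y' \<Longrightarrow> is_adjoint (X + X') (Y + Y')"
  by (simp add: is_adjoint_def blinfun.add_left cinner_add_left cinner_add_right)

lemma is_adjoint_scaleC: "is_adjoint X Y \<Longrightarrow> is_adjoint (scaleC_op (cnj c) X) (scaleC_op c Y)"
  by (simp add: is_adjoint_def scaleC_op_apply cinner_scaleC_left cinner_scaleC_right)

lemma is_adjoint_compose: "is_adjoint X Y \<Longrightarrow> is_adjoint X' Y' \<Longrightarrow> is_adjoint (X' o\<^sub>L X) (Y o\<^sub>L Y')"
  by (simp add: is_adjoint_def)

text \<open>An isometry with a right inverse is unitary; its adjoint is that inverse.\<close>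

lemma is_adjoint_of_isometry:
  assumes iso: "\<And>f. norm (blinfun_apply X f) = norm f" and X: "X \<in> bounded_ops"
    and inv: "X o\<^sub>L Y = id_blinfun"
  shows "is_adjoint X Y"
proof -
  have re: "Re (cinner_L2 (blinfun_apply X f) (blinfun_apply X g)) = Re (cinner_L2 f g)" for f g
  proof -
    have "inner (blinfun_apply X f) (blinfun_apply X g) = inner f g"
      using norm_diff_power2[of "blinfun_apply X f" "blinfun_apply X g"] norm_diff_power2[of f g]
      by (simp add: iso flip: blinfun.diff_right)
    then show ?thesis by (simp add: inner_L2_def)
  qed
  have "cinner_L2 (blinfun_apply X f) (blinfun_apply X g) = cinner_L2 f g" for f g
    using re[of f g] re[of "scaleC_L2 \<i> f" g]
    by (simp add: blinfun_apply_scaleC[OF X] cinner_scaleC_left complex_eq_iff)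
  moreover have "blinfun_apply X (blinfun_apply Y g) = g" for g
    using inv by (metis blinfun_apply_blinfun_compose blinfun_apply_id_blinfun)
  ultimately show ?thesis unfolding is_adjoint_def by metis
qed

lemma generator_has_adjoint:
  assumes "X \<in> A_ph_gens" shows "\<exists>Y. is_adjoint X Y"
proof -
  have "is_adjoint (M_op a) (M_op (- a))" "is_adjoint (D_op a) (D_op (- a))" "is_adjoint (V_op a) (V_op (- a))" for a
    by (rule is_adjoint_of_isometry; simp add: M_op_apply D_op_apply V_op_apply norm_mult_L2 norm_translate_L2
        norm_dilate_L2 M_op_bounded_ops D_op_bounded_ops V_op_bounded_ops M_op_add D_op_add V_op_add M_op_0 D_op_0 V_op_0)+
  then show ?thesis using assms by (auto simp: A_ph_gens_def)
qed

theorem theorem4p10: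
  shows "chiral A_ph"
  unfolding chiral_def
proof
  assume "\<exists>\<Phi>. isometric_algebra_iso \<Phi> A_ph (adjoint_algebra A_ph)"
  then obtain \<Phi> where \<Phi>: "isometric_algebra_iso \<Phi> A_ph (adjoint_algebra A_ph)" ..
  then have bij: "bij_betw \<Phi> A_ph (adjoint_algebra A_ph)"
    and add: "\<And>X Y. X \<in> A_ph \<Longrightarrow> Y \<in> A_ph \<Longrightarrow> \<Phi> (X + Y) = \<Phi> X + \<Phi> Y"
    and scale: "\<And>c X. X \<in> A_ph \<Longrightarrow> \<Phi> (scaleC_op c X) = scaleC_op c (\<Phi> X)"
    and comp: "\<And>X Y. X \<in> A_ph \<Longrightarrow> Y \<in> A_ph \<Longrightarrow> \<Phi> (X o\<^sub>L Y) = \<Phi> X o\<^sub>L \<Phi> Y"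
    and norm: "\<And>X. X \<in> A_ph \<Longrightarrow> norm (\<Phi> X) = norm X"
    by (auto simp: isometric_algebra_iso_def)
  \<comment> \<open>the adjoint of \<open>\<Phi> X\<close>\<close>
  define \<Psi> where "\<Psi> X = (SOME Z. Z \<in> A_ph \<and> is_adjoint Z (\<Phi> X))" for X
  have \<Psi>: "\<Psi> X \<in> A_ph" "is_adjoint (\<Psi> X) (\<Phi> X)" if "X \<in> A_ph" for X
  proof -
    have "\<Phi> X \<in> adjoint_algebra A_ph" using bij that by (auto simp: bij_betw_def)
    then have "\<exists>Z. Z \<in> A_ph \<and> is_adjoint Z (\<Phi> X)" by (auto simp: adjoint_algebra_def)
    then have "\<Psi> X \<in> A_ph \<and> is_adjoint (\<Psi> X) (\<Phi> X)" unfolding \<Psi>_def by (rule someI_ex)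
    then show "\<Psi> X \<in> A_ph" "is_adjoint (\<Psi> X) (\<Phi> X)" by auto
  qed
  have range: "\<exists>Y\<in>A_ph. \<Psi> Y = X" if "X \<in> A_ph" "is_adjoint X Z" for X Z
  proof -
    have "Z \<in> adjoint_algebra A_ph" using that by (auto simp: adjoint_algebra_def)
    then have "Z \<in> \<Phi> ` A_ph" using bij by (simp add: bij_betw_def)
    then obtain Y where "Y \<in> A_ph" "\<Phi> Y = Z" by blast
    then show ?thesis using is_adjoint_unique[OF _ that(2)] \<Psi>(2)[of Y] by auto
  qed
  have comp': "\<Psi> (X o\<^sub>L Y) = \<Psi> Y o\<^sub>L \<Psi> X" if "X \<in> A_ph" "Y \<in> A_ph" for X Y
    using \<Psi>(2)[OF A_ph_compose[OF that]] comp[OF that] is_adjoint_compose[OF \<Psi>(2)[OF that(1)] \<Psi>(2)[OF that(2)]]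
    by (auto intro: is_adjoint_unique)
  have "anti_automorphism \<Psi>"
  proof
    fix X Y c assume X: "X \<in> A_ph"
    show "\<Psi> X \<in> A_ph" using \<Psi>(1)[OF X] .
    show "norm (\<Psi> X) = norm X" using is_adjoint_norm[OF \<Psi>(2)[OF X]] norm[OF X] by simp
    show "\<Psi> (scaleC_op c X) = scaleC_op (cnj c) (\<Psi> X)"
      using \<Psi>(2)[OF A_ph_scaleC[OF X]] is_adjoint_scaleC[OF \<Psi>(2)[OF X]] unfolding scale[OF X]
      by (rule is_adjoint_unique)
    assume Y: "Y \<in> A_ph"
    show "\<Psi> (X + Y) = \<Psi> X + \<Psi> Y"
      using \<Psi>(2)[OF A_ph_add[OF X Y]] is_adjoint_add[OF \<Psi>(2)[OF X] \<Psi>(2)[OF Y]] unfolding add[OF X Y]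
      by (rule is_adjoint_unique)
    show "\<Psi> (X o\<^sub>L Y) = \<Psi> Y o\<^sub>L \<Psi> X" using comp'[OF X Y] .
  next
    fix X assume "X \<in> A_ph_gens"
    then show "\<exists>Y\<in>A_ph. \<Psi> Y = X" using generator_has_adjoint gens_A_ph range by meson
  next
    have "is_adjoint id_blinfun id_blinfun" by (simp add: is_adjoint_def)
    then obtain E where E: "E \<in> A_ph" "\<Psi> E = id_blinfun" using range[OF id_A_ph] by blast
    have "id_blinfun = \<Psi> (E o\<^sub>L id_blinfun)" using E by simp
    also have "\<dots> = \<Psi> id_blinfun o\<^sub>L \<Psi> E" using comp'[OF E(1) id_A_ph] by simp
    finally show "\<Psi> id_blinfun = id_blinfun" using E by simp
  qed
  then show False by (rule anti_automorphism.no_anti_automorphism)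
qed

end
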